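(* For any $k\in\mathbb{N}$, let $\eta^k=\left(\binom{k+1}{2},\binom{k}{2},\dots,\binom{2}{2}\right)$ and $\delta^k=(k,(k-1)^2,\dots,1^k)$. Then, for any triple of partitions $\lambda$, $\mu$, $\nu$ of the same size, there is an $L\in\mathbb{N}$ such that for all $n\ge L$, $$\mathsf{g}(\lambda+n\eta^k,\ \mu+n\eta^k,\ \nu+n\delta^k)=\mathsf{g}(\lambda+L\eta^k,\ \mu+L\eta^k,\ \nu+L\delta^k).$$
   Context: $\mathbb{N}$ is the set of positive integers. A partition is a weakly decreasing sequence of positive integers; its size is the sum of its parts. In a partition, $i^{r}$ stands for $r$ parts equal to $i$; thus $\delta^k=(k,(k-1)^2,\dots,1^k)$ has one part equal to $k$, two parts equal to $k-1$, and in general $k+1-i$ parts equal to $i$ for $1\le i\le k$. The sum of two partitions is taken coordinatewise after appending zeros to the shorter one, and $n\alpha$ is the partition $\alpha$ with every part multiplied by $n$. For partitions $\lambda,\mu,\nu$ of $m$, let $\chi^\lambda$ denote the irreducible complex character of the symmetric group $S_m$ associated to $\lambda$. The Kronecker coefficient is $\mathsf{g}(\lambda,\mu,\nu)=\langle\chi^\lambda\otimes\chi^\mu,\chi^\nu\rangle$, the multiplicity of $\chi^\nu$ in $\chi^\lambda\otimes\chi^\mu$. *)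

theory Defs
  imports Complex_Main "HOL-Library.Function_Algebras" "HOL-Combinatorics.Permutations"
begin

section \<open>Partitions\<close>

definition partition_of :: "nat \<Rightarrow> nat list \<Rightarrow> bool" where
  "partition_of m lam \<longleftrightarrow> sorted_wrt (\<ge>) lam \<and> (\<forall>a\<in>set lam. 0 < a) \<and> sum_list lam = m"

fun padd :: "nat list \<Rightarrow> nat list \<Rightarrow> nat list" where
  "padd [] bs = bs"
| "padd as [] = as"
| "padd (a # as) (b # bs) = (a + b) # padd as bs"

definition pscale :: "nat \<Rightarrow> nat list \<Rightarrow> nat list" where
  "pscale n lam = map ((*) n) lam"

definition eta :: "nat \<Rightarrow> nat list" where
  "eta k = map (\<lambda>j. j choose 2) (rev [2..<k + 2])"

definition delta :: "nat \<Rightarrow> nat list" where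
  "delta k = concat (map (\<lambda>i. replicate (k + 1 - i) i) (rev [1..<k + 1]))"

section \<open>Irreducible characters of the symmetric group\<close>

text \<open>
  The symmetric group on \<open>m\<close> letters is the set of all \<open>p\<close> with \<open>p permutes {..<m}\<close>, under
  composition. An element of its group algebra is a function from permutations to complex
  numbers, vanishing off the group; the next interpretation supplies the pointwise complex
  vector space structure on all functions.
\<close>

interpretation cfun: vector_space "\<lambda>(c :: complex) (f :: (nat \<Rightarrow> nat) \<Rightarrow> complex) x. c * f x"
  by unfold_locales (auto simp: fun_eq_iff algebra_simps)

text \<open>
  The tableau used for \<open>lam\<close> is the one filled with \<open>0, 1, 2, \<dots>\<close> along the rows, top to bottom:
  entry \<open>x\<close> lies in the box \<open>boxes lam ! x\<close>, a pair (row, column).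
\<close>

definition boxes :: "nat list \<Rightarrow> (nat \<times> nat) list" where
  "boxes lam = concat (map (\<lambda>i. map (Pair i) [0..<lam ! i]) [0..<length lam])"

definition row_group :: "nat list \<Rightarrow> (nat \<Rightarrow> nat) set" where
  "row_group lam = {p. p permutes {..<sum_list lam} \<and>
     (\<forall>x<sum_list lam. fst (boxes lam ! p x) = fst (boxes lam ! x))}"

definition column_group :: "nat list \<Rightarrow> (nat \<Rightarrow> nat) set" where
  "column_group lam = {p. p permutes {..<sum_list lam} \<and>
     (\<forall>x<sum_list lam. snd (boxes lam ! p x) = snd (boxes lam ! x))}"

text \<open>The element \<open>\<Sum>\<^sub>p \<Sum>\<^sub>q sgn(q) pq\<close>, with \<open>p\<close> in the row group and \<open>q\<close> in the column group.\<close>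

definition young_symmetrizer :: "nat list \<Rightarrow> (nat \<Rightarrow> nat) \<Rightarrow> complex" where
  "young_symmetrizer lam g =
     (\<Sum>p\<in>row_group lam. \<Sum>q\<in>column_group lam. if g = p \<circ> q then of_int (sign q) else 0)"

text \<open>Left multiplication by \<open>p\<close> on the group algebra: it sends the basis vector of \<open>h\<close> to that of \<open>p \<circ> h\<close>.\<close>

definition translate :: "(nat \<Rightarrow> nat) \<Rightarrow> ((nat \<Rightarrow> nat) \<Rightarrow> complex) \<Rightarrow> ((nat \<Rightarrow> nat) \<Rightarrow> complex)" where
  "translate p f = (\<lambda>g. f (inv p \<circ> g))"

text \<open>The irreducible module of \<open>lam\<close>: the left ideal generated by the Young symmetrizer.\<close>

definition irr_module :: "nat list \<Rightarrow> ((nat \<Rightarrow> nat) \<Rightarrow> complex) set" where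
  "irr_module lam =
     cfun.span ((\<lambda>p. translate p (young_symmetrizer lam)) ` {p. p permutes {..<sum_list lam}})"

text \<open>The trace of \<open>T\<close> on a finite-dimensional \<open>T\<close>-invariant subspace \<open>V\<close>; it does not depend on
  the basis chosen.\<close>

definition trace_on ::
  "((nat \<Rightarrow> nat) \<Rightarrow> complex) set \<Rightarrow> (((nat \<Rightarrow> nat) \<Rightarrow> complex) \<Rightarrow> ((nat \<Rightarrow> nat) \<Rightarrow> complex)) \<Rightarrow> complex"
where
  "trace_on V T =
     (let B = (SOME B. cfun.independent B \<and> cfun.span B = V)
      in \<Sum>b\<in>B. cfun.representation B (T b) b)"

definition irr_char :: "nat list \<Rightarrow> (nat \<Rightarrow> nat) \<Rightarrow> complex" where
  "irr_char lam p = trace_on (irr_module lam) (translate p)"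

section \<open>Kronecker coefficients\<close>

definition char_inner :: "nat \<Rightarrow> ((nat \<Rightarrow> nat) \<Rightarrow> complex) \<Rightarrow> ((nat \<Rightarrow> nat) \<Rightarrow> complex) \<Rightarrow> complex" where
  "char_inner m \<phi> \<psi> = (\<Sum>p | p permutes {..<m}. \<phi> p * cnj (\<psi> p)) / fact m"

text \<open>Meaningful only for three partitions of the same size, which is read off from \<open>lam\<close>. The
  character of a tensor product is the pointwise product.\<close>

definition kronecker :: "nat list \<Rightarrow> nat list \<Rightarrow> nat list \<Rightarrow> complex" where
  "kronecker lam mu nu =
     char_inner (sum_list lam) (\<lambda>p. irr_char lam p * irr_char mu p) (irr_char nu)"

end

theory Submission
  imports Defs "HOL-Library.FuncSet" "HOL-Combinatorics.List_Permutation"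
begin

text \<open>
  The idea is to write a Kronecker coefficient as an alternating sum of Kostka numbers over matrices
  with prescribed margins, and to see that along the given direction only finitely many matrices
  matter, each with a Kostka number that becomes constant.

  Let \<open>\<phi>\<^sup>a\<close> be the character of the symmetric group on the words of content \<open>a\<close>, and \<open>\<rho>\<close> the
  staircase. The irreducible character of \<open>\<lambda>\<close> is the alternating sum of the \<open>\<phi>\<^sup>a\<close> with
  \<open>a = \<lambda> + \<rho> - \<rho> \<circ> q\<close> over all permutations \<open>q\<close> of the rows
  (\<open>irr_char_eq_determinantal_char\<close>). To prove this it is enough that both class functions have norm
  \<open>1\<close> and inner product \<open>1\<close>. On the side of the module, the Young symmetrizer \<open>c\<close> satisfies
  \<open>c * c = h c\<close>, so the character is a sum of \<open>c\<close> over conjugates, divided by \<open>h\<close> (\<open>trace_irr\<close>), and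
  its inner product with \<open>\<phi>\<^sup>a\<close> vanishes unless \<open>\<lambda>\<close> dominates \<open>a\<close>. On the side of the determinant,
  the inner product with \<open>\<phi>\<^sup>a\<close> is a Kostka number, for which a sign reversing involution gives the
  Pieri rule (\<open>pieri\<close>) and hence the same triangularity with respect to dominance.

  A product \<open>\<phi>\<^sup>a \<phi>\<^sup>b\<close> is the sum of \<open>\<phi>\<^sup>A\<close> over all matrices \<open>A\<close> with row sums \<open>a\<close> and column sums
  \<open>b\<close>. So the Kronecker coefficient is an alternating sum, over such matrices, of the Kostka numbers of
  shape \<open>\<nu>\<close> and weight \<open>A\<close> (\<open>kronecker_expansion\<close>).

  Now consider the triple moved by \<open>n\<close> times \<open>(\<eta>, \<eta>, \<delta>)\<close>. With indices from \<open>0\<close>, the matrix \<open>A0\<close> with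
  entries \<open>max 0 (k - i - j)\<close> has both margins \<open>\<eta>\<close>, and its nonzero entries are the parts of \<open>\<delta>\<close>. It
  is additive: its entries are the positive parts of a function of the row plus a function of the
  column. The Kostka number of a matrix \<open>A\<close> vanishes unless \<open>\<nu> + n \<delta>\<close> dominates \<open>A\<close>, which bounds
  from above how much \<open>A\<close> exceeds \<open>n A0\<close> on the large entries of \<open>A0\<close>; the margins of \<open>A\<close> fix the sum of
  \<open>A\<close> against that additive function. Together these confine \<open>A - n A0\<close> to a finite set independent of
  \<open>n\<close> (\<open>perturbation_bounded\<close>). For a fixed difference \<open>B\<close>, the Kostka number of shape \<open>\<nu> + n \<delta>\<close> and
  weight \<open>n A0 + B\<close> is eventually constant, by induction on the number of horizontal strips
  (\<open>kostka_stable\<close>): up to translation by multiples of \<open>n\<close> there are finitely many candidates for each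
  strip, and each is subject to linear inequalities in \<open>n\<close>, which eventually hold for all \<open>n\<close> or for
  none.
\<close>

section \<open>Words and their contents\<close>

abbreviation Sym :: "nat \<Rightarrow> (nat \<Rightarrow> nat) set" where
  "Sym m \<equiv> {p. p permutes {..<m}}"

definition content :: "nat \<Rightarrow> (nat \<Rightarrow> 'a) \<Rightarrow> 'a \<Rightarrow> int" where
  "content m w i = int (card {x. x < m \<and> w x = i})"

definition contents :: "'a set \<Rightarrow> nat \<Rightarrow> ('a \<Rightarrow> int) set" where
  "contents X m = {c. (\<forall>x. 0 \<le> c x) \<and> (\<forall>x. x \<notin> X \<longrightarrow> c x = 0) \<and> sum c X = int m}"

abbreviation words :: "nat \<Rightarrow> 'a set \<Rightarrow> (nat \<Rightarrow> 'a) set" where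
  "words m X \<equiv> {..<m} \<rightarrow>\<^sub>E X"

lemma finite_words: "finite X \<Longrightarrow> finite (words m X)"
  by (intro finite_PiE) auto

lemma finite_Sym [simp]: "finite (Sym m)"
  by (simp add: finite_permutations)

lemma words_comp:
  assumes "w \<in> words m X" "p \<in> Sym m"
  shows "w \<circ> p \<in> words m X"
proof -
  have p: "p permutes {..<m}" using assms by simp
  have "(w \<circ> p) x = undefined" if "x \<notin> {..<m}" for x
    using assms(1) that permutes_not_in[OF p that] by (auto simp: PiE_iff extensional_def)
  moreover have "(w \<circ> p) x \<in> X" if "x \<in> {..<m}" for x
    using assms(1) permutes_in_image[OF p, of x] that by (auto simp: PiE_iff)
  ultimately show ?thesis by (auto simp: PiE_iff extensional_def)
qed

lemma content_comp:
  assumes "p \<in> Sym m"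
  shows "content m (w \<circ> p) = content m w"
proof
  fix i
  have p: "p permutes {..<m}" using assms by simp
  have "{x. x < m \<and> w x = i} = p ` {x. x < m \<and> (w \<circ> p) x = i}"
  proof (intro set_eqI iffI)
    fix x assume "x \<in> {x. x < m \<and> w x = i}"
    then have "x < m" "w x = i" by auto
    then have "inv p x < m" "p (inv p x) = x"
      using permutes_in_image[OF permutes_inv[OF p], of x] permutes_inverses(1)[OF p] by auto
    then show "x \<in> p ` {x. x < m \<and> (w \<circ> p) x = i}"
      using \<open>w x = i\<close> by (intro image_eqI[of _ _ "inv p x"]) auto
  qed (use permutes_in_image[OF p] in auto)
  then show "content m (w \<circ> p) i = content m w i"
    unfolding content_def using card_image[OF inj_on_subset[OF permutes_inj[OF p] subset_UNIV]] by metis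
qed

lemma content_in_contents:
  assumes "finite X" "w \<in> words m X"
  shows "content m w \<in> contents X m"
proof -
  have "(\<Sum>i\<in>X. card {x. x < m \<and> w x = i}) = card (\<Union>i\<in>X. {x. x < m \<and> w x = i})"
    by (subst card_UN_disjoint) (use assms in auto)
  also have "(\<Union>i\<in>X. {x. x < m \<and> w x = i}) = {..<m}"
    using assms(2) by (auto simp: PiE_iff)
  finally have "(\<Sum>i\<in>X. content m w i) = int m"
    unfolding content_def by (simp flip: of_nat_sum)
  moreover have "content m w x = 0" if "x \<notin> X" for x
    using assms(2) that by (auto simp: content_def PiE_iff)
  ultimately show ?thesis
    by (auto simp: contents_def content_def)
qed

lemma content_mset: "content m w i = int (count (mset (map w [0..<m])) i)"
proof -
  have "{j. j < length (map w [0..<m]) \<and> i = map w [0..<m] ! j} = {x. x < m \<and> w x = i}"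
    by auto
  then show ?thesis
    using length_filter_conv_card[of "(=) i" "map w [0..<m]"] count_mset[of "map w [0..<m]" i]
    by (simp only: content_def count_list_eq_length_filter)
qed

lemma same_content_permute:
  assumes "w \<in> words m X" "w' \<in> words m X" "content m w = content m w'"
  shows "\<exists>p\<in>Sym m. w' = w \<circ> p"
proof -
  have "mset (map w' [0..<m]) = mset (map w [0..<m])"
    using assms(3) by (intro multiset_eqI) (metis content_mset of_nat_eq_iff)
  then obtain p where p: "p permutes {..<length (map w [0..<m])}"
    "permute_list p (map w [0..<m]) = map w' [0..<m]"
    by (rule mset_eq_permutation)
  then have p': "p \<in> Sym m" by simp
  have "w' x = (w \<circ> p) x" if "x < m" for x
  proof -
    have "p x < m" using permutes_in_image[OF p(1), of x] that by simp
    then show ?thesis using arg_cong[OF p(2), of "\<lambda>l. l ! x"] that p(1)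
      by (simp add: permute_list_nth)
  qed
  then have "w' = w \<circ> p"
    using assms(2) words_comp[OF assms(1) p'] by (intro PiE_ext[of _ "{..<m}"]) auto
  with p' show ?thesis by blast
qed

lemma ex_word_of_content:
  assumes X: "finite X" and c: "c \<in> contents X m"
  shows "\<exists>w\<in>words m X. content m w = c"
proof -
  define M where "M = (\<Sum>x\<in>X. replicate_mset (nat (c x)) x)"
  have cnt: "count M i = nat (c i)" for i
  proof -
    have "count M i = (\<Sum>x\<in>X. if x = i then nat (c x) else 0)"
      unfolding M_def count_sum by (intro sum.cong) auto
    also have "\<dots> = nat (c i)"
      using X c by (auto simp: contents_def)
    finally show ?thesis .
  qed
  obtain xs where xs: "mset xs = M" using ex_mset by blast
  have "int (size M) = (\<Sum>x\<in>X. int (nat (c x)))" by (simp add: M_def)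
  also have "\<dots> = int m" using c by (simp add: contents_def)
  finally have len: "length xs = m" using xs size_mset[of xs] by simp
  define w where "w = restrict (\<lambda>x. xs ! x) {..<m}"
  have map: "map w [0..<m] = xs"
    using len by (intro nth_equalityI) (auto simp: w_def)
  have "set xs \<subseteq> X"
  proof
    fix x assume "x \<in> set xs"
    then have "0 < count M x" using count_mset_gt_0[of x xs] xs by simp
    then have "0 < c x" using cnt by simp
    then show "x \<in> X" using c by (auto simp: contents_def)
  qed
  then have "w \<in> words m X"
    using len by (auto simp: w_def set_conv_nth)
  moreover have "content m w = c"
  proof
    fix i show "content m w i = c i"
      unfolding content_mset map xs cnt using c by (simp add: contents_def)
  qed
  ultimately show ?thesis by blast
qed

text \<open>The permutations carrying \<open>w'\<close> to \<open>w\<close> form a coset of the stabilizer of \<open>w\<close>, because the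
  symmetric group acts transitively on the words of a given content.\<close>

lemma card_translates:
  assumes w: "w \<in> words m X" "w' \<in> words m X" "content m w = content m w'"
  shows "card {p\<in>Sym m. w' \<circ> p = w} = card {p\<in>Sym m. w \<circ> p = w}"
proof -
  obtain q where q: "q permutes {..<m}" "w = w' \<circ> q"
    using same_content_permute[OF w(2,1)] w(3) by auto
  have "bij_betw (\<lambda>p. q \<circ> p) {p\<in>Sym m. w \<circ> p = w} {p\<in>Sym m. w' \<circ> p = w}"
  proof (rule bij_betw_byWitness[where f' = "\<lambda>p. inv q \<circ> p"])
    show "\<forall>p\<in>{p\<in>Sym m. w \<circ> p = w}. inv q \<circ> (q \<circ> p) = p"
      using permutes_inv_o(2)[OF q(1)] by (auto simp flip: comp_assoc)
    show "\<forall>p\<in>{p\<in>Sym m. w' \<circ> p = w}. q \<circ> (inv q \<circ> p) = p"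
      using permutes_inv_o(1)[OF q(1)] by (auto simp flip: comp_assoc)
    show "(\<lambda>p. q \<circ> p) ` {p\<in>Sym m. w \<circ> p = w} \<subseteq> {p\<in>Sym m. w' \<circ> p = w}"
      using q by (auto simp: permutes_compose comp_assoc)
    show "(\<lambda>p. inv q \<circ> p) ` {p\<in>Sym m. w' \<circ> p = w} \<subseteq> {p\<in>Sym m. w \<circ> p = w}"
    proof clarsimp
      fix p assume p: "p permutes {..<m}" "w = w' \<circ> p"
      have "w \<circ> (inv q \<circ> p) = w' \<circ> (q \<circ> inv q) \<circ> p" by (simp add: q(2) comp_assoc)
      then show "inv q \<circ> p permutes {..<m} \<and> w' \<circ> p \<circ> (inv q \<circ> p) = w' \<circ> p"
        using p q permutes_inv_o(1)[OF q(1)] by (simp add: permutes_compose permutes_inv comp_assoc)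
    qed
  qed
  then show ?thesis by (simp add: bij_betw_same_card)
qed

text \<open>Fix one word \<open>w0\<close> of content \<open>c\<close>. Sorting all permutations by the word to which they carry
  \<open>w0\<close> splits the group into sets whose sizes are the stabilizer sizes.\<close>

lemma sum_stabilizers:
  assumes X: "finite X" and c: "c \<in> contents X m"
  shows "(\<Sum>w | w \<in> words m X \<and> content m w = c. card {p\<in>Sym m. w \<circ> p = w}) = fact m"
proof -
  obtain w0 where w0: "w0 \<in> words m X" "content m w0 = c"
    using ex_word_of_content[OF X c] by blast
  let ?W = "{w \<in> words m X. content m w = c}"
  have "(\<Sum>w\<in>?W. card {p\<in>Sym m. w \<circ> p = w}) = (\<Sum>w\<in>?W. card {p\<in>Sym m. w0 \<circ> p = w})"
    using w0 card_translates[of _ m X w0] by (intro sum.cong) auto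
  also have "\<dots> = card (\<Union>w\<in>?W. {p\<in>Sym m. w0 \<circ> p = w})"
    using finite_words[OF X] by (subst card_UN_disjoint) auto
  also have "(\<Union>w\<in>?W. {p\<in>Sym m. w0 \<circ> p = w}) = Sym m"
  proof (intro equalityI subsetI)
    fix p assume "p \<in> Sym m"
    then show "p \<in> (\<Union>w\<in>?W. {p\<in>Sym m. w0 \<circ> p = w})"
      using words_comp[OF w0(1), of p] content_comp[of p m w0] w0(2) by blast
  qed auto
  also have "card (Sym m) = fact m" by (rule card_permutations) auto
  finally show ?thesis by (simp only: Collect_conj_eq[symmetric])
qed

lemma finite_box:
  assumes "finite X"
  shows "finite {f :: 'a \<Rightarrow> int. (\<forall>x\<in>X. lo \<le> f x \<and> f x \<le> hi) \<and> (\<forall>x. x \<notin> X \<longrightarrow> f x = 0)}"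
  using finite_set_of_finite_funs[OF assms, of "{lo..hi}" 0]
  by (rule rev_finite_subset) auto

lemma finite_contents:
  assumes "finite X"
  shows "finite (contents X m)"
proof (rule finite_subset[OF _ finite_box[OF assms, of 0 "int m"]], clarsimp simp: contents_def)
  fix c :: "'a \<Rightarrow> int" and x
  assume c: "\<forall>x. 0 \<le> c x" "sum c X = int m" and x: "x \<in> X"
  have "c x \<le> sum c X" using c x assms by (intro member_le_sum) auto
  then show "c x \<le> int m" using c by simp
qed

text \<open>Burnside's lemma for words: the orbits of the symmetric group are exactly the sets of words
  with a common content. The inner product of two permutation characters is the instance for
  words of pairs, with \<open>Q\<close> prescribing the contents of both components.\<close>

lemma burnside_words:
  assumes X: "finite X"
  shows "(\<Sum>p\<in>Sym m. int (card {w \<in> words m X. Q (content m w) \<and> w \<circ> p = w}))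
    = fact m * int (card {c \<in> contents X m. Q c})"
proof -
  let ?W = "{w \<in> words m X. Q (content m w)}"
  have fW: "finite ?W" using finite_words[OF X] by simp
  have "(\<Sum>p\<in>Sym m. card {w \<in> words m X. Q (content m w) \<and> w \<circ> p = w})
      = (\<Sum>p\<in>Sym m. \<Sum>w\<in>?W. if w \<circ> p = w then 1 else 0)"
  proof (intro sum.cong refl)
    fix p
    show "card {w \<in> words m X. Q (content m w) \<and> w \<circ> p = w} = (\<Sum>w\<in>?W. if w \<circ> p = w then 1 else 0)"
      using fW by (subst sum.inter_filter[symmetric]) (auto intro!: arg_cong[of _ _ card])
  qed
  also have "\<dots> = (\<Sum>w\<in>?W. \<Sum>p\<in>Sym m. if w \<circ> p = w then 1 else 0)" by (rule sum.swap)
  also have "\<dots> = (\<Sum>w\<in>?W. card {p\<in>Sym m. w \<circ> p = w})"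
    by (intro sum.cong refl) (subst sum.inter_filter[symmetric]; simp)
  also have "\<dots> = (\<Sum>c | c \<in> contents X m \<and> Q c. \<Sum>w | w \<in> ?W \<and> content m w = c. card {p\<in>Sym m. w \<circ> p = w})"
    using content_in_contents[OF X] finite_contents[OF X] fW
    by (intro sum.group[symmetric]) auto
  also have "\<dots> = (\<Sum>c | c \<in> contents X m \<and> Q c. fact m)"
  proof (intro sum.cong refl)
    fix c assume c: "c \<in> {c. c \<in> contents X m \<and> Q c}"
    then have "{w. w \<in> ?W \<and> content m w = c} = {w. w \<in> words m X \<and> content m w = c}" by auto
    then show "(\<Sum>w | w \<in> ?W \<and> content m w = c. card {p\<in>Sym m. w \<circ> p = w}) = fact m"
      using sum_stabilizers[OF X, of c m] c by simp
  qed
  finally show ?thesis by (simp flip: of_nat_sum add: mult.commute)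
qed

section \<open>Matrices with given margins and Kostka numbers\<close>

definition margin_matrices :: "nat \<Rightarrow> nat \<Rightarrow> (nat \<Rightarrow> int) \<Rightarrow> (nat \<Rightarrow> int) \<Rightarrow> (nat \<times> nat \<Rightarrow> int) set" where
  "margin_matrices N s a b = {T. (\<forall>z. 0 \<le> T z) \<and> (\<forall>z. z \<notin> {..<N} \<times> {..<s} \<longrightarrow> T z = 0) \<and>
     (\<forall>i<N. (\<Sum>j<s. T (i, j)) = a i) \<and> (\<forall>j<s. (\<Sum>i<N. T (i, j)) = b j)}"

definition weak_compositions :: "nat \<Rightarrow> int \<Rightarrow> (nat \<Rightarrow> int) set" where
  "weak_compositions s n = {c. (\<forall>j. 0 \<le> c j) \<and> (\<forall>j\<ge>s. c j = 0) \<and> (\<Sum>j<s. c j) = n}"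

lemma finite_weak_compositions: "finite (weak_compositions s n)"
proof (rule finite_subset[OF _ finite_box[of "{..<s}" 0 n]], clarsimp simp: weak_compositions_def)
  fix c :: "nat \<Rightarrow> int" and x
  assume "\<forall>j. 0 \<le> c j" "x < s"
  then show "c x \<le> sum c {..<s}" by (intro member_le_sum) auto
qed auto

lemma finite_margin_matrices: "finite (margin_matrices N s a b)"
proof (rule finite_subset[OF _ finite_box[of "{..<N} \<times> {..<s}" 0 "\<Sum>i<N. \<bar>a i\<bar>"]])
  show "margin_matrices N s a b \<subseteq> {f. (\<forall>x\<in>{..<N} \<times> {..<s}. 0 \<le> f x \<and> f x \<le> (\<Sum>i<N. \<bar>a i\<bar>)) \<and>
       (\<forall>x. x \<notin> {..<N} \<times> {..<s} \<longrightarrow> f x = 0)}"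
  proof
    fix T assume T: "T \<in> margin_matrices N s a b"
    have "T (i, j) \<le> (\<Sum>i<N. \<bar>a i\<bar>)" if "i < N" "j < s" for i j
    proof -
      have "T (i, j) \<le> (\<Sum>j<s. T (i, j))"
        using T that by (intro member_le_sum[where f = "\<lambda>j. T (i, j)"]) (auto simp: margin_matrices_def)
      also have "\<dots> \<le> \<bar>a i\<bar>" using T that by (auto simp: margin_matrices_def)
      also have "\<dots> \<le> (\<Sum>i<N. \<bar>a i\<bar>)"
        using that by (intro member_le_sum[where f = "\<lambda>i. \<bar>a i\<bar>"]) auto
      finally show ?thesis .
    qed
    then show "T \<in> {f. (\<forall>x\<in>{..<N} \<times> {..<s}. 0 \<le> f x \<and> f x \<le> (\<Sum>i<N. \<bar>a i\<bar>)) \<and>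
       (\<forall>x. x \<notin> {..<N} \<times> {..<s} \<longrightarrow> f x = 0)}"
      using T by (auto simp: margin_matrices_def)
  qed
qed simp

lemma card_margin_matrices_permute_le:
  assumes p: "p permutes {..<N}" and q: "q permutes {..<s}"
  shows "card (margin_matrices N s a b) \<le> card (margin_matrices N s (a \<circ> p) (b \<circ> q))"
proof (rule card_inj_on_le[where f = "\<lambda>T. T \<circ> map_prod p q"])
  have "surj (map_prod p q)"
    using permutes_surj[OF p] permutes_surj[OF q] by (simp add: map_prod_surj)
  then show "inj_on (\<lambda>T. T \<circ> map_prod p q) (margin_matrices N s a b)"
    by (auto simp: inj_on_def fun_eq_iff) (metis surj_pair surjD map_prod_simp)
  show "(\<lambda>T. T \<circ> map_prod p q) ` margin_matrices N s a b \<subseteq> margin_matrices N s (a \<circ> p) (b \<circ> q)"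
  proof clarify
    fix T assume T: "T \<in> margin_matrices N s a b"
    have row: "(\<Sum>j<s. T (i, q j)) = (\<Sum>j<s. T (i, j))" for i
      using sum.permute[OF q, of "\<lambda>j. T (i, j)"] by simp
    have col: "(\<Sum>i<N. T (p i, j)) = (\<Sum>i<N. T (i, j))" for j
      using sum.permute[OF p, of "\<lambda>i. T (i, j)"] by simp
    show "T \<circ> map_prod p q \<in> margin_matrices N s (a \<circ> p) (b \<circ> q)"
      using T permutes_in_image[OF p] permutes_in_image[OF q]
      by (auto simp: margin_matrices_def row col)
  qed
qed (rule finite_margin_matrices)

lemma card_margin_matrices_permute:
  assumes p: "p permutes {..<N}" and q: "q permutes {..<s}"
  shows "card (margin_matrices N s (a \<circ> p) (b \<circ> q)) = card (margin_matrices N s a b)"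
proof (rule antisym)
  have "(a \<circ> p) \<circ> inv p = a" "(b \<circ> q) \<circ> inv q = b"
    using permutes_inv_o[OF p] permutes_inv_o[OF q] by (simp_all add: comp_assoc)
  then show "card (margin_matrices N s (a \<circ> p) (b \<circ> q)) \<le> card (margin_matrices N s a b)"
    using card_margin_matrices_permute_le[OF permutes_inv[OF p] permutes_inv[OF q], of "a \<circ> p" "b \<circ> q"]
    by (simp only:)
qed (rule card_margin_matrices_permute_le[OF p q])

lemma margin_matrices_cong:
  assumes "\<And>i. i < N \<Longrightarrow> a i = a' i" "\<And>j. j < s \<Longrightarrow> b j = b' j"
  shows "margin_matrices N s a b = margin_matrices N s a' b'"
  unfolding margin_matrices_def by (intro Collect_cong conj_cong refl) (simp_all add: assms)

lemma card_margin_matrices_last_row: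
  assumes c: "c \<in> weak_compositions s (a N)"
  shows "card {T \<in> margin_matrices (Suc N) s a b. (\<lambda>j. T (N, j)) = c} = card (margin_matrices N s a (\<lambda>j. b j - c j))"
proof -
  let ?cut = "\<lambda>T (i, j). if i < N then T (i, j) else 0 :: int"
  let ?ext = "\<lambda>T (i, j). if i = N then c j else T (i, j)"
  have "bij_betw ?cut {T \<in> margin_matrices (Suc N) s a b. (\<lambda>j. T (N, j)) = c} (margin_matrices N s a (\<lambda>j. b j - c j))"
  proof (rule bij_betw_byWitness[where f' = ?ext])
  show "\<forall>T\<in>{T \<in> margin_matrices (Suc N) s a b. (\<lambda>j. T (N, j)) = c}. ?ext (?cut T) = T"
    by (auto simp: fun_eq_iff margin_matrices_def)
  show "\<forall>T\<in>margin_matrices N s a (\<lambda>j. b j - c j). ?cut (?ext T) = T"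
    by (auto simp: fun_eq_iff margin_matrices_def)
  show "?cut ` {T \<in> margin_matrices (Suc N) s a b. (\<lambda>j. T (N, j)) = c} \<subseteq> margin_matrices N s a (\<lambda>j. b j - c j)"
  proof clarify
    fix T assume T: "T \<in> margin_matrices (Suc N) s a b" "c = (\<lambda>j. T (N, j))"
    then have "(\<Sum>i<N. T (i, j)) = b j - T (N, j)" if "j < s" for j
      using that by (auto simp: margin_matrices_def)
    then show "?cut T \<in> margin_matrices N s a (\<lambda>j. b j - T (N, j))"
      using T by (auto simp: margin_matrices_def)
  qed
  show "?ext ` margin_matrices N s a (\<lambda>j. b j - c j) \<subseteq> {T \<in> margin_matrices (Suc N) s a b. (\<lambda>j. T (N, j)) = c}"
    using c by (auto simp: margin_matrices_def weak_compositions_def less_Suc_eq)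
  qed
  then show ?thesis by (rule bij_betw_same_card)
qed

lemma card_margin_matrices_Suc:
  "card (margin_matrices (Suc N) s a b) = (\<Sum>c\<in>weak_compositions s (a N). card (margin_matrices N s a (\<lambda>j. b j - c j)))"
proof -
  have "card (margin_matrices (Suc N) s a b) = (\<Sum>c\<in>weak_compositions s (a N). card {T \<in> margin_matrices (Suc N) s a b. (\<lambda>j. T (N, j)) = c})"
    unfolding card_eq_sum
    by (rule sum.group[symmetric]) (auto simp: finite_margin_matrices finite_weak_compositions, auto simp: margin_matrices_def weak_compositions_def)
  then show ?thesis by (simp add: card_margin_matrices_last_row)
qed

text \<open>The vector \<open>(s - 1, \<dots>, 1, 0)\<close>, usually called \<open>\<rho>\<close>; it is extended by \<open>0\<close>.\<close>

definition staircase :: "nat \<Rightarrow> nat \<Rightarrow> int" where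
  "staircase s i = (if i < s then int s - 1 - int i else 0)"

text \<open>When \<open>l\<close> is a partition with at most \<open>s\<close> parts plus the staircase, this is the Kostka number of
  that partition and the weight \<open>(a 0, \<dots>, a (N - 1))\<close>. The alternating sum over matrices is used as
  the definition because it is the inner product of a permutation character with a determinantal
  one, and because it makes sense for every integer vector \<open>l\<close>: the antisymmetry in \<open>l\<close> gives the
  Pieri rule.\<close>

definition kostka :: "nat \<Rightarrow> nat \<Rightarrow> (nat \<Rightarrow> int) \<Rightarrow> (nat \<Rightarrow> int) \<Rightarrow> int" where
  "kostka N s a l = (\<Sum>p\<in>Sym s. sign p * int (card (margin_matrices N s a (\<lambda>j. l j - staircase s (p j)))))"

definition strictly_decreasing :: "nat \<Rightarrow> (nat \<Rightarrow> int) \<Rightarrow> bool" where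
  "strictly_decreasing s l \<longleftrightarrow> (\<forall>i. Suc i < s \<longrightarrow> l (Suc i) < l i)"

lemma strictly_decreasing_less: "strictly_decreasing s l \<Longrightarrow> i < j \<Longrightarrow> j < s \<Longrightarrow> l j < l i"
proof (induction j)
  case (Suc j)
  then have "l (Suc j) < l j" by (auto simp: strictly_decreasing_def)
  moreover have "l j \<le> l i" using Suc by (cases "i = j") auto
  ultimately show ?case by simp
qed simp

text \<open>Visible from the alternating sum, hidden in the recursive description by horizontal strips:
  the weights may be reordered.\<close>

lemma kostka_permute_weights:
  assumes "p permutes {..<N}"
  shows "kostka N s (a \<circ> p) l = kostka N s a l"
  unfolding kostka_def
  using card_margin_matrices_permute[OF assms permutes_id, of s a] by (simp add: id_def o_def)

lemma kostka_cong:
  assumes "\<And>i. i < N \<Longrightarrow> a i = a' i" "\<And>j. j < s \<Longrightarrow> l j = l' j"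
  shows "kostka N s a l = kostka N s a' l'"
  unfolding kostka_def by (intro sum.cong refl arg_cong2[of _ _ _ _ "(*)"] arg_cong[of _ _ int]
    arg_cong[of _ _ card] margin_matrices_cong) (use assms in auto)

text \<open>A permutation of the entries of \<open>l\<close> is absorbed by permuting the columns of the matrices, at
  the price of composing the summation index with it.\<close>

lemma kostka_antisym:
  assumes q: "q permutes {..<s}"
  shows "kostka N s a (l \<circ> q) = sign q * kostka N s a l"
proof -
  have pq: "permutation q" using q permutation_permutes by blast
  have "kostka N s a (l \<circ> q)
      = (\<Sum>p\<in>Sym s. sign (p \<circ> q) * int (card (margin_matrices N s a (\<lambda>j. (l \<circ> q) j - staircase s ((p \<circ> q) j)))))"
    unfolding kostka_def by (rule sum_permutations_compose_right[OF q])
  also have "\<dots> = (\<Sum>p\<in>Sym s. sign q * (sign p * int (card (margin_matrices N s a (\<lambda>j. l j - staircase s (p j))))))"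
  proof (intro sum.cong refl)
    fix p assume "p \<in> Sym s"
    then have "permutation p" using permutation_permutes by blast
    then have sg: "sign (p \<circ> q) = sign q * sign p" using pq by (simp add: sign_compose)
    have "card (margin_matrices N s (a \<circ> id) ((\<lambda>j. l j - staircase s (p j)) \<circ> q))
        = card (margin_matrices N s a (\<lambda>j. l j - staircase s (p j)))"
      by (rule card_margin_matrices_permute[OF permutes_id q])
    then show "sign (p \<circ> q) * int (card (margin_matrices N s a (\<lambda>j. (l \<circ> q) j - staircase s ((p \<circ> q) j))))
      = sign q * (sign p * int (card (margin_matrices N s a (\<lambda>j. l j - staircase s (p j)))))"
      unfolding sg by (simp add: o_def)
  qed
  finally show ?thesis by (simp add: kostka_def sum_distrib_left)
qed

lemma kostka_Suc:
  "kostka (Suc N) s a l = (\<Sum>c\<in>weak_compositions s (a N). kostka N s a (\<lambda>j. l j - c j))"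
proof -
  have "kostka (Suc N) s a l = (\<Sum>p\<in>Sym s. \<Sum>c\<in>weak_compositions s (a N).
      sign p * int (card (margin_matrices N s a (\<lambda>j. l j - c j - staircase s (p j)))))"
    unfolding kostka_def card_margin_matrices_Suc by (simp add: sum_distrib_left algebra_simps)
  also have "\<dots> = (\<Sum>c\<in>weak_compositions s (a N). kostka N s a (\<lambda>j. l j - c j))"
    unfolding kostka_def by (rule sum.swap)
  finally show ?thesis .
qed

text \<open>In terms of \<open>l\<close> minus the staircase, \<open>l - c\<close> arises by removing a horizontal strip with \<open>c i\<close>
  boxes in row \<open>i\<close>: the interlacing condition \<open>\<lambda>\<^sub>i\<^sub>+\<^sub>1 \<le> \<mu>\<^sub>i\<close> becomes strict after adding the
  staircase.\<close>

definition horizontal_strips :: "nat \<Rightarrow> (nat \<Rightarrow> int) \<Rightarrow> int \<Rightarrow> (nat \<Rightarrow> int) set" where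
  "horizontal_strips s l n = {c \<in> weak_compositions s n. \<forall>i. Suc i < s \<longrightarrow> l (Suc i) < l i - c i}"

lemma finite_horizontal_strips: "finite (horizontal_strips s l n)"
  by (simp add: horizontal_strips_def finite_weak_compositions)

lemma strictly_decreasing_strip: "c \<in> horizontal_strips s l n \<Longrightarrow> strictly_decreasing s (\<lambda>j. l j - c j)"
  by (fastforce simp: horizontal_strips_def strictly_decreasing_def weak_compositions_def intro: le_less_trans[rotated])

text \<open>The expansion \<open>kostka_Suc\<close> runs over all weak compositions \<open>c\<close>, not only over horizontal
  strips. The other terms cancel in pairs. Let \<open>i\<close> be the first place where \<open>l i - c i \<le> l (i + 1)\<close>.
  Both entries \<open>i\<close> and \<open>i + 1\<close> of \<open>l - c\<close> are then at most \<open>l (i + 1)\<close>, hence also at most \<open>l i\<close>,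
  so exchanging them yields \<open>l - c'\<close> for another weak composition \<open>c'\<close>. The first bad place of
  \<open>c'\<close> is again \<open>i\<close>, and the exchange changes the sign by antisymmetry.\<close>

lemma pieri:
  assumes l: "strictly_decreasing s l"
  shows "kostka (Suc N) s a l = (\<Sum>c\<in>horizontal_strips s l (a N). kostka N s a (\<lambda>j. l j - c j))"
proof -
  define bad where "bad c i \<longleftrightarrow> Suc i < s \<and> l i - c i \<le> l (Suc i)" for c i
  define first where "first c = (LEAST i. bad c i)" for c
  \<comment> \<open>The partner of \<open>c\<close>: it exchanges the entries \<open>i\<close> and \<open>i + 1\<close> of \<open>l - c\<close>.\<close>
  define flip where "flip c = (let i = first c in
     c(i := l i - l (Suc i) + c (Suc i), Suc i := l (Suc i) - l i + c i))" for c
  define B where "B = {c \<in> weak_compositions s (a N). \<exists>i. bad c i}"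
  have bad_first: "bad c (first c)" if "c \<in> B" for c
    using that unfolding B_def first_def by (auto intro: LeastI)
  have first_flip: "first (flip c) = first c" if "c \<in> B" for c
  proof -
    have "bad (flip c) (first c)"
      using bad_first[OF that] that by (auto simp: bad_def flip_def Let_def B_def weak_compositions_def)
    moreover have "\<not> bad (flip c) j" if "j < first c" for j
      using not_less_Least[of j "bad c"] that by (auto simp: bad_def flip_def Let_def first_def)
    ultimately show ?thesis
      unfolding first_def[of "flip c"] by (metis LeastI_ex Least_le antisym_conv1 linorder_not_le)
  qed
  have flip_flip: "flip (flip c) = c" if "c \<in> B" for c
    using first_flip[OF that] by (simp add: flip_def[of "flip c"] Let_def) (auto simp: flip_def Let_def fun_eq_iff)
  have flip_B: "flip c \<in> B" if "c \<in> B" for c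
  proof -
    let ?i = "first c"
    have i: "Suc ?i < s" "l ?i - c ?i \<le> l (Suc ?i)" using bad_first[OF that] by (auto simp: bad_def)
    have c: "c \<in> weak_compositions s (a N)" using that by (simp add: B_def)
    have split: "{..<s} = insert ?i (insert (Suc ?i) ({..<s} - {?i, Suc ?i}))" using i by auto
    have "sum (flip c) {..<s} = sum c {..<s}"
      by (subst (1 2) split) (auto simp: flip_def Let_def intro!: sum.cong)
    then have "flip c \<in> weak_compositions s (a N)"
      using c i l by (auto simp: weak_compositions_def flip_def Let_def strictly_decreasing_def intro!: add_nonneg_nonneg) 
    moreover have "bad (flip c) (first (flip c))"
      using first_flip[OF that] bad_first[OF that] c by (auto simp: bad_def flip_def Let_def weak_compositions_def)
    ultimately show ?thesis by (auto simp: B_def)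
  qed
  let ?g = "\<lambda>c. kostka N s a (\<lambda>j. l j - c j)"
  have neg: "?g (flip c) = - ?g c" if "c \<in> B" for c
  proof -
    let ?i = "first c"
    have i: "Suc ?i < s" using bad_first[OF that] by (auto simp: bad_def)
    let ?t = "transpose ?i (Suc ?i)"
    have "(\<lambda>j. l j - flip c j) = (\<lambda>j. l j - c j) \<circ> ?t"
      by (auto simp: flip_def Let_def fun_eq_iff transpose_def)
    moreover have "?t permutes {..<s}" using i by (intro permutes_swap_id) auto
    ultimately show ?thesis by (simp only: kostka_antisym) (simp add: sign_swap_id)
  qed
  have "sum ?g B = (\<Sum>c\<in>B. ?g (flip c))"
    by (rule sum.reindex_bij_witness[of _ flip flip]) (auto simp: flip_flip flip_B)
  also have "\<dots> = - sum ?g B" by (simp add: neg sum_negf)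
  finally have "sum ?g B = 0" by simp
  moreover have "weak_compositions s (a N) = horizontal_strips s l (a N) \<union> B" "horizontal_strips s l (a N) \<inter> B = {}"
    by (auto simp: horizontal_strips_def B_def bad_def)
  moreover have "finite B" by (simp add: B_def finite_weak_compositions)
  ultimately show ?thesis unfolding kostka_Suc
    by (simp add: sum.union_disjoint finite_horizontal_strips)
qed

lemma permutes_increasing_id:
  assumes p: "p permutes {..<s}" and mono: "\<And>i j. i < j \<Longrightarrow> j < s \<Longrightarrow> p i < (p j :: nat)"
  shows "p = id"
proof (rule permutes_natset_ge[OF p], rule ballI)
  fix i assume "i \<in> {..<s}"
  then show "i \<le> p i"
  proof (induction i)
    case (Suc i)
    then have "i \<le> p i" "p i < p (Suc i)" using mono[of i "Suc i"] by auto
    then show ?case by simp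
  qed simp
qed

lemma kostka_0:
  assumes l: "strictly_decreasing s l"
  shows "kostka 0 s a l = (if \<forall>j<s. l j = staircase s j then 1 else 0)"
proof -
  have mat: "card (margin_matrices 0 s a b) = (if \<forall>j<s. b j = 0 then 1 else 0)" for b
  proof -
    have "margin_matrices 0 s a b = (if \<forall>j<s. b j = 0 then {\<lambda>_. 0} else {})"
      by (auto simp: margin_matrices_def fun_eq_iff)
    then show ?thesis by simp
  qed
  have id: "p = id" if "p \<in> Sym s" "\<forall>j<s. l j - staircase s (p j) = 0" for p
  proof (rule permutes_increasing_id)
    show p: "p permutes {..<s}" using that by simp
    fix i j assume ij: "i < j" "j < s"
    then have "staircase s (p j) < staircase s (p i)" using strictly_decreasing_less[OF l ij] that(2) by simp
    moreover have "p i < s" "p j < s" using ij permutes_in_image[OF p] by auto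
    ultimately show "p i < p j" by (simp add: staircase_def)
  qed
  have "kostka 0 s a l = (\<Sum>p\<in>Sym s. if p = id then (if \<forall>j<s. l j = staircase s j then 1 else 0) else 0)"
    unfolding kostka_def mat using id by (intro sum.cong refl) (auto simp: sign_id)
  then show ?thesis by (simp add: permutes_id)
qed

text \<open>Starting from the staircase, \<open>N\<close> horizontal strips can only reach the first \<open>N\<close> rows, and the
  number of boxes added is the total weight.\<close>

lemma kostka_support:
  assumes "strictly_decreasing s l" "N \<le> s" "kostka N s a l \<noteq> 0"
  shows "(\<forall>i. N \<le> i \<and> i < s \<longrightarrow> l i = staircase s i) \<and> (\<Sum>i<s. l i) = (\<Sum>i<s. staircase s i) + (\<Sum>i<N. a i)"
  using assms
proof (induction N arbitrary: l)
  case 0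
  then show ?case using kostka_0[of s l a] by (auto split: if_splits)
next
  case (Suc N)
  obtain c where c: "c \<in> horizontal_strips s l (a N)" "kostka N s a (\<lambda>j. l j - c j) \<noteq> 0"
    using Suc.prems(3) sum.not_neutral_contains_not_neutral unfolding pieri[OF Suc.prems(1)] by blast
  have IH: "\<forall>i. N \<le> i \<and> i < s \<longrightarrow> l i - c i = staircase s i"
      "(\<Sum>i<s. l i - c i) = (\<Sum>i<s. staircase s i) + (\<Sum>i<N. a i)"
    using Suc.IH[OF strictly_decreasing_strip[OF c(1)] _ c(2)] Suc.prems(2) by auto
  have "l i = staircase s i" if i: "Suc N \<le> i" "i < s" for i
  proof -
    obtain k where k: "i = Suc k" using i by (cases i) auto
    have "l i < l k - c k" "0 \<le> c i" using c(1) i k by (auto simp: horizontal_strips_def weak_compositions_def)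
    moreover have "l k - c k = staircase s k" "l i - c i = staircase s i" using IH(1) i k by auto
    ultimately show ?thesis using i k by (simp add: staircase_def)
  qed
  moreover have "(\<Sum>i<s. c i) = a N" using c(1) by (simp add: horizontal_strips_def weak_compositions_def)
  ultimately show ?case using IH(2) by (simp add: sum_subtractf)
qed

text \<open>The first \<open>t\<close> strips fill only the first \<open>t\<close> rows, and they stay inside the final shape.\<close>

lemma kostka_dominance:
  assumes "strictly_decreasing s l" "N \<le> s" "kostka N s a l \<noteq> 0" "t \<le> N"
  shows "(\<Sum>i<t. a i) \<le> (\<Sum>i<t. l i - staircase s i)"
  using assms
proof (induction N arbitrary: l)
  case (Suc N)
  show ?case
  proof (cases "t = Suc N")
    case True
    have *: "\<forall>i. Suc N \<le> i \<and> i < s \<longrightarrow> l i = staircase s i"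
      "(\<Sum>i<s. l i) = (\<Sum>i<s. staircase s i) + (\<Sum>i<Suc N. a i)"
      using kostka_support[OF Suc.prems(1-3)] by auto
    have "(\<Sum>i<Suc N. a i) = (\<Sum>i<s. l i - staircase s i)" using *(2) by (simp add: sum_subtractf)
    also have "\<dots> = (\<Sum>i<Suc N. l i - staircase s i)"
      using * Suc.prems(2) by (intro sum.mono_neutral_right) auto
    finally show ?thesis using True by simp
  next
    case False
    obtain c where c: "c \<in> horizontal_strips s l (a N)" "kostka N s a (\<lambda>j. l j - c j) \<noteq> 0"
      using Suc.prems(3) sum.not_neutral_contains_not_neutral unfolding pieri[OF Suc.prems(1)] by blast
    have "(\<Sum>i<t. a i) \<le> (\<Sum>i<t. l i - c i - staircase s i)"
      using Suc.IH[OF strictly_decreasing_strip[OF c(1)] _ c(2)] Suc.prems False by auto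
    also have "\<dots> \<le> (\<Sum>i<t. l i - staircase s i)"
      using c(1) by (intro sum_mono) (auto simp: horizontal_strips_def weak_compositions_def)
    finally show ?thesis .
  qed
qed simp

text \<open>When the weight equals the shape, the last strip has to be the complete last row: every other
  choice leaves a row that the remaining strips cannot reach.\<close>

lemma kostka_diagonal:
  fixes lam :: "nat \<Rightarrow> int"
  assumes dec: "\<And>i. lam (Suc i) \<le> lam i" and nn: "\<And>i. 0 \<le> lam i" and "N \<le> s"
  shows "kostka N s lam (\<lambda>i. (if i < N then lam i else 0) + staircase s i) = 1"
  using \<open>N \<le> s\<close>
proof (induction N)
  case 0
  have "strictly_decreasing s (staircase s)" by (auto simp: strictly_decreasing_def staircase_def)
  then show ?case by (simp add: kostka_0)
next
  case (Suc N)
  define l where "l = (\<lambda>i. (if i < Suc N then lam i else 0) + staircase s i)"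
  define c0 where "c0 = (\<lambda>i. if i = N then lam N else 0)"
  have l: "strictly_decreasing s l"
    unfolding strictly_decreasing_def l_def
  proof (intro allI impI)
    fix i assume "Suc i < s"
    then have "staircase s (Suc i) < staircase s i" by (simp add: staircase_def)
    then show "(if Suc i < Suc N then lam (Suc i) else 0) + staircase s (Suc i)
        < (if i < Suc N then lam i else 0) + staircase s i"
      using dec[of i] nn[of i] by (cases "i < N"; cases "i = N"; simp)
  qed
  have c0: "c0 \<in> horizontal_strips s l (lam N)"
  proof -
    have "c0 \<in> weak_compositions s (lam N)" using Suc.prems nn by (auto simp: weak_compositions_def c0_def)
    moreover have "l (Suc i) < l i - c0 i" if "Suc i < s" for i
    proof -
      have "staircase s (Suc i) < staircase s i" using that by (simp add: staircase_def)
      then show ?thesis using dec[of i] nn[of i] by (cases "i < N"; cases "i = N"; simp add: l_def c0_def)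
    qed
    ultimately show ?thesis by (simp add: horizontal_strips_def)
  qed
  have eq: "(\<lambda>i. l i - c0 i) = (\<lambda>i. (if i < N then lam i else 0) + staircase s i)"
    by (auto simp: l_def c0_def fun_eq_iff)
  have zero: "kostka N s lam (\<lambda>j. l j - c j) = 0" if c: "c \<in> horizontal_strips s l (lam N)" "c \<noteq> c0" for c
  proof (rule ccontr)
    assume "kostka N s lam (\<lambda>j. l j - c j) \<noteq> 0"
    then have *: "\<forall>i. N \<le> i \<and> i < s \<longrightarrow> l i - c i = staircase s i"
      using kostka_support[OF strictly_decreasing_strip[OF c(1)], of N lam] Suc.prems by auto
    have cc: "\<forall>j. 0 \<le> c j" "\<forall>j\<ge>s. c j = 0" "(\<Sum>j<s. c j) = lam N"
      using c(1) by (auto simp: horizontal_strips_def weak_compositions_def)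
    have N: "c N = lam N" using * Suc.prems by (auto simp: l_def)
    have "(\<Sum>j<s. c j) = c N + (\<Sum>j\<in>{..<s} - {N}. c j)"
      using Suc.prems by (subst sum.remove[of _ N]) auto
    then have "(\<Sum>j\<in>{..<s} - {N}. c j) = 0" using N cc(3) by simp
    then have "\<forall>j\<in>{..<s} - {N}. c j = 0"
      using cc(1) by (subst (asm) sum_nonneg_eq_0_iff) auto
    then have "c x = c0 x" for x using N cc(2) by (cases "x < s") (auto simp: c0_def)
    with c show False by auto
  qed
  have "kostka (Suc N) s lam l = (\<Sum>c\<in>horizontal_strips s l (lam N). if c = c0 then kostka N s lam (\<lambda>j. l j - c0 j) else 0)"
    unfolding pieri[OF l] using zero by (intro sum.cong) auto
  also have "\<dots> = 1" using c0 Suc by (simp add: finite_horizontal_strips eq)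
  finally show ?case by (simp add: l_def)
qed

section \<open>Permutation characters and their determinants\<close>

text \<open>The character of the permutation module on the words of content \<open>a\<close>. The content is an integer
  vector because the determinantal formula produces negative entries; the character is then \<open>0\<close>.\<close>

definition permchar :: "nat \<Rightarrow> nat \<Rightarrow> (nat \<Rightarrow> int) \<Rightarrow> (nat \<Rightarrow> nat) \<Rightarrow> int" where
  "permchar m s a p =
     int (card {w \<in> words m {..<s}. (\<forall>i<s. content m w i = a i) \<and> w \<circ> p = w})"

lemma fixed_word_iff:
  assumes "w \<in> words m X" "p permutes {..<m}"
  shows "w \<circ> p = w \<longleftrightarrow> (\<forall>x<m. w (p x) = w x)"
proof
  assume *: "\<forall>x<m. w (p x) = w x"
  show "w \<circ> p = w"
  proof
    fix x show "(w \<circ> p) x = w x"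
      using * permutes_not_in[OF assms(2), of x] by (cases "x < m") auto
  qed
qed (metis comp_apply)

lemma content_compose:
  assumes X: "finite X" and w: "w \<in> words m X"
  shows "content m (restrict (\<lambda>y. f (w y)) {..<m}) i = (\<Sum>x | x \<in> X \<and> f x = i. content m w x)"
proof -
  have "{y. y < m \<and> restrict (\<lambda>y. f (w y)) {..<m} y = i} = (\<Union>x\<in>{x\<in>X. f x = i}. {y. y < m \<and> w y = x})"
    using w by (auto simp: PiE_iff)
  also have "card \<dots> = (\<Sum>x | x \<in> X \<and> f x = i. card {y. y < m \<and> w y = x})"
    by (rule card_UN_disjoint) (use X in auto)
  finally show ?thesis by (simp add: content_def)
qed

text \<open>A pair of words is a word whose letters are pairs, and a permutation fixes the pair iff it
  fixes both components. The letters of \<open>X\<close> stand for the pairs through the maps \<open>f\<close> and \<open>g\<close>.\<close>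

lemma permchar_mult:
  assumes X: "finite X" and bij: "bij_betw (\<lambda>x. (f x, g x)) X ({..<N} \<times> {..<s})"
    and p: "p permutes {..<m}"
  shows "permchar m N a p * permchar m s b p =
    int (card {w \<in> words m X. ((\<forall>i<N. (\<Sum>x | x \<in> X \<and> f x = i. content m w x) = a i) \<and>
      (\<forall>j<s. (\<Sum>x | x \<in> X \<and> g x = j. content m w x) = b j)) \<and> w \<circ> p = w})"
    (is "_ = int (card ?W)")
proof -
  let ?U = "{u \<in> words m {..<N}. (\<forall>i<N. content m u i = a i) \<and> u \<circ> p = u}"
  let ?V = "{v \<in> words m {..<s}. (\<forall>i<s. content m v i = b i) \<and> v \<circ> p = v}"
  define h where "h = inv_into X (\<lambda>x. (f x, g x))"
  have h: "h (f x, g x) = x" if "x \<in> X" for x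
    using bij_betw_inv_into_left[OF bij that] by (simp add: h_def)
  have fg: "f x < N" "g x < s" if "x \<in> X" for x
    using bij_betwE[OF bij] that by auto
  have h': "h (i, j) \<in> X" "f (h (i, j)) = i" "g (h (i, j)) = j" if "i < N" "j < s" for i j
    using bij_betw_inv_into_right[OF bij, of "(i, j)"] that bij_betwE[OF bij_betw_inv_into[OF bij]]
    by (auto simp: h_def)
  have pm: "p x < m" if "x < m" for x using permutes_in_image[OF p] that by simp
  define F where "F = (\<lambda>w. (restrict (\<lambda>y. f (w y)) {..<m}, restrict (\<lambda>y. g (w y)) {..<m}))"
  define H where "H = (\<lambda>(u, v). restrict (\<lambda>y. h (u y, v y)) {..<m})"
  have HX: "H (u, v) \<in> words m X" if "u \<in> words m {..<N}" "v \<in> words m {..<s}" for u v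
    using that h' by (auto simp: H_def PiE_iff)
  have FH: "F (H (u, v)) = (u, v)" if "u \<in> words m {..<N}" "v \<in> words m {..<s}" for u v
  proof -
    have "restrict (\<lambda>y. f (H (u, v) y)) {..<m} = u" "restrict (\<lambda>y. g (H (u, v) y)) {..<m} = v"
      using that h' by (auto simp: H_def PiE_iff extensional_def)
    then show ?thesis by (simp add: F_def)
  qed
  have HF: "H (F w) = w" if "w \<in> words m X" for w
    using that h by (auto simp: F_def H_def PiE_iff extensional_def)
  have Fw: "F w \<in> words m {..<N} \<times> words m {..<s}" if "w \<in> words m X" for w
    using that fg by (auto simp: F_def PiE_iff)
  have fixd: "w \<circ> p = w \<longleftrightarrow> fst (F w) \<circ> p = fst (F w) \<and> snd (F w) \<circ> p = snd (F w)" if w: "w \<in> words m X" for w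
  proof -
    have "w (p x) = w x \<longleftrightarrow> f (w (p x)) = f (w x) \<and> g (w (p x)) = g (w x)" if "x < m" for x
      using h[of "w x"] h[of "w (p x)"] w pm that by (metis PiE_mem lessThan_iff)
    then show ?thesis
      using fixed_word_iff[OF w p] Fw[OF w] fixed_word_iff[OF _ p, of _ "{..<N}"] fixed_word_iff[OF _ p, of _ "{..<s}"]
        pm by (auto simp: F_def)
  qed
  have cF: "content m (fst (F w)) i = (\<Sum>x | x \<in> X \<and> f x = i. content m w x)"
    "content m (snd (F w)) i = (\<Sum>x | x \<in> X \<and> g x = i. content m w x)" if "w \<in> words m X" for w i
    using content_compose[OF X that] by (simp_all add: F_def)
  have "bij_betw F ?W (?U \<times> ?V)"
  proof (rule bij_betw_byWitness[where f' = H])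
    show "\<forall>w\<in>?W. H (F w) = w" using HF by blast
    show "\<forall>z\<in>?U \<times> ?V. F (H z) = z" using FH by auto
    show "F ` ?W \<subseteq> ?U \<times> ?V"
    proof
      fix z assume "z \<in> F ` ?W"
      then obtain w where w: "w \<in> ?W" "z = F w" by blast
      then have "fst z \<in> ?U" "snd z \<in> ?V" using Fw[of w] fixd[of w] cF[of w] by auto
      then show "z \<in> ?U \<times> ?V" by (simp add: mem_Times_iff)
    qed
    show "H ` (?U \<times> ?V) \<subseteq> ?W"
    proof
      fix z assume "z \<in> H ` (?U \<times> ?V)"
      then obtain u v where z: "z = H (u, v)" and
        uv: "u \<in> words m {..<N}" "\<forall>i<N. content m u i = a i" "u \<circ> p = u"
        "v \<in> words m {..<s}" "\<forall>i<s. content m v i = b i" "v \<circ> p = v"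
        by blast
      show "z \<in> ?W" unfolding z
        using HX[OF uv(1,4)] FH[OF uv(1,4)] fixd[OF HX[OF uv(1,4)]] cF[OF HX[OF uv(1,4)]] uv by simp
    qed
  qed
  then show ?thesis
    by (simp add: permchar_def bij_betw_same_card card_cartesian_product)
qed

lemma sum_fst_fibre: "finite Y \<Longrightarrow> i \<in> X \<Longrightarrow> (\<Sum>z | z \<in> X \<times> Y \<and> fst z = i. h z) = (\<Sum>j\<in>Y. h (i, j))"
  by (rule sum.reindex_bij_witness[of _ "\<lambda>j. (i, j)" snd]) auto

lemma sum_snd_fibre: "finite X \<Longrightarrow> j \<in> Y \<Longrightarrow> (\<Sum>z | z \<in> X \<times> Y \<and> snd z = j. h z) = (\<Sum>i\<in>X. h (i, j))"
  by (rule sum.reindex_bij_witness[of _ "\<lambda>i. (i, j)" fst]) auto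

text \<open>The content of a word of pairs is a matrix whose margins are the contents of its
  components.\<close>

lemma permchar_inner:
  assumes "(\<Sum>i<N. a i) = int m"
  shows "(\<Sum>p\<in>Sym m. permchar m N a p * permchar m s b p) = fact m * int (card (margin_matrices N s a b))"
proof -
  let ?X = "{..<N} \<times> {..<s}"
  let ?Q = "\<lambda>c. (\<forall>i<N. (\<Sum>x | x \<in> ?X \<and> fst x = i. c x) = a i) \<and>
      (\<forall>j<s. (\<Sum>x | x \<in> ?X \<and> snd x = j. c x) = b j)"
  have "(\<Sum>p\<in>Sym m. permchar m N a p * permchar m s b p) =
     (\<Sum>p\<in>Sym m. int (card {w \<in> words m ?X. ?Q (content m w) \<and> w \<circ> p = w}))"
    by (intro sum.cong refl permchar_mult) (auto simp: bij_betw_def)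
  also have "\<dots> = fact m * int (card {c \<in> contents ?X m. ?Q c})"
    by (rule burnside_words) auto
  also have "{c \<in> contents ?X m. ?Q c} = margin_matrices N s a b"
  proof -
    have "sum c ?X = int m" if "\<forall>i<N. (\<Sum>j<s. c (i, j)) = a i" for c
      using that assms by (simp add: sum.cartesian_product')
    then show ?thesis
      unfolding contents_def margin_matrices_def by (auto simp: sum_fst_fibre sum_snd_fibre)
  qed
  finally show ?thesis .
qed

text \<open>The Jacobi-Trudi determinant of permutation characters belonging to the partition \<open>l\<close> minus
  the staircase.\<close>

definition determinantal_char :: "nat \<Rightarrow> nat \<Rightarrow> (nat \<Rightarrow> int) \<Rightarrow> (nat \<Rightarrow> nat) \<Rightarrow> int" where
  "determinantal_char m s l p = (\<Sum>q\<in>Sym s. sign q * permchar m s (\<lambda>j. l j - staircase s (q j)) p)"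

lemma permchar_determinantal_char_inner:
  assumes "(\<Sum>i<N. a i) = int m"
  shows "(\<Sum>p\<in>Sym m. permchar m N a p * determinantal_char m s l p) = fact m * kostka N s a l"
proof -
  have "(\<Sum>p\<in>Sym m. permchar m N a p * determinantal_char m s l p) =
    (\<Sum>p\<in>Sym m. \<Sum>q\<in>Sym s. sign q * (permchar m N a p * permchar m s (\<lambda>j. l j - staircase s (q j)) p))"
    unfolding determinantal_char_def by (simp add: sum_distrib_left mult_ac)
  also have "\<dots> = (\<Sum>q\<in>Sym s. sign q * (\<Sum>p\<in>Sym m. permchar m N a p * permchar m s (\<lambda>j. l j - staircase s (q j)) p))"
    by (subst sum.swap) (simp add: sum_distrib_left)
  also have "\<dots> = fact m * kostka N s a l"
    unfolding permchar_inner[OF assms] kostka_def by (simp add: sum_distrib_left mult_ac)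
  finally show ?thesis .
qed

text \<open>The inequalities bound the sum of the first \<open>t\<close> values of \<open>q\<close> by \<open>0 + \<dots> + (t - 1)\<close>, which only
  the identity achieves for all \<open>t\<close>. This singles out one term in the sums over permutations
  below.\<close>

lemma staircase_dominance_id:
  assumes q: "q permutes {..<s}"
    and le: "\<And>t. t \<le> s \<Longrightarrow> (\<Sum>i<t. l i - staircase s (q i)) \<le> (\<Sum>i<t. l i - staircase s i)"
  shows "q = id"
proof (rule permutes_natset_ge[OF q], rule ballI)
  have lt: "q i < s" if "i < s" for i using permutes_in_image[OF q] that by simp
  have "q i = i" if "i < s" for i
    using that
  proof (induction i rule: less_induct)
    case (less i)
    have "i \<le> q i"
    proof (rule ccontr)
      assume "\<not> i \<le> q i"
      then have "q (q i) = q i" "q i \<noteq> i" using less by auto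
      then show False using permutes_inj[OF q] by (auto dest: injD)
    qed
    moreover have "(\<Sum>j<Suc i. staircase s j) \<le> (\<Sum>j<Suc i. staircase s (q j))"
      using le[of "Suc i"] less.prems by (simp add: sum_subtractf)
    then have "staircase s i \<le> staircase s (q i)" using less by simp
    then have "q i \<le> i" using less.prems lt[OF less.prems] by (simp add: staircase_def)
    ultimately show ?case by simp
  qed
  then show "\<And>i. i \<in> {..<s} \<Longrightarrow> i \<le> q i" by simp
qed

lemma sum_staircase_permute:
  assumes "q permutes {..<s}"
  shows "(\<Sum>i<s. staircase s (q i)) = (\<Sum>i<s. staircase s i)"
  using sum.permute[OF assms, of "staircase s"] by simp

lemma strictly_decreasing_add_staircase:
  assumes "\<And>i. lam (Suc i) \<le> lam i"
  shows "strictly_decreasing s (\<lambda>i. lam i + staircase s i)"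
  unfolding strictly_decreasing_def staircase_def by (smt (verit) assms Suc_lessD of_nat_Suc)

text \<open>Expand one of the factors. The term of \<open>q\<close> is a Kostka number whose weight is dominated by the
  shape only if \<open>q\<close> is the identity, and the remaining Kostka number is \<open>1\<close>.\<close>

lemma determinantal_char_norm:
  fixes lam :: "nat \<Rightarrow> int"
  assumes dec: "\<And>i. lam (Suc i) \<le> lam i" and nn: "\<And>i. 0 \<le> lam i" and m: "(\<Sum>i<s. lam i) = int m"
  defines "l \<equiv> \<lambda>i. lam i + staircase s i"
  shows "(\<Sum>p\<in>Sym m. determinantal_char m s l p * determinantal_char m s l p) = fact m"
proof -
  have l: "strictly_decreasing s l" unfolding l_def by (rule strictly_decreasing_add_staircase[of lam s, OF dec])
  have "(\<Sum>p\<in>Sym m. determinantal_char m s l p * determinantal_char m s l p)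
     = (\<Sum>p\<in>Sym m. \<Sum>q\<in>Sym s. sign q * (permchar m s (\<lambda>j. l j - staircase s (q j)) p * determinantal_char m s l p))"
    unfolding determinantal_char_def[of m s l] by (simp add: sum_distrib_left sum_distrib_right mult_ac)
  also have "\<dots> = (\<Sum>q\<in>Sym s. sign q * (\<Sum>p\<in>Sym m. permchar m s (\<lambda>j. l j - staircase s (q j)) p * determinantal_char m s l p))"
    by (subst sum.swap) (simp add: sum_distrib_left)
  also have "\<dots> = (\<Sum>q\<in>Sym s. if q = id then fact m else 0)"
  proof (intro sum.cong refl)
    fix q assume q: "q \<in> Sym s"
    let ?a = "\<lambda>j. l j - staircase s (q j)"
    have "(\<Sum>j<s. ?a j) = int m"
      using q m by (simp add: l_def sum.distrib sum_subtractf sum_staircase_permute)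
    then have *: "(\<Sum>p\<in>Sym m. permchar m s ?a p * determinantal_char m s l p) = fact m * kostka s s ?a l"
      by (rule permchar_determinantal_char_inner)
    have "kostka s s ?a l = (if q = id then 1 else 0)"
    proof (cases "q = id")
      case True
      have "kostka s s ?a l = kostka s s lam (\<lambda>i. (if i < s then lam i else 0) + staircase s i)"
        by (rule kostka_cong) (auto simp: True l_def)
      then show ?thesis using kostka_diagonal[of lam s s] dec nn True by simp
    next
      case False
      then show ?thesis
        using kostka_dominance[OF l order_refl, of ?a] staircase_dominance_id[of q s l] q by auto
    qed
    then show "sign q * (\<Sum>p\<in>Sym m. permchar m s ?a p * determinantal_char m s l p) = (if q = id then fact m else 0)"
      unfolding * by (simp add: sign_id)
  qed
  also have "\<dots> = fact m" by (simp add: permutes_id)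
  finally show ?thesis .
qed

lemma permchar_inv:
  assumes p: "p permutes {..<m}"
  shows "permchar m s a (inv p) = permchar m s a p"
proof -
  have "w \<circ> inv p = w \<longleftrightarrow> w \<circ> p = w" for w :: "nat \<Rightarrow> nat"
    using permutes_inv_o[OF p] by (metis comp_assoc comp_id)
  then show ?thesis by (simp add: permchar_def)
qed

text \<open>Renaming the positions of a word by \<open>x\<close> conjugates the permutations that fix it.\<close>

lemma permchar_conj:
  assumes p: "p permutes {..<m}" and x: "x permutes {..<m}"
  shows "permchar m s a (x \<circ> p \<circ> inv x) = permchar m s a p"
proof -
  have "bij_betw (\<lambda>w. w \<circ> x) {w \<in> words m {..<s}. (\<forall>i<s. content m w i = a i) \<and> w \<circ> (x \<circ> p \<circ> inv x) = w}
     {w \<in> words m {..<s}. (\<forall>i<s. content m w i = a i) \<and> w \<circ> p = w}"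
  proof (rule bij_betw_byWitness[where f' = "\<lambda>w. w \<circ> inv x"])
    have xi: "inv x \<in> Sym m" "x \<in> Sym m" using x permutes_inv by auto
    have *: "w \<circ> x \<circ> inv x = w" "w \<circ> inv x \<circ> x = w" for w :: "nat \<Rightarrow> nat"
      using permutes_inv_o[OF x] by (simp_all add: comp_assoc)
    show "\<forall>w\<in>{w \<in> words m {..<s}. (\<forall>i<s. content m w i = a i) \<and> w \<circ> (x \<circ> p \<circ> inv x) = w}. w \<circ> x \<circ> inv x = w"
      "\<forall>w\<in>{w \<in> words m {..<s}. (\<forall>i<s. content m w i = a i) \<and> w \<circ> p = w}. w \<circ> inv x \<circ> x = w"
      using * by auto
    have "w \<circ> x \<circ> p = w \<circ> x" if "w \<circ> (x \<circ> p \<circ> inv x) = w" for w :: "nat \<Rightarrow> nat"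
      using that *(2)[of "w \<circ> x \<circ> p"] by (metis comp_assoc)
    then show "(\<lambda>w. w \<circ> x) ` {w \<in> words m {..<s}. (\<forall>i<s. content m w i = a i) \<and> w \<circ> (x \<circ> p \<circ> inv x) = w}
      \<subseteq> {w \<in> words m {..<s}. (\<forall>i<s. content m w i = a i) \<and> w \<circ> p = w}"
      using xi by (simp add: image_subset_iff words_comp content_comp)
    have "w \<circ> inv x \<circ> (x \<circ> p \<circ> inv x) = w \<circ> inv x" if "w \<circ> p = w" for w :: "nat \<Rightarrow> nat"
      using that *(2)[of w] by (metis comp_assoc)
    then show "(\<lambda>w. w \<circ> inv x) ` {w \<in> words m {..<s}. (\<forall>i<s. content m w i = a i) \<and> w \<circ> p = w}
      \<subseteq> {w \<in> words m {..<s}. (\<forall>i<s. content m w i = a i) \<and> w \<circ> (x \<circ> p \<circ> inv x) = w}"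
      using xi by (simp add: image_subset_iff words_comp content_comp)
  qed
  then show ?thesis by (simp add: permchar_def bij_betw_same_card)
qed

lemma permchar_mult_sum:
  assumes bij: "bij_betw (\<lambda>t. (f t, g t)) {..<s} ({..<N} \<times> {..<M})" and p: "p permutes {..<m}"
  shows "permchar m N a p * permchar m M b p =
    (\<Sum>A | A \<in> contents {..<s} m \<and> (\<forall>i<N. (\<Sum>t | t < s \<and> f t = i. A t) = a i) \<and>
       (\<forall>j<M. (\<Sum>t | t < s \<and> g t = j. A t) = b j). permchar m s A p)"
proof -
  let ?Q = "\<lambda>A. (\<forall>i<N. (\<Sum>t | t < s \<and> f t = i. A t) = a i) \<and> (\<forall>j<M. (\<Sum>t | t < s \<and> g t = j. A t) = b j)"
  let ?W = "{w \<in> words m {..<s}. ?Q (content m w) \<and> w \<circ> p = w}"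
  have "permchar m N a p * permchar m M b p = int (card ?W)"
    using permchar_mult[OF _ bij p] by simp
  also have "card ?W = (\<Sum>A | A \<in> contents {..<s} m \<and> ?Q A. card {w \<in> ?W. content m w = A})"
    unfolding card_eq_sum
    by (rule sum.group[symmetric]) (use finite_words[of "{..<s}" m] finite_contents[of "{..<s}" m]
       content_in_contents[of "{..<s}" _ m] in auto)
  also have "int \<dots> = (\<Sum>A | A \<in> contents {..<s} m \<and> ?Q A. permchar m s A p)"
    unfolding permchar_def of_nat_sum
  proof (intro sum.cong refl arg_cong[of _ _ int] arg_cong[of _ _ card])
    fix A assume A: "A \<in> {A \<in> contents {..<s} m. ?Q A}"
    have "content m w = A" if "w \<in> words m {..<s}" "\<forall>i<s. content m w i = A i" for w
    proof
      fix i show "content m w i = A i"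
        using content_in_contents[OF _ that(1)] A that by (cases "i < s") (auto simp: contents_def)
    qed
    then show "{w \<in> ?W. content m w = A} = {w \<in> words m {..<s}. (\<forall>i<s. content m w i = A i) \<and> w \<circ> p = w}"
      using A by auto
  qed
  finally show ?thesis by simp
qed

section \<open>Young symmetrizers\<close>

locale young_shape =
  fixes lam :: "nat list"
  assumes dec: "sorted_wrt (\<ge>) lam"
begin

abbreviation "m \<equiv> sum_list lam"
abbreviation "row x \<equiv> fst (boxes lam ! x)"
abbreviation "col x \<equiv> snd (boxes lam ! x)"
abbreviation "R \<equiv> row_group lam"
abbreviation "C \<equiv> column_group lam"
abbreviation "c \<equiv> young_symmetrizer lam"

lemma set_boxes: "set (boxes lam) = (SIGMA i:{..<length lam}. {..<lam ! i})"
  by (auto simp: boxes_def)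

lemma length_boxes: "length (boxes lam) = m"
proof -
  have "map (length \<circ> (\<lambda>i. map (Pair i) [0..<lam ! i])) [0..<length lam] = map ((!) lam) [0..<length lam]"
    by simp
  then show ?thesis by (simp add: boxes_def length_concat map_nth)
qed

lemma distinct_boxes: "distinct (boxes lam)"
proof (rule card_distinct)
  show "card (set (boxes lam)) = length (boxes lam)"
    by (simp add: set_boxes length_boxes sum_list_sum_nth atLeast0LessThan)
qed

lemma box_mem: "x < m \<Longrightarrow> row x < length lam \<and> col x < lam ! row x"
proof -
  assume "x < m"
  then have "boxes lam ! x \<in> (SIGMA i:{..<length lam}. {..<lam ! i})"
    using nth_mem[of x "boxes lam"] by (simp only: length_boxes set_boxes)
  then show ?thesis by auto
qed

lemma box_inj: "x < m \<Longrightarrow> y < m \<Longrightarrow> row x = row y \<Longrightarrow> col x = col y \<Longrightarrow> x = y"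
  using nth_eq_iff_index_eq[OF distinct_boxes, of x y] by (simp add: length_boxes prod_eq_iff)

lemma box_ex: "i < length lam \<Longrightarrow> j < lam ! i \<Longrightarrow> \<exists>x<m. row x = i \<and> col x = j"
proof -
  assume "i < length lam" "j < lam ! i"
  then have "(i, j) \<in> set (boxes lam)" by (simp add: set_boxes)
  then obtain x where "x < m" "boxes lam ! x = (i, j)" by (auto simp: in_set_conv_nth length_boxes)
  then show ?thesis by auto
qed

lemma card_row: "i < length lam \<Longrightarrow> card {x. x < m \<and> row x = i} = lam ! i"
proof -
  assume i: "i < length lam"
  have "bij_betw col {x. x < m \<and> row x = i} {..<lam ! i}"
    unfolding bij_betw_def using box_inj box_mem box_ex[OF i] by (fastforce simp: inj_on_def)
  then show ?thesis by (simp add: bij_betw_same_card)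
qed

definition column :: "nat \<Rightarrow> nat set" where
  "column j = {x. x < m \<and> col x = j}"

lemma finite_column [simp]: "finite (column j)"
  by (simp add: column_def)

text \<open>The rows weakly decrease in length, so a column meets an initial segment of the rows.\<close>

lemma rows_of_column: "bij_betw row (column j) {..<card (column j)}"
proof -
  have inj: "inj_on row (column j)" using box_inj by (auto simp: inj_on_def column_def)
  have "i \<in> row ` column j" if "x \<in> column j" "i \<le> row x" for x i
  proof -
    have x: "row x < length lam" "j < lam ! row x" using that(1) box_mem[of x] by (auto simp: column_def)
    have "lam ! row x \<le> lam ! i"
      using sorted_wrt_nth_less[OF dec, of i "row x"] that(2) x by (cases "i = row x") auto
    then show ?thesis using box_ex[of i j] x that(2) by (auto simp: column_def image_iff)
  qed
  then have closed: "i \<in> row ` column j" if "k \<in> row ` column j" "i \<le> k" for i k using that by auto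
  have "row ` column j = {..<card (row ` column j)}"
  proof (rule card_subset_eq)
    show "row ` column j \<subseteq> {..<card (row ` column j)}"
    proof
      fix k assume "k \<in> row ` column j"
      then have "{..k} \<subseteq> row ` column j" using closed by auto
      then have "card {..k} \<le> card (row ` column j)" by (intro card_mono) auto
      then show "k \<in> {..<card (row ` column j)}" by simp
    qed
  qed simp_all
  then show ?thesis using inj by (simp add: bij_betw_def card_image)
qed

definition column_injective :: "(nat \<Rightarrow> nat) \<Rightarrow> bool" where
  "column_injective w \<longleftrightarrow> (\<forall>j. inj_on w (column j))"

lemma card_column_rows_less: "card {x \<in> column j. row x < t} = min t (card (column j))"
proof -
  have "row ` {x \<in> column j. row x < t} = {..<min t (card (column j))}"
  proof -
    have "row ` {x \<in> column j. row x < t} = row ` column j \<inter> {..<t}" by auto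
    then show ?thesis using rows_of_column[of j] by (auto simp: bij_betw_def)
  qed
  moreover have "inj_on row {x \<in> column j. row x < t}"
    using rows_of_column[of j] by (auto simp: bij_betw_def intro: inj_on_subset)
  ultimately show ?thesis using card_image[of row "{x \<in> column j. row x < t}"] by simp
qed

lemma card_column_less:
  assumes "column_injective w"
  shows "card {x \<in> column j. w x < t} \<le> card {x \<in> column j. row x < t}"
proof -
  have "inj_on w {x \<in> column j. w x < t}"
    using assms by (auto simp: column_injective_def intro: inj_on_subset)
  then have "card {x \<in> column j. w x < t} \<le> card {..<t}"
    by (rule card_inj_on_le) auto
  moreover have "card {x \<in> column j. w x < t} \<le> card (column j)"
    by (rule card_mono) auto
  ultimately show ?thesis by (simp add: card_column_rows_less)
qed

lemma card_by_columns: "card {x. x < m \<and> P x} = (\<Sum>j\<in>col ` {..<m}. card {x \<in> column j. P x})"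
proof -
  have "{x. x < m \<and> P x} = (\<Union>j\<in>col ` {..<m}. {x \<in> column j. P x})" by (auto simp: column_def)
  also have "card \<dots> = (\<Sum>j\<in>col ` {..<m}. card {x \<in> column j. P x})"
    by (rule card_UN_disjoint) (auto simp: column_def)
  finally show ?thesis .
qed

text \<open>A column of length \<open>d\<close> has at most \<open>min t d\<close> letters below \<open>t\<close>, and filling every box with its
  row index attains this bound in every column.\<close>

lemma column_injective_dominance:
  assumes "column_injective w"
  shows "card {x. x < m \<and> w x < t} \<le> card {x. x < m \<and> row x < t}"
  unfolding card_by_columns by (intro sum_mono card_column_less assms)

lemma card_less_by_content:
  fixes w :: "nat \<Rightarrow> nat"
  shows
  "int (card {x. x < m \<and> w x < t}) = (\<Sum>i<t. content m w i)"
proof -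
  have "{x. x < m \<and> w x < t} = (\<Union>i\<in>{..<t}. {x. x < m \<and> w x = i})" by auto
  also have "card \<dots> = (\<Sum>i<t. card {x. x < m \<and> w x = i})"
    by (rule card_UN_disjoint) auto
  finally show ?thesis by (simp add: content_def)
qed

text \<open>Equality in \<open>column_injective_dominance\<close> forces equality in each column. So the letters of \<open>w\<close> in
  a column of length \<open>d\<close> are \<open>0, \<dots>, d - 1\<close>, each once, and a rearrangement within the columns turns
  \<open>w\<close> into the word of row indices.\<close>

lemma straighten_word:
  assumes inj: "column_injective w" and ct: "\<And>i. content m w i = content m row i"
  shows "\<exists>q\<in>C. \<forall>x<m. w (q x) = row x"
proof -
  have "int (card {x. x < m \<and> w x < t}) = int (card {x. x < m \<and> row x < t})" for t
    unfolding card_less_by_content by (simp add: ct)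
  then have sums: "(\<Sum>j\<in>col ` {..<m}. card {x \<in> column j. w x < t})
      = (\<Sum>j\<in>col ` {..<m}. card {x \<in> column j. row x < t})" for t
    unfolding card_by_columns of_nat_eq_iff .
  have eq: "card {x \<in> column j. w x < t} = card {x \<in> column j. row x < t}" if "j \<in> col ` {..<m}" for j t
  proof (rule ccontr)
    assume "card {x \<in> column j. w x < t} \<noteq> card {x \<in> column j. row x < t}"
    then have "card {x \<in> column j. w x < t} < card {x \<in> column j. row x < t}"
      using card_column_less[OF inj, of j t] by simp
    then have "(\<Sum>j\<in>col ` {..<m}. card {x \<in> column j. w x < t})
      < (\<Sum>j\<in>col ` {..<m}. card {x \<in> column j. row x < t})"
      by (intro sum_strict_mono_ex1) (use that card_column_less[OF inj] in auto)
    then show False by (simp add: sums)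
  qed
  have img: "bij_betw w (column (col x)) {..<card (column (col x))}" if "x < m" for x
  proof -
    let ?K = "column (col x)"
    have "card {y \<in> ?K. w y < card ?K} = card ?K"
      using eq[of "col x" "card ?K"] that by (simp add: card_column_rows_less)
    then have "{y \<in> ?K. w y < card ?K} = ?K" by (intro card_subset_eq) auto
    then have "w ` ?K \<subseteq> {..<card ?K}" by auto
    moreover have i: "inj_on w ?K" using inj by (simp add: column_injective_def)
    ultimately have "w ` ?K = {..<card ?K}" by (intro card_subset_eq) (auto simp: card_image)
    then show ?thesis using i by (simp add: bij_betw_def)
  qed
  define q where "q x = (if x < m then inv_into (column (col x)) w (row x) else x)" for x
  have rowlt: "row x \<in> w ` column (col x)" if "x < m" for x
  proof -
    have "x \<in> column (col x)" using that by (simp add: column_def)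
    then have "row x \<in> {..<card (column (col x))}"
      using bij_betwE[OF rows_of_column[of "col x"]] by blast
    then show ?thesis using img[OF that] by (simp add: bij_betw_def)
  qed
  have q1: "w (q x) = row x" if "x < m" for x
    using f_inv_into_f[OF rowlt[OF that]] that by (simp add: q_def)
  have "q x \<in> column (col x)" if "x < m" for x
    using inv_into_into[OF rowlt[OF that]] that by (simp add: q_def)
  then have q2: "q x < m" "col (q x) = col x" if "x < m" for x
    using that by (auto simp: column_def)
  have "q permutes {..<m}"
  proof (rule bij_imp_permutes)
    have injq: "inj_on q {..<m}"
    proof (rule inj_onI)
      fix x y assume xy: "x \<in> {..<m}" "y \<in> {..<m}" "q x = q y"
      then show "x = y" using q1[of x] q1[of y] q2[of x] q2[of y] box_inj[of x y] by auto
    qed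
    moreover have "q ` {..<m} \<subseteq> {..<m}" using q2 by auto
    ultimately show "bij_betw q {..<m} {..<m}"
      by (simp add: bij_betw_def endo_inj_surj)
  qed (simp add: q_def)
  then have "q \<in> C" using q2 by (simp add: column_group_def)
  then show ?thesis using q1 by blast
qed

lemma R_permutes: "r \<in> R \<Longrightarrow> r permutes {..<m}" and C_permutes: "q \<in> C \<Longrightarrow> q permutes {..<m}"
  by (auto simp: row_group_def column_group_def)

lemma finite_R [simp]: "finite R" and finite_C [simp]: "finite C"
  by (rule finite_subset[OF _ finite_Sym[of m]], auto simp: row_group_def column_group_def)+

lemma id_R: "id \<in> R" and id_C: "id \<in> C"
  by (auto simp: row_group_def column_group_def permutes_id)

lemma perm_lt: "p permutes {..<m} \<Longrightarrow> x < m \<Longrightarrow> p x < m"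
  using permutes_in_image[of p "{..<m}" x] by simp

lemma comp_R: "r \<in> R \<Longrightarrow> r' \<in> R \<Longrightarrow> r \<circ> r' \<in> R"
  and comp_C: "q \<in> C \<Longrightarrow> q' \<in> C \<Longrightarrow> q \<circ> q' \<in> C"
  by (auto simp: row_group_def column_group_def permutes_compose perm_lt)

lemma inv_R: "r \<in> R \<Longrightarrow> inv r \<in> R"
proof -
  assume r: "r \<in> R"
  then have p: "inv r permutes {..<m}" by (intro permutes_inv R_permutes)
  have "row (inv r x) = row x" if "x < m" for x
    using r perm_lt[OF p that] permutes_inverses(1)[OF R_permutes[OF r], of x]
    by (simp add: row_group_def) metis
  then show ?thesis using p by (simp add: row_group_def)
qed

lemma inv_C: "q \<in> C \<Longrightarrow> inv q \<in> C"
proof -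
  assume q: "q \<in> C"
  then have p: "inv q permutes {..<m}" by (intro permutes_inv C_permutes)
  have "col (inv q x) = col x" if "x < m" for x
    using q perm_lt[OF p that] permutes_inverses(1)[OF C_permutes[OF q], of x]
    by (simp add: column_group_def) metis
  then show ?thesis using p by (simp add: column_group_def)
qed

lemma R_Int_C: "p \<in> R \<Longrightarrow> p \<in> C \<Longrightarrow> p = id"
proof
  fix x assume p: "p \<in> R" "p \<in> C"
  show "p x = id x"
  proof (cases "x < m")
    case True
    then show ?thesis using p box_inj[of "p x" x] perm_lt[of p x]
      by (simp add: row_group_def column_group_def)
  next
    case False
    then show ?thesis using permutes_not_in[OF R_permutes[OF p(1)], of x] by simp
  qed
qed

lemma transpose_C: "x < m \<Longrightarrow> y < m \<Longrightarrow> col x = col y \<Longrightarrow> transpose x y \<in> C"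
  and transpose_R: "x < m \<Longrightarrow> y < m \<Longrightarrow> row x = row y \<Longrightarrow> transpose x y \<in> R"
  using permutes_swap_id[of x "{..<m}" y] by (auto simp: column_group_def row_group_def transpose_def)

lemma sign_C_comp: "q \<in> C \<Longrightarrow> q' \<in> C \<Longrightarrow> sign (q \<circ> q') = sign q * sign q'"
  using C_permutes permutation_permutes[of q] permutation_permutes[of q']
  by (intro sign_compose) blast+

lemma sign_C_inv: "q \<in> C \<Longrightarrow> sign (inv q) = sign q"
  using C_permutes permutation_permutes[of q] by (intro sign_inverse) blast

lemma c_left: "r \<in> R \<Longrightarrow> c (r \<circ> x) = c x"
proof -
  assume r: "r \<in> R"
  have inv: "inv r \<circ> r = id" "r \<circ> inv r = id" using permutes_inv_o[OF R_permutes[OF r]] by auto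
  show ?thesis
    unfolding young_symmetrizer_def
  proof (rule sum.reindex_bij_witness[of _ "\<lambda>p. r \<circ> p" "\<lambda>p. inv r \<circ> p"])
    fix p assume "p \<in> R"
    have "r \<circ> x = p \<circ> q \<longleftrightarrow> x = inv r \<circ> p \<circ> q" for q
      using inv by (metis comp_assoc id_comp)
    then show "(\<Sum>q\<in>C. if x = inv r \<circ> p \<circ> q then of_int (sign q) else 0) = (\<Sum>q\<in>C. if r \<circ> x = p \<circ> q then of_int (sign q) else (0 :: complex))"
      by simp
  qed (auto simp: comp_R inv_R r inv simp flip: comp_assoc)
qed

lemma c_right: "q \<in> C \<Longrightarrow> c (x \<circ> q) = of_int (sign q) * c x"
proof -
  assume q: "q \<in> C"
  have inv: "inv q \<circ> q = id" "q \<circ> inv q = id" using permutes_inv_o[OF C_permutes[OF q]] by auto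
  have "(\<Sum>u\<in>C. if x \<circ> q = p \<circ> u then of_int (sign u) else 0)
      = (\<Sum>u\<in>C. of_int (sign q) * (if x = p \<circ> u then of_int (sign u) else (0 :: complex)))" for p
  proof (rule sum.reindex_bij_witness[of _ "\<lambda>u. u \<circ> q" "\<lambda>u. u \<circ> inv q"])
    fix u assume u: "u \<in> C"
    have "x \<circ> q = p \<circ> u \<longleftrightarrow> x = p \<circ> (u \<circ> inv q)"
      using inv by (metis comp_assoc comp_id)
    moreover have "sign u = sign q * sign (u \<circ> inv q)"
      using q u by (simp add: sign_C_comp inv_C sign_C_inv)
    ultimately show "of_int (sign q) * (if x = p \<circ> (u \<circ> inv q) then of_int (sign (u \<circ> inv q)) else (0 :: complex))
       = (if x \<circ> q = p \<circ> u then of_int (sign u) else 0)" by simp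
  qed (auto simp: comp_C inv_C q inv comp_assoc)
  then show ?thesis
    unfolding young_symmetrizer_def by (simp add: sum_distrib_left)
qed

lemma c_id: "c id = 1"
proof -
  have "(\<Sum>q\<in>C. if id = p \<circ> q then of_int (sign q) else 0) = (if p = id then 1 else (0 :: complex))" if "p \<in> R" for p
  proof -
    have "id = p \<circ> q \<longleftrightarrow> q = id \<and> p = id" if "q \<in> C" for q
    proof
      assume *: "id = p \<circ> q"
      then have "p = inv q"
        using permutes_inv_o(1)[OF C_permutes[OF that]] by (metis comp_assoc comp_id id_comp)
      then have "p = id" using R_Int_C[of p] \<open>p \<in> R\<close> inv_C[OF that] by simp
      then show "q = id \<and> p = id" using * by simp
    qed simp
    then have "(\<Sum>q\<in>C. if id = p \<circ> q then of_int (sign q) else 0)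
      = (\<Sum>q\<in>C. if q = id then (if p = id then 1 else 0) else (0 :: complex))"
      by (intro sum.cong refl) (auto simp: sign_id)
    then show ?thesis by (simp add: id_C)
  qed
  then show ?thesis by (simp add: young_symmetrizer_def id_R)
qed

lemma sum_c: "(\<Sum>y\<in>Sym m. c y * F y) = (\<Sum>p\<in>R. \<Sum>q\<in>C. of_int (sign q) * F (p \<circ> q))"
proof -
  have "(\<Sum>y\<in>Sym m. c y * F y)
     = (\<Sum>y\<in>Sym m. \<Sum>p\<in>R. \<Sum>q\<in>C. if y = p \<circ> q then of_int (sign q) * F (p \<circ> q) else 0)"
    unfolding young_symmetrizer_def sum_distrib_right by (intro sum.cong refl) auto
  also have "\<dots> = (\<Sum>p\<in>R. \<Sum>q\<in>C. \<Sum>y\<in>Sym m. if y = p \<circ> q then of_int (sign q) * F (p \<circ> q) else 0)"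
    by (subst sum.swap) (intro sum.cong refl sum.swap)
  also have "\<dots> = (\<Sum>p\<in>R. \<Sum>q\<in>C. of_int (sign q) * F (p \<circ> q))"
    by (intro sum.cong refl) (auto simp: permutes_compose R_permutes C_permutes)
  finally show ?thesis .
qed

lemma c_outside: "x \<notin> Sym m \<Longrightarrow> c x = 0"
  unfolding young_symmetrizer_def
  by (intro sum.neutral ballI) (auto simp: permutes_compose R_permutes C_permutes)

text \<open>If \<open>x = r \<circ> q\<close> with \<open>r\<close> in the row group and \<open>q\<close> in the column group, the invariance computes
  \<open>f x\<close> from \<open>f id\<close>. By \<open>straighten_word\<close>, any other \<open>x\<close> sends two elements of some column into one row.
  Then \<open>x = t \<circ> x \<circ> u\<close> for a transposition \<open>t\<close> in the row group and a transposition \<open>u\<close> in the column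
  group, whence \<open>f x = - f x\<close>.\<close>

lemma young_uniqueness:
  fixes f :: "(nat \<Rightarrow> nat) \<Rightarrow> complex"
  assumes f: "\<And>r x q. r \<in> R \<Longrightarrow> x \<in> Sym m \<Longrightarrow> q \<in> C \<Longrightarrow> f (r \<circ> x \<circ> q) = of_int (sign q) * f x"
    and x: "x \<in> Sym m"
  shows "f x = f id * c x"
proof (cases "column_injective (\<lambda>y. row (x y))")
  case True
  have px: "x permutes {..<m}" using x by simp
  have "content m (\<lambda>y. row (x y)) i = content m row i" for i
    using content_comp[OF x, of row] by (simp add: o_def)
  then obtain q where q: "q \<in> C" "\<forall>y<m. row (x (q y)) = row y"
    using straighten_word[OF True] by blast
  have "x \<circ> q \<in> R"
    using q px C_permutes[OF q(1)] by (simp add: row_group_def permutes_compose)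
  moreover have "x = (x \<circ> q) \<circ> id \<circ> inv q"
    using permutes_inv_o(1)[OF C_permutes[OF q(1)]] by (simp add: comp_assoc)
  ultimately obtain r u where ru: "r \<in> R" "u \<in> C" "x = r \<circ> id \<circ> u" using inv_C[OF q(1)] by blast
  have "f x = of_int (sign u) * f id" using f[of r id u] ru by (simp add: permutes_id)
  moreover have "c x = of_int (sign u)" using ru c_left[of r u] c_right[of u id] c_id by simp
  ultimately show ?thesis by simp
next
  case False
  have px: "x permutes {..<m}" using x by simp
  obtain y z where yz: "y < m" "z < m" "col y = col z" "y \<noteq> z" "row (x y) = row (x z)"
    using False by (auto simp: column_injective_def inj_on_def column_def)
  let ?u = "transpose y z" and ?t = "transpose (x y) (x z)"
  have u: "?u \<in> C" using yz by (intro transpose_C) auto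
  have t: "?t \<in> R" using yz perm_lt[OF px] by (intro transpose_R) auto
  have "?t \<circ> x \<circ> ?u = x"
    using permutes_inj[OF px] by (auto simp: fun_eq_iff transpose_def dest: injD)
  moreover have "sign ?u = -1" using yz by (simp add: sign_swap_id)
  ultimately have "f x = - f x" "c x = - c x"
    using f[OF t x u] c_left[OF t, of "x \<circ> ?u"] c_right[OF u, of x] by (simp_all add: comp_assoc)
  then show ?thesis by simp
qed

text \<open>The scalar with \<open>c * c = h c\<close> in the group algebra, that is \<open>m!\<close> divided by the dimension of the
  irreducible module.\<close>

definition h :: complex where
  "h = (\<Sum>y\<in>Sym m. c y * c (inv y))"

text \<open>In the group algebra the product \<open>c * g\<^sup>-\<^sup>1 * c\<close> is a multiple of \<open>c\<close>: as a function of \<open>x\<close> the left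
  side has the invariance required by \<open>young_uniqueness\<close>.\<close>

lemma c_sandwich:
  assumes g: "g \<in> Sym m" and x: "x \<in> Sym m"
  shows "(\<Sum>y\<in>Sym m. c y * c (g \<circ> inv y \<circ> x)) = (\<Sum>y\<in>Sym m. c y * c (g \<circ> inv y)) * c x"
proof -
  define f where "f x = (\<Sum>y\<in>Sym m. c y * c (g \<circ> inv y \<circ> x))" for x
  have inv: "f (r \<circ> x \<circ> q) = of_int (sign q) * f x" if r: "r \<in> R" and q: "q \<in> C" for r x q
  proof -
    have pr: "r permutes {..<m}" by (rule R_permutes[OF r])
    have "f (r \<circ> x \<circ> q) = of_int (sign q) * (\<Sum>y\<in>Sym m. c y * c (g \<circ> inv y \<circ> r \<circ> x))"
      unfolding f_def sum_distrib_left
      by (intro sum.cong refl) (use c_right[OF q] in \<open>simp add: comp_assoc[symmetric]\<close>)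
    also have "(\<Sum>y\<in>Sym m. c y * c (g \<circ> inv y \<circ> r \<circ> x)) = (\<Sum>y\<in>Sym m. c (r \<circ> y) * c (g \<circ> inv (r \<circ> y) \<circ> r \<circ> x))"
      by (rule setum_permutations_compose_left[OF pr])
    also have "\<dots> = f x"
      unfolding f_def
    proof (intro sum.cong refl)
      fix y assume "y \<in> Sym m"
      then have "inv (r \<circ> y) = inv y \<circ> inv r"
        using pr permutes_bij by (intro o_inv_distrib) auto
      then have "g \<circ> inv (r \<circ> y) \<circ> r \<circ> x = g \<circ> inv y \<circ> x"
        using permutes_inv_o(2)[OF pr] by (metis comp_assoc comp_id)
      then show "c (r \<circ> y) * c (g \<circ> inv (r \<circ> y) \<circ> r \<circ> x) = c y * c (g \<circ> inv y \<circ> x)"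
        by (simp add: c_left[OF r])
    qed
    finally show ?thesis .
  qed
  have "f x = f id * c x" by (rule young_uniqueness[OF inv x])
  then show ?thesis by (simp add: f_def)
qed

lemma c_idempotent: "x \<in> Sym m \<Longrightarrow> (\<Sum>y\<in>Sym m. c y * c (inv y \<circ> x)) = h * c x"
  using c_sandwich[of id x] by (simp add: permutes_id h_def)

end

section \<open>The trace on the irreducible module\<close>

lemma sum_apply: "(\<Sum>i\<in>A. F i) x = (\<Sum>i\<in>A. F i x)"
  for F :: "'i \<Rightarrow> 'b \<Rightarrow> 'c :: comm_monoid_add"
  by (induction A rule: infinite_finite_induct) auto

lemma inv_comp_permutes:
  "p permutes S \<Longrightarrow> q permutes S \<Longrightarrow> inv (p \<circ> q) = inv q \<circ> inv p"
  using permutes_bij by (intro o_inv_distrib) auto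

context young_shape
begin

abbreviation "V \<equiv> irr_module lam"

text \<open>Right multiplication by \<open>c\<close> in the group algebra, written as a combination of the translates of
  \<open>c\<close> so that its values visibly lie in the left ideal \<open>V\<close>.\<close>

abbreviation conv :: "((nat \<Rightarrow> nat) \<Rightarrow> complex) \<Rightarrow> (nat \<Rightarrow> nat) \<Rightarrow> complex" where
  "conv f \<equiv> \<Sum>y\<in>Sym m. (\<lambda>g. f y * translate y c g)"

lemma translate_c_in_V: "y \<in> Sym m \<Longrightarrow> translate y c \<in> V"
  unfolding irr_module_def by (intro cfun.span_base imageI)

lemma conv_on_V:
  assumes "v \<in> V"
  shows "conv v = (\<lambda>g. h * v g)"
proof -
  have "v \<in> cfun.span ((\<lambda>p. translate p c) ` Sym m)" using assms by (simp add: irr_module_def)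
  then show ?thesis
  proof (rule cfun.span_induct)
    show "cfun.subspace {v. conv v = (\<lambda>g. h * v g)}"
      unfolding cfun.subspace_def
      by (auto simp: fun_eq_iff sum_apply algebra_simps sum.distrib sum_distrib_left[symmetric])
  next
    fix v assume "v \<in> (\<lambda>p. translate p c) ` Sym m"
    then obtain p where p: "p permutes {..<m}" "v = translate p c" by auto
    show "conv v = (\<lambda>g. h * v g)"
    proof
      fix g
      have "conv v g = (\<Sum>y\<in>Sym m. c (inv p \<circ> y) * c (inv y \<circ> g))"
        by (simp add: sum_apply p translate_def)
      also have "\<dots> = (\<Sum>y\<in>Sym m. c (inv p \<circ> (p \<circ> y)) * c (inv (p \<circ> y) \<circ> g))"
        by (rule setum_permutations_compose_left[OF p(1)])
      also have "\<dots> = (\<Sum>y\<in>Sym m. c y * c (inv y \<circ> (inv p \<circ> g)))"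
      proof (intro sum.cong refl)
        fix y assume "y \<in> Sym m"
        then have "inv (p \<circ> y) = inv y \<circ> inv p"
          using p permutes_bij by (intro o_inv_distrib) auto
        moreover have "inv p \<circ> (p \<circ> y) = y" using permutes_inv_o(2)[OF p(1)] by (metis comp_assoc id_comp)
        ultimately show "c (inv p \<circ> (p \<circ> y)) * c (inv (p \<circ> y) \<circ> g) = c y * c (inv y \<circ> (inv p \<circ> g))"
          by (simp add: comp_assoc)
      qed
      also have "\<dots> = h * v g"
      proof (cases "g \<in> Sym m")
        case True
        then have "inv p \<circ> g \<in> Sym m" using p permutes_inv by (auto intro: permutes_compose)
        then show ?thesis using c_idempotent by (simp add: p translate_def)
      next
        case False
        have out: "inv q \<circ> g \<notin> Sym m" if "q permutes {..<m}" for q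
        proof
          assume "inv q \<circ> g \<in> Sym m"
          then have "q \<circ> (inv q \<circ> g) \<in> Sym m" using that by (simp add: permutes_compose)
          moreover have "q \<circ> (inv q \<circ> g) = g" using permutes_inv_o(1)[OF that] by (metis comp_assoc id_comp)
          ultimately show False using False by simp
        qed
        have "inv y \<circ> (inv p \<circ> g) \<notin> Sym m" if "y \<in> Sym m" for y
        proof -
          have "inv (p \<circ> y) = inv y \<circ> inv p"
            using p permutes_bij that by (intro o_inv_distrib) auto
          then show ?thesis using out[of "p \<circ> y"] that p by (simp add: permutes_compose comp_assoc)
        qed
        then show ?thesis using out[OF p(1)] by (simp add: c_outside p translate_def)
      qed
      finally show "conv v g = h * v g" .
    qed
  qed
qed

lemma translate_in_V:
  assumes "v \<in> V" "p permutes {..<m}"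
  shows "translate p v \<in> V"
proof -
  have "v \<in> cfun.span ((\<lambda>p. translate p c) ` Sym m)" using assms by (simp add: irr_module_def)
  then show ?thesis
  proof (rule cfun.span_induct)
    show "cfun.subspace {v. translate p v \<in> V}"
      unfolding cfun.subspace_def irr_module_def
    proof (intro conjI ballI allI CollectI)
      show "translate p 0 \<in> cfun.span ((\<lambda>p. translate p c) ` Sym m)"
        using cfun.span_zero by (simp add: translate_def zero_fun_def)
    next
      fix x y assume "x \<in> {v. translate p v \<in> cfun.span ((\<lambda>p. translate p c) ` Sym m)}"
        "y \<in> {v. translate p v \<in> cfun.span ((\<lambda>p. translate p c) ` Sym m)}"
      then show "translate p (x + y) \<in> cfun.span ((\<lambda>p. translate p c) ` Sym m)"
        using cfun.span_add[of "translate p x" _ "translate p y"] by (simp add: translate_def plus_fun_def)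
    next
      fix k x assume "x \<in> {v. translate p v \<in> cfun.span ((\<lambda>p. translate p c) ` Sym m)}"
      then show "translate p (\<lambda>g. k * x g) \<in> cfun.span ((\<lambda>p. translate p c) ` Sym m)"
        using cfun.span_scale[of "translate p x" _ k] by (simp add: translate_def)
    qed
  next
    fix v assume "v \<in> (\<lambda>p. translate p c) ` Sym m"
    then obtain q where q: "q permutes {..<m}" "v = translate q c" by auto
    have "inv (p \<circ> q) = inv q \<circ> inv p"
      using q(1) assms(2) permutes_bij by (intro o_inv_distrib) auto
    then have "translate p v = translate (p \<circ> q) c"
      by (simp add: q translate_def comp_assoc)
    then show "translate p v \<in> V" using q(1) assms(2) by (simp add: translate_c_in_V permutes_compose)
  qed
qed

text \<open>Let \<open>E\<close> be right multiplication by \<open>c\<close>. It maps the group algebra into \<open>V\<close> and acts on \<open>V\<close> as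
  multiplication by \<open>h\<close>. The trace of \<open>p\<close> after \<open>E\<close> on the whole group algebra is the right side when
  computed in the basis of group elements, and \<open>h\<close> times the trace of \<open>p\<close> on \<open>V\<close> when computed through
  a basis of \<open>V\<close>.\<close>

lemma trace_irr:
  assumes p: "p permutes {..<m}"
  shows "h * irr_char lam p = (\<Sum>x\<in>Sym m. c (inv x \<circ> inv p \<circ> x))"
proof -
  define B where "B = (SOME B. cfun.independent B \<and> cfun.span B = V)"
  have "\<exists>B. cfun.independent B \<and> cfun.span B = V"
  proof -
    obtain B where "B \<subseteq> V" "cfun.independent B" "V \<subseteq> cfun.span B"
      by (rule cfun.maximal_independent_subset)
    moreover have "cfun.span B \<subseteq> V"
      using \<open>B \<subseteq> V\<close> unfolding irr_module_def by (intro cfun.span_minimal) auto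
    ultimately show ?thesis by blast
  qed
  then have B: "cfun.independent B" "cfun.span B = V"
    unfolding B_def by (metis (mono_tags, lifting) someI_ex)+
  have "B \<subseteq> cfun.span ((\<lambda>p. translate p c) ` Sym m)"
    using cfun.span_superset[of B] B(2) by (simp add: irr_module_def)
  then have fin: "finite B"
    using cfun.independent_span_bound[of "(\<lambda>p. translate p c) ` Sym m" B] B(1) by simp
  have BV: "b \<in> V" if "b \<in> B" for b using cfun.span_base[OF that] B by simp
  \<comment> \<open>The coordinates of \<open>E\<close> applied to the group element \<open>x\<close>, whose image is \<open>translate x c\<close>.\<close>
  define rho where "rho x b = cfun.representation B (translate x c) b" for x b
  have expand: "translate x c g = (\<Sum>b\<in>B. rho x b * b g)" if "x \<in> Sym m" for x g
  proof -
    have "(\<Sum>b\<in>B. (\<lambda>g. rho x b * b g)) = translate x c"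
      unfolding rho_def using translate_c_in_V[OF that] B fin
      by (intro cfun.sum_representation_eq) auto
    from fun_cong[OF this, of g] show ?thesis by (simp add: sum_apply)
  qed
  have coeff: "(\<Sum>x\<in>Sym m. translate p b x * rho x b) = h * cfun.representation B (translate p b) b"
    if b: "b \<in> B" for b
  proof -
    let ?T = "translate p b"
    have TV: "?T \<in> V" using translate_in_V BV[OF b] p by blast
    have sc: "(\<lambda>g. ?T x * translate x c g) \<in> cfun.span B" if "x \<in> Sym m" for x
      using cfun.span_scale[of "translate x c" B "?T x"] translate_c_in_V[OF that] B by simp
    have "cfun.representation B (conv ?T) b
        = (\<Sum>x\<in>Sym m. cfun.representation B (\<lambda>g. ?T x * translate x c g) b)"
      by (subst cfun.representation_sum[OF B(1) sc]) simp_all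
    also have "\<dots> = (\<Sum>x\<in>Sym m. ?T x * rho x b)"
      unfolding rho_def using translate_c_in_V B
      by (intro sum.cong refl) (simp add: cfun.representation_scale)
    finally have "(\<Sum>x\<in>Sym m. ?T x * rho x b) = cfun.representation B (conv ?T) b" ..
    also have "conv ?T = (\<lambda>g. h * ?T g)" by (rule conv_on_V[OF TV])
    also have "cfun.representation B (\<lambda>g. h * ?T g) b = h * cfun.representation B ?T b"
      using TV B by (subst cfun.representation_scale) auto
    finally show ?thesis .
  qed
  have "(\<Sum>x\<in>Sym m. c (inv x \<circ> inv p \<circ> x)) = (\<Sum>x\<in>Sym m. \<Sum>b\<in>B. translate p b x * rho x b)"
  proof (intro sum.cong refl)
    fix x assume x: "x \<in> Sym m"
    have "c (inv x \<circ> inv p \<circ> x) = translate x c (inv p \<circ> x)" by (simp add: translate_def comp_assoc)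
    then show "c (inv x \<circ> inv p \<circ> x) = (\<Sum>b\<in>B. translate p b x * rho x b)"
      unfolding expand[OF x] by (simp add: translate_def mult.commute)
  qed
  also have "\<dots> = (\<Sum>b\<in>B. \<Sum>x\<in>Sym m. translate p b x * rho x b)" by (rule sum.swap)
  also have "\<dots> = h * (\<Sum>b\<in>B. cfun.representation B (translate p b) b)"
    by (simp add: coeff sum_distrib_left)
  also have "\<dots> = h * irr_char lam p"
    unfolding irr_char_def trace_on_def Let_def B_def[symmetric] ..
  finally show ?thesis ..
qed

text \<open>For \<open>p = id\<close> the right side of \<open>trace_irr\<close> is \<open>m!\<close>.\<close>

lemma h_nonzero: "h \<noteq> 0"
proof
  assume "h = 0"
  then have "(\<Sum>x\<in>Sym m. c (inv x \<circ> inv id \<circ> x)) = 0"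
    using trace_irr[of id] by (simp add: permutes_id)
  moreover have "(\<Sum>x\<in>Sym m. c (inv x \<circ> inv id \<circ> x)) = (\<Sum>x\<in>Sym m. 1)"
  proof (intro sum.cong refl)
    fix x assume "x \<in> Sym m"
    then have "inv x \<circ> inv id \<circ> x = id" using permutes_inv_o(2)[of x "{..<m}"] by simp
    then show "c (inv x \<circ> inv id \<circ> x) = 1" by (simp add: c_id)
  qed
  ultimately show False using card_permutations[of "{..<m}" m] by simp
qed

text \<open>By \<open>trace_irr\<close> this is \<open>h\<close> times the irreducible character. It is an explicit class function with
  real values, so inner products with it reduce to sums against \<open>c\<close>.\<close>

definition conj_sum :: "(nat \<Rightarrow> nat) \<Rightarrow> complex" where
  "conj_sum p = (\<Sum>x\<in>Sym m. c (inv x \<circ> inv p \<circ> x))"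

lemma conj_sum_conj:
  assumes x: "x permutes {..<m}" and p: "p permutes {..<m}"
  shows "conj_sum (x \<circ> p \<circ> inv x) = conj_sum p"
proof -
  have bx: "bij x" "bij (inv x)" "bij p" "bij (p \<circ> inv x)"
    using x p permutes_bij permutes_inv permutes_compose by blast+
  have "inv (x \<circ> p \<circ> inv x) = x \<circ> inv p \<circ> inv x"
    using bx by (simp add: o_inv_distrib comp_assoc inv_inv_eq)
  then have "conj_sum (x \<circ> p \<circ> inv x) = (\<Sum>y\<in>Sym m. c (inv y \<circ> (x \<circ> inv p \<circ> inv x) \<circ> y))"
    by (simp add: conj_sum_def)
  also have "\<dots> = (\<Sum>y\<in>Sym m. c (inv (x \<circ> y) \<circ> (x \<circ> inv p \<circ> inv x) \<circ> (x \<circ> y)))"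
    by (rule setum_permutations_compose_left[OF x])
  also have "\<dots> = conj_sum p"
    unfolding conj_sum_def
  proof (intro sum.cong refl)
    fix y assume "y \<in> Sym m"
    then have "inv (x \<circ> y) = inv y \<circ> inv x" using x permutes_bij by (intro o_inv_distrib) auto
    moreover have "inv x (x z) = z" for z using permutes_inverses(2)[OF x] .
    ultimately have "inv (x \<circ> y) \<circ> (x \<circ> inv p \<circ> inv x) \<circ> (x \<circ> y) = inv y \<circ> inv p \<circ> y"
      by (simp add: fun_eq_iff)
    then show "c (inv (x \<circ> y) \<circ> (x \<circ> inv p \<circ> inv x) \<circ> (x \<circ> y)) = c (inv y \<circ> inv p \<circ> y)" by simp
  qed
  finally show ?thesis .
qed

text \<open>The summation over conjugates can be moved from \<open>c\<close> to the class function \<open>F\<close>, where it has no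
  effect beyond the factor \<open>m!\<close>.\<close>

lemma sum_conj_sum_class_function:
  assumes F: "\<And>x p. x \<in> Sym m \<Longrightarrow> p \<in> Sym m \<Longrightarrow> F (x \<circ> p \<circ> inv x) = F p"
  shows "(\<Sum>p\<in>Sym m. conj_sum p * F (inv p)) = fact m * (\<Sum>p\<in>Sym m. c p * F p)"
proof -
  have "(\<Sum>p\<in>Sym m. conj_sum p * F (inv p)) = (\<Sum>p\<in>Sym m. \<Sum>x\<in>Sym m. c (inv x \<circ> inv p \<circ> x) * F (inv p))"
    by (simp add: conj_sum_def sum_distrib_right)
  also have "\<dots> = (\<Sum>x\<in>Sym m. \<Sum>p\<in>Sym m. c (inv x \<circ> inv p \<circ> x) * F (inv p))" by (rule sum.swap)
  also have "\<dots> = (\<Sum>x\<in>Sym m. \<Sum>p\<in>Sym m. c p * F p)"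
  proof (rule sum.cong[OF refl])
    fix x assume "x \<in> Sym m"
    then have x: "x permutes {..<m}" "inv x permutes {..<m}" using permutes_inv by auto
    have inv: "x (inv x z) = z" "inv x (x z) = z" for z using permutes_inverses[OF x(1)] by auto
    show "(\<Sum>p\<in>Sym m. c (inv x \<circ> inv p \<circ> x) * F (inv p)) = (\<Sum>p\<in>Sym m. c p * F p)"
    proof (rule sum.reindex_bij_witness[of _ "\<lambda>p. inv (x \<circ> p \<circ> inv x)" "\<lambda>p. inv x \<circ> inv p \<circ> x"])
      fix p assume p: "p \<in> Sym m"
      have pc: "p permutes {..<m}" "x \<circ> p \<circ> inv x permutes {..<m}" "inv x \<circ> inv p \<circ> x permutes {..<m}"
        using p x permutes_inv[of p] by (auto intro!: permutes_compose)
      show "inv x \<circ> inv p \<circ> x \<in> Sym m" "inv (x \<circ> p \<circ> inv x) \<in> Sym m"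
        using pc permutes_inv by auto
      have conj: "x \<circ> (inv x \<circ> inv p \<circ> x) \<circ> inv x = inv p"
        using inv by (simp add: fun_eq_iff)
      show "inv (x \<circ> (inv x \<circ> inv p \<circ> x) \<circ> inv x) = p"
        unfolding conj by (rule permutes_inv_inv[OF pc(1)])
      have "inv (inv (x \<circ> p \<circ> inv x)) = x \<circ> p \<circ> inv x" by (rule permutes_inv_inv[OF pc(2)])
      then show "inv x \<circ> inv (inv (x \<circ> p \<circ> inv x)) \<circ> x = p"
        using inv by (simp add: fun_eq_iff)
      show "c (inv x \<circ> inv p \<circ> x) * F (inv x \<circ> inv p \<circ> x) = c (inv x \<circ> inv p \<circ> x) * F (inv p)"
        using F[of x "inv x \<circ> inv p \<circ> x"] pc x conj by simp
    qed
  qed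
  also have "\<dots> = fact m * (\<Sum>p\<in>Sym m. c p * F p)"
    using card_permutations[of "{..<m}" m] by simp
  finally show ?thesis .
qed

text \<open>The inverse of \<open>r \<circ> q\<close> is \<open>inv q \<circ> inv r\<close>, which is conjugate to \<open>inv r \<circ> inv q\<close>, and both
  subgroups are closed under inversion.\<close>

lemma conj_sum_inv:
  assumes p: "p permutes {..<m}"
  shows "conj_sum (inv p) = conj_sum p"
proof -
  \<comment> \<open>How often the class sum of \<open>a\<close> meets \<open>b\<close>.\<close>
  define n where "n a b = complex_of_nat (card {x \<in> Sym m. inv x \<circ> inv a \<circ> x = b})" for a b :: "nat \<Rightarrow> nat"
  have conj_sum_n: "conj_sum a = (\<Sum>r\<in>R. \<Sum>q\<in>C. of_int (sign q) * n a (r \<circ> q))" if a: "a permutes {..<m}" for a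
  proof -
    have mem: "inv x \<circ> inv a \<circ> x \<in> Sym m" if "x \<in> Sym m" for x
      using that a permutes_inv permutes_compose by (metis mem_Collect_eq)
    have "conj_sum a = (\<Sum>x\<in>Sym m. \<Sum>y\<in>Sym m. c y * (if inv x \<circ> inv a \<circ> x = y then 1 else 0))"
      unfolding conj_sum_def using mem by (intro sum.cong refl) (simp add: sum.delta if_distrib cong: if_cong)
    also have "\<dots> = (\<Sum>y\<in>Sym m. c y * n a y)"
      unfolding n_def by (subst sum.swap) (simp add: sum_distrib_left[symmetric] sum.inter_filter[symmetric] flip: of_nat_sum)
    finally show ?thesis by (simp only: sum_c)
  qed
  have flip: "n (inv p) (r \<circ> q) = n p (inv r \<circ> inv q)" if r: "r \<in> R" and q: "q \<in> C" for r q
  proof -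
    have "card {x \<in> Sym m. inv x \<circ> inv (inv p) \<circ> x = r \<circ> q} = card {x \<in> Sym m. inv x \<circ> inv p \<circ> x = inv r \<circ> inv q}"
    proof (rule bij_betw_same_card[of "\<lambda>x. x \<circ> inv q"], rule bij_betw_byWitness[where f' = "\<lambda>x. x \<circ> q"])
      have Q: "q permutes {..<m}" "inv q permutes {..<m}" "r permutes {..<m}"
        using C_permutes[OF q] permutes_inv R_permutes[OF r] by auto
      have I: "q (inv q z) = z" "inv q (q z) = z" "r (inv r z) = z" "inv r (r z) = z" "p (inv p z) = z" "inv p (p z) = z" for z
        using permutes_inverses[OF Q(1)] permutes_inverses[OF Q(3)] permutes_inverses[OF p] by auto
      show "\<forall>x\<in>{x \<in> Sym m. inv x \<circ> inv (inv p) \<circ> x = r \<circ> q}. x \<circ> inv q \<circ> q = x"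
        "\<forall>x\<in>{x \<in> Sym m. inv x \<circ> inv p \<circ> x = inv r \<circ> inv q}. x \<circ> q \<circ> inv q = x"
        using I by (simp_all add: fun_eq_iff)
      show "(\<lambda>x. x \<circ> inv q) ` {x \<in> Sym m. inv x \<circ> inv (inv p) \<circ> x = r \<circ> q}
        \<subseteq> {x \<in> Sym m. inv x \<circ> inv p \<circ> x = inv r \<circ> inv q}"
      proof
        fix z assume "z \<in> (\<lambda>x. x \<circ> inv q) ` {x \<in> Sym m. inv x \<circ> inv (inv p) \<circ> x = r \<circ> q}"
        then obtain x where x: "x permutes {..<m}" "inv x \<circ> p \<circ> x = r \<circ> q" "z = x \<circ> inv q"
          using permutes_inv_inv[OF p] by auto
        have J: "x (inv x y) = y" "inv x (x y) = y" for y using permutes_inverses[OF x(1)] by auto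
        have iz: "inv z = q \<circ> inv x"
          using x(1,3) Q by (simp add: inv_comp_permutes permutes_inv_inv)
        have e: "p (x y) = x (r (q y))" for y
          using arg_cong[OF fun_cong[OF x(2), of y], of x] J by simp
        have "inv p (x y) = x (inv q (inv r y))" for y
          using arg_cong[OF e[of "inv q (inv r y)"], of "inv p"] I by simp
        then have "inv z \<circ> inv p \<circ> z = inv r \<circ> inv q"
          using I J unfolding iz unfolding x(3) by (simp add: fun_eq_iff)
        then show "z \<in> {x \<in> Sym m. inv x \<circ> inv p \<circ> x = inv r \<circ> inv q}"
          using x Q by (simp add: permutes_compose)
      qed
      show "(\<lambda>x. x \<circ> q) ` {x \<in> Sym m. inv x \<circ> inv p \<circ> x = inv r \<circ> inv q}
        \<subseteq> {x \<in> Sym m. inv x \<circ> inv (inv p) \<circ> x = r \<circ> q}"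
      proof
        fix z assume "z \<in> (\<lambda>x. x \<circ> q) ` {x \<in> Sym m. inv x \<circ> inv p \<circ> x = inv r \<circ> inv q}"
        then obtain x where x: "x permutes {..<m}" "inv x \<circ> inv p \<circ> x = inv r \<circ> inv q" "z = x \<circ> q"
          by auto
        have J: "x (inv x y) = y" "inv x (x y) = y" for y using permutes_inverses[OF x(1)] by auto
        have iz: "inv z = inv q \<circ> inv x"
          using x(1,3) Q by (simp add: inv_comp_permutes)
        have e: "inv p (x y) = x (inv r (inv q y))" for y
          using arg_cong[OF fun_cong[OF x(2), of y], of x] J by simp
        have "p (x y) = x (q (r y))" for y
          using arg_cong[OF e[of "q (r y)"], of p] I by simp
        then have "inv z \<circ> p \<circ> z = r \<circ> q"
          using I J unfolding iz unfolding x(3) by (simp add: fun_eq_iff)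
        then show "z \<in> {x \<in> Sym m. inv x \<circ> inv (inv p) \<circ> x = r \<circ> q}"
          using x Q permutes_inv_inv[OF p] by (simp add: permutes_compose)
      qed
    qed
    then show ?thesis by (simp add: n_def)
  qed
  have "conj_sum (inv p) = (\<Sum>r\<in>R. \<Sum>q\<in>C. of_int (sign q) * n p (inv r \<circ> inv q))"
    unfolding conj_sum_n[OF permutes_inv[OF p]] by (intro sum.cong refl) (simp add: flip)
  also have "\<dots> = (\<Sum>r\<in>R. \<Sum>q\<in>C. of_int (sign q) * n p (r \<circ> inv q))"
    by (rule sum.reindex_bij_witness[of _ inv inv]) (auto simp: inv_R permutes_inv_inv[OF R_permutes])
  also have "\<dots> = (\<Sum>r\<in>R. \<Sum>q\<in>C. of_int (sign q) * n p (r \<circ> q))"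
    by (rule sum.cong[OF refl], rule sum.reindex_bij_witness[of _ inv inv])
      (auto simp: inv_C sign_C_inv permutes_inv_inv[OF C_permutes])
  also have "\<dots> = conj_sum p" by (rule conj_sum_n[OF p, symmetric])
  finally show ?thesis .
qed

text \<open>Replacing one factor by \<open>c\<close> leaves the coefficients of \<open>c * x * c\<close> at \<open>x\<close>, which \<open>c_sandwich\<close> and
  \<open>c_idempotent\<close> evaluate.\<close>

lemma conj_sum_norm: "(\<Sum>p\<in>Sym m. conj_sum p * conj_sum p) = fact m * h\<^sup>2"
proof -
  have "(\<Sum>p\<in>Sym m. conj_sum p * conj_sum p) = (\<Sum>p\<in>Sym m. conj_sum p * conj_sum (inv p))"
    by (intro sum.cong refl) (simp add: conj_sum_inv)
  also have "\<dots> = fact m * (\<Sum>p\<in>Sym m. c p * conj_sum p)"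
    using conj_sum_conj by (intro sum_conj_sum_class_function) auto
  also have "(\<Sum>p\<in>Sym m. c p * conj_sum p) = (\<Sum>x\<in>Sym m. \<Sum>p\<in>Sym m. c p * c (inv x \<circ> inv p \<circ> x))"
    unfolding conj_sum_def sum_distrib_left by (rule sum.swap)
  also have "\<dots> = (\<Sum>x\<in>Sym m. h * c (inv x) * c x)"
  proof (intro sum.cong refl)
    fix x assume "x \<in> Sym m"
    then have x: "x permutes {..<m}" "inv x \<in> Sym m" using permutes_inv by auto
    have "(\<Sum>p\<in>Sym m. c p * c (inv x \<circ> inv p)) = (\<Sum>p\<in>Sym m. c (inv p \<circ> inv x) * c p)"
    proof (rule sum.reindex_bij_witness[of _ "\<lambda>p. inv p \<circ> inv x" "\<lambda>p. inv x \<circ> inv p"])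
      fix p assume p: "p \<in> Sym m"
      have pc: "inv p permutes {..<m}" "inv x permutes {..<m}" "p permutes {..<m}" using p x permutes_inv by auto
      show "inv x \<circ> inv p \<in> Sym m" "inv p \<circ> inv x \<in> Sym m" using pc by (auto intro: permutes_compose)
      have a: "inv (inv x \<circ> inv p) = p \<circ> x" "inv (inv p \<circ> inv x) = x \<circ> p"
        using pc x(1) by (simp_all add: inv_comp_permutes permutes_inv_inv)
      have I: "x (inv x z) = z" "inv x (x z) = z" for z using permutes_inverses[OF x(1)] by auto
      show "inv (inv x \<circ> inv p) \<circ> inv x = p" "inv x \<circ> inv (inv p \<circ> inv x) = p"
        unfolding a using I by (simp_all add: fun_eq_iff)
      then show "c (inv (inv x \<circ> inv p) \<circ> inv x) * c (inv x \<circ> inv p) = c p * c (inv x \<circ> inv p)" by simp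
    qed
    also have "\<dots> = (\<Sum>p\<in>Sym m. c p * c (inv p \<circ> inv x))" by (simp add: mult.commute)
    also have "\<dots> = h * c (inv x)" by (rule c_idempotent[OF x(2)])
    finally show "(\<Sum>p\<in>Sym m. c p * c (inv x \<circ> inv p \<circ> x)) = h * c (inv x) * c x"
      using c_sandwich[OF x(2), of x] x by simp
  qed
  also have "\<dots> = h * h" by (simp add: h_def sum_distrib_left mult_ac)
  finally show ?thesis by (simp add: power2_eq_square)
qed

end

section \<open>The determinantal formula for irreducible characters\<close>

text \<open>The parts of a partition as an integer vector, extended by \<open>0\<close>.\<close>

definition part :: "nat list \<Rightarrow> nat \<Rightarrow> int" where
  "part lam i = (if i < length lam then int (lam ! i) else 0)"

lemma sum_part:
  assumes "length lam \<le> s"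
  shows "(\<Sum>i<s. part lam i) = int (sum_list lam)"
proof -
  have "(\<Sum>i<s. part lam i) = (\<Sum>i<length lam. part lam i)"
    by (rule sum.mono_neutral_right) (use assms in \<open>auto simp: part_def\<close>)
  also have "\<dots> = int (sum_list lam)" by (simp add: part_def sum_list_sum_nth atLeast0LessThan)
  finally show ?thesis .
qed

context young_shape
begin

lemma content_row: "content m row i = part lam i"
proof (cases "i < length lam")
  case True
  then show ?thesis using card_row[OF True] by (simp add: content_def part_def)
next
  case False
  then have "{x. x < m \<and> row x = i} = {}" using box_mem by auto
  then show ?thesis using False by (simp only: content_def part_def card.empty) simp
qed

text \<open>Two equal letters of \<open>w\<close> in one column give a transposition \<open>u\<close> in the column group that fixes
  \<open>w\<close>. Multiplication by \<open>u\<close> permutes the summation range and changes the sign of every term.\<close>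

lemma sum_c_stabilizer_eq_0:
  assumes "\<not> column_injective w"
  shows "(\<Sum>p | p \<in> Sym m \<and> w \<circ> p = w. c p) = 0"
proof -
  obtain y z where yz: "y < m" "z < m" "col y = col z" "y \<noteq> z" "w y = w z"
    using assms by (auto simp: column_injective_def inj_on_def column_def)
  let ?u = "transpose y z"
  have u: "?u \<in> C" using yz by (intro transpose_C) auto
  have wu: "w \<circ> ?u = w" using yz by (auto simp: fun_eq_iff transpose_def)
  have "(\<Sum>p | p \<in> Sym m \<and> w \<circ> p = w. c p) = (\<Sum>p | p \<in> Sym m \<and> w \<circ> p = w. c (p \<circ> ?u))"
  proof (rule sum.reindex_bij_witness[of _ "\<lambda>p. p \<circ> ?u" "\<lambda>p. p \<circ> ?u"])
    fix p assume p: "p \<in> {p \<in> Sym m. w \<circ> p = w}"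
    then have "p \<circ> ?u permutes {..<m}" using C_permutes[OF u] by (simp add: permutes_compose)
    moreover have "w \<circ> (p \<circ> ?u) = w" using p wu by (metis (mono_tags, lifting) comp_assoc mem_Collect_eq)
    ultimately show "p \<circ> ?u \<in> {p \<in> Sym m. w \<circ> p = w}" "p \<circ> ?u \<in> {p \<in> Sym m. w \<circ> p = w}" by auto
  qed (auto simp: comp_assoc)
  also have "\<dots> = - (\<Sum>p | p \<in> Sym m \<and> w \<circ> p = w. c p)"
    using yz by (simp add: c_right[OF u] sign_swap_id sum_negf)
  finally show ?thesis by simp
qed

lemma sum_c_permchar:
  "(\<Sum>p\<in>Sym m. c p * of_int (permchar m s a p)) =
   (\<Sum>w | w \<in> words m {..<s} \<and> (\<forall>i<s. content m w i = a i) \<and> column_injective w.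
      \<Sum>p | p \<in> Sym m \<and> w \<circ> p = w. c p)"
proof -
  let ?W = "{w \<in> words m {..<s}. \<forall>i<s. content m w i = a i}"
  have fin: "finite ?W" using finite_words[of "{..<s}" m] by simp
  have "(\<Sum>p\<in>Sym m. c p * of_int (permchar m s a p)) = (\<Sum>p\<in>Sym m. \<Sum>w\<in>?W. if w \<circ> p = w then c p else 0)"
  proof (rule sum.cong[OF refl])
    fix p
    have "{w \<in> words m {..<s}. (\<forall>i<s. content m w i = a i) \<and> w \<circ> p = w} = {w \<in> ?W. w \<circ> p = w}" by auto
    then have "permchar m s a p = int (card {w \<in> ?W. w \<circ> p = w})" by (simp only: permchar_def)
    moreover have "(\<Sum>w\<in>?W. if w \<circ> p = w then c p else 0) = (\<Sum>w\<in>{w \<in> ?W. w \<circ> p = w}. c p)"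
      using fin by (intro sum.inter_filter[symmetric])
    ultimately show "c p * of_int (permchar m s a p) = (\<Sum>w\<in>?W. if w \<circ> p = w then c p else 0)"
      by simp
  qed
  also have "\<dots> = (\<Sum>w\<in>?W. \<Sum>p\<in>Sym m. if w \<circ> p = w then c p else 0)" by (rule sum.swap)
  also have "\<dots> = (\<Sum>w\<in>?W. \<Sum>p | p \<in> Sym m \<and> w \<circ> p = w. c p)"
    by (intro sum.cong refl sum.inter_filter[symmetric] finite_Sym)
  also have "\<dots> = (\<Sum>w | w \<in> words m {..<s} \<and> (\<forall>i<s. content m w i = a i) \<and> column_injective w.
      \<Sum>p | p \<in> Sym m \<and> w \<circ> p = w. c p)"
    by (rule sum.mono_neutral_right[OF fin]) (use sum_c_stabilizer_eq_0 in auto)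
  finally show ?thesis .
qed

lemma sum_c_permchar_dominance:
  assumes "(\<Sum>p\<in>Sym m. c p * of_int (permchar m s a p)) \<noteq> 0" "t \<le> s"
  shows "(\<Sum>i<t. a i) \<le> (\<Sum>i<t. part lam i)"
proof -
  obtain w where
    "w \<in> {w. w \<in> words m {..<s} \<and> (\<forall>i<s. content m w i = a i) \<and> column_injective w}"
    using assms(1) unfolding sum_c_permchar by (rule sum.not_neutral_contains_not_neutral)
  then have w: "w \<in> words m {..<s}" "\<forall>i<s. content m w i = a i" "column_injective w" by auto
  have "(\<Sum>i<t. a i) = (\<Sum>i<t. content m w i)" using w(2) assms(2) by (intro sum.cong) auto
  also have "\<dots> \<le> (\<Sum>i<t. content m row i)"
    using column_injective_dominance[OF w(3), of t] unfolding card_less_by_content[symmetric] by simp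
  finally show ?thesis by (simp add: content_row)
qed

text \<open>By \<open>straighten_word\<close> the column injective words of this content are the words \<open>row \<circ> q\<close> with \<open>q\<close> in
  the column group, each arising once. The stabilizer of such a word is a conjugate of the row group,
  and the resulting double sum over both groups is the one that defines \<open>h\<close>.\<close>

lemma sum_c_permchar_row:
  assumes s: "length lam \<le> s" and a: "\<And>i. i < s \<Longrightarrow> a i = part lam i"
  shows "(\<Sum>p\<in>Sym m. c p * of_int (permchar m s a p)) = h"
proof -
  let ?W = "{w. w \<in> words m {..<s} \<and> (\<forall>i<s. content m w i = a i) \<and> column_injective w}"
  define roww where "roww = restrict row {..<m}"
  have row_words: "roww \<in> words m {..<s}"
    using box_mem s by (auto simp: roww_def intro: less_le_trans)
  have roww: "roww x = row x" if "x < m" for x using that by (simp add: roww_def)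
  have content_roww: "content m roww i = part lam i" for i
  proof -
    have "{x. x < m \<and> roww x = i} = {x. x < m \<and> row x = i}" using roww by auto
    then show ?thesis using content_row[of i] by (simp only: content_def)
  qed
  have bij: "bij_betw (\<lambda>q. roww \<circ> q) C ?W"
    unfolding bij_betw_def
  proof
    show "inj_on (\<lambda>q. roww \<circ> q) C"
    proof (rule inj_onI)
      fix q q' assume q: "q \<in> C" "q' \<in> C" "roww \<circ> q = roww \<circ> q'"
      show "q = q'"
      proof
        fix x show "q x = q' x"
        proof (cases "x < m")
          case True
          then have lt: "q x < m" "q' x < m" using perm_lt C_permutes q by auto
          have "row (q x) = row (q' x)" using fun_cong[OF q(3), of x] lt roww by simp
          moreover have "col (q x) = col (q' x)" using q True by (simp add: column_group_def)
          ultimately show ?thesis using box_inj lt by blast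
        next
          case False
          then show ?thesis
            using permutes_not_in[OF C_permutes[OF q(1)], of x] permutes_not_in[OF C_permutes[OF q(2)], of x]
            by simp
        qed
      qed
    qed
    show "(\<lambda>q. roww \<circ> q) ` C = ?W"
    proof (intro equalityI subsetI)
      fix w assume "w \<in> (\<lambda>q. roww \<circ> q) ` C"
      then obtain q where q: "q \<in> C" "w = roww \<circ> q" by auto
      have qS: "q \<in> Sym m" using C_permutes[OF q(1)] by simp
      have "column_injective w"
        unfolding column_injective_def
      proof (intro allI inj_onI)
        fix j x y assume xy: "x \<in> column j" "y \<in> column j" "w x = w y"
        then have lt: "x < m" "y < m" "q x < m" "q y < m" "col x = col y"
          using perm_lt[OF C_permutes[OF q(1)]] by (auto simp: column_def)
        then have "row (q x) = row (q y)" using xy(3) roww q(2) by simp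
        moreover have "col (q x) = col (q y)" using q(1) lt by (simp add: column_group_def)
        ultimately have "q x = q y" using box_inj lt by blast
        then show "x = y" using permutes_inj[OF C_permutes[OF q(1)]] by (auto dest: injD)
      qed
      then show "w \<in> ?W"
        using words_comp[OF row_words qS] content_comp[OF qS, of roww] q(2) content_roww a by simp
    next
      fix w assume w: "w \<in> ?W"
      have "content m w i = content m row i" for i
      proof (cases "i < s")
        case True
        then show ?thesis using w a by (simp add: content_row)
      next
        case False
        then have "content m w i = 0"
          using content_in_contents[of "{..<s}" w m] w by (simp add: contents_def)
        then show ?thesis using False s by (simp add: content_row part_def)
      qed
      then obtain q where q: "q \<in> C" "\<forall>x<m. w (q x) = row x"
        using straighten_word[of w] w by blast
      have qi: "inv q \<in> C" by (rule inv_C[OF q(1)])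
      have "w = roww \<circ> inv q"
      proof (rule PiE_ext[of _ "{..<m}" "\<lambda>_. {..<s}"])
        show "roww \<circ> inv q \<in> words m {..<s}"
          using words_comp[OF row_words] C_permutes[OF qi] by simp
        fix x assume "x \<in> {..<m}"
        then have x: "x < m" "inv q x < m" using perm_lt[OF C_permutes[OF qi]] by auto
        have "w x = w (q (inv q x))" using permutes_inverses(1)[OF C_permutes[OF q(1)]] by simp
        then show "w x = (roww \<circ> inv q) x" using q(2) x roww by simp
      qed (use w in auto)
      then show "w \<in> (\<lambda>q. roww \<circ> q) ` C" using qi by blast
    qed
  qed
  have inner: "(\<Sum>p | p \<in> Sym m \<and> (roww \<circ> q) \<circ> p = roww \<circ> q. c p) = (\<Sum>r\<in>R. of_int (sign q) * c (inv q \<circ> r))"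
    if q: "q \<in> C" for q
  proof (rule sum.reindex_bij_witness[of _ "\<lambda>r. inv q \<circ> r \<circ> q" "\<lambda>p. q \<circ> p \<circ> inv q"])
    have Q: "q permutes {..<m}" "inv q permutes {..<m}" using C_permutes[OF q] permutes_inv by auto
    have I: "q (inv q x) = x" "inv q (q x) = x" for x using permutes_inverses[OF Q(1)] by auto
    show "inv q \<circ> (q \<circ> p \<circ> inv q) \<circ> q = p" "q \<circ> (inv q \<circ> p \<circ> q) \<circ> inv q = p" for p :: "nat \<Rightarrow> nat"
      using I by (simp_all add: fun_eq_iff)
    show "q \<circ> p \<circ> inv q \<in> R" if "p \<in> {p \<in> Sym m. (roww \<circ> q) \<circ> p = roww \<circ> q}" for p
    proof -
      have p: "p permutes {..<m}" "(roww \<circ> q) \<circ> p = roww \<circ> q" using that by auto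
      have pq: "roww (q (p y)) = roww (q y)" for y using fun_cong[OF p(2), of y] by simp
      have perm: "q \<circ> p \<circ> inv q permutes {..<m}" using p(1) Q by (simp add: permutes_compose)
      have "row ((q \<circ> p \<circ> inv q) x) = row x" if "x < m" for x
        using pq[of "inv q x"] roww[OF that] roww[OF perm_lt[OF perm that]] I by simp
      then show ?thesis using perm by (simp add: row_group_def)
    qed
    show "inv q \<circ> r \<circ> q \<in> {p \<in> Sym m. (roww \<circ> q) \<circ> p = roww \<circ> q}" if r: "r \<in> R" for r
    proof -
      have perm: "inv q \<circ> r \<circ> q \<in> Sym m" using R_permutes[OF r] Q by (simp add: permutes_compose)
      have "roww (q ((inv q \<circ> r \<circ> q) x)) = roww (q x)" if "x < m" for x
      proof -
        have "q x < m" "r (q x) < m" using that perm_lt Q R_permutes[OF r] by auto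
        then show ?thesis using r I roww by (simp add: row_group_def)
      qed
      then have "(roww \<circ> q) \<circ> (inv q \<circ> r \<circ> q) = roww \<circ> q"
        using perm Q words_comp[OF row_words] by (subst fixed_word_iff[of _ m "{..<s}"]) auto
      then show ?thesis using perm by simp
    qed
    show "of_int (sign q) * c (inv q \<circ> (q \<circ> p \<circ> inv q)) = c p" for p
    proof -
      have "inv q \<circ> (q \<circ> p \<circ> inv q) = p \<circ> inv q" using I by (simp add: fun_eq_iff)
      then have "of_int (sign q) * c (inv q \<circ> (q \<circ> p \<circ> inv q)) = of_int (sign q) * of_int (sign q) * c p"
        using c_right[OF inv_C[OF q], of p] sign_C_inv[OF q] by simp
      then show ?thesis by (simp flip: of_int_mult)
    qed
  qed
  have "(\<Sum>p\<in>Sym m. c p * of_int (permchar m s a p)) = (\<Sum>q\<in>C. \<Sum>r\<in>R. of_int (sign q) * c (inv q \<circ> r))"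
    unfolding sum_c_permchar sum.reindex_bij_betw[OF bij, symmetric] by (intro sum.cong refl inner)
  also have "\<dots> = (\<Sum>r\<in>R. \<Sum>q\<in>C. of_int (sign q) * c (inv q \<circ> r))" by (rule sum.swap)
  also have "\<dots> = (\<Sum>r\<in>R. \<Sum>q\<in>C. of_int (sign q) * c (inv (r \<circ> q)))"
    by (rule sum.reindex_bij_witness[of _ inv inv])
      (auto simp: inv_R permutes_inv_inv[OF R_permutes] inv_comp_permutes[OF R_permutes C_permutes])
  also have "\<dots> = h" unfolding h_def by (rule sum_c[symmetric])
  finally show ?thesis .
qed

lemma sum_conj_sum_permchar:
  "(\<Sum>p\<in>Sym m. conj_sum p * of_int (permchar m s a p)) = fact m * (\<Sum>p\<in>Sym m. c p * of_int (permchar m s a p))"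
proof -
  have "(\<Sum>p\<in>Sym m. conj_sum p * of_int (permchar m s a p)) = (\<Sum>p\<in>Sym m. conj_sum p * of_int (permchar m s a (inv p)))"
    by (intro sum.cong refl) (simp add: permchar_inv)
  also have "\<dots> = fact m * (\<Sum>p\<in>Sym m. c p * of_int (permchar m s a p))"
    by (rule sum_conj_sum_class_function) (simp add: permchar_conj)
  finally show ?thesis .
qed

lemma part_decreasing: "part lam (Suc i) \<le> part lam i"
  using sorted_wrt_nth_less[OF dec, of i "Suc i"] by (cases "Suc i < length lam") (auto simp: part_def)

text \<open>As in \<open>determinantal_char_norm\<close>, dominance leaves only the identity permutation.\<close>

lemma conj_sum_determinantal_char_inner:
  assumes s: "length lam \<le> s"
  defines "l \<equiv> \<lambda>i. part lam i + staircase s i"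
  shows "(\<Sum>p\<in>Sym m. conj_sum p * of_int (determinantal_char m s l p)) = fact m * h"
proof -
  have "(\<Sum>p\<in>Sym m. conj_sum p * of_int (determinantal_char m s l p))
     = (\<Sum>p\<in>Sym m. \<Sum>q\<in>Sym s. of_int (sign q) * (conj_sum p * of_int (permchar m s (\<lambda>j. l j - staircase s (q j)) p)))"
    unfolding determinantal_char_def by (simp add: sum_distrib_left mult_ac)
  also have "\<dots> = (\<Sum>q\<in>Sym s. of_int (sign q) * (\<Sum>p\<in>Sym m. conj_sum p * of_int (permchar m s (\<lambda>j. l j - staircase s (q j)) p)))"
    by (subst sum.swap) (simp add: sum_distrib_left)
  also have "\<dots> = (\<Sum>q\<in>Sym s. if q = id then fact m * h else 0)"
  proof (rule sum.cong[OF refl])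
    fix q assume q: "q \<in> Sym s"
    let ?a = "\<lambda>j. l j - staircase s (q j)"
    have "(\<Sum>p\<in>Sym m. c p * of_int (permchar m s ?a p)) = (if q = id then h else 0)"
    proof (cases "q = id")
      case True
      then show ?thesis using sum_c_permchar_row[OF s, of ?a] by (simp add: l_def)
    next
      case False
      show ?thesis
      proof (rule ccontr)
        assume "(\<Sum>p\<in>Sym m. c p * of_int (permchar m s ?a p)) \<noteq> (if q = id then h else 0)"
        then have "(\<Sum>p\<in>Sym m. c p * of_int (permchar m s ?a p)) \<noteq> 0" using False by simp
        then have "q = id"
          using q sum_c_permchar_dominance[of s ?a]
          by (intro staircase_dominance_id[of q s l]) (auto simp: l_def)
        with False show False by simp
      qed
    qed
    then show "of_int (sign q) * (\<Sum>p\<in>Sym m. conj_sum p * of_int (permchar m s ?a p)) = (if q = id then fact m * h else 0)"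
      unfolding sum_conj_sum_permchar by (simp add: sign_id)
  qed
  also have "\<dots> = fact m * h" by (simp add: permutes_id)
  finally show ?thesis .
qed

lemma c_real: "c x \<in> \<real>"
  unfolding young_symmetrizer_def by (intro sum_in_Reals) auto

lemma h_real: "h \<in> \<real>" and conj_sum_real: "conj_sum p \<in> \<real>"
  unfolding h_def conj_sum_def by (intro sum_in_Reals Reals_mult c_real)+

text \<open>Both sides have norm \<open>1\<close>, and so has their inner product; hence the norm of the difference is
  \<open>1 - 2 + 1 = 0\<close>, and a real function of norm \<open>0\<close> vanishes.\<close>

theorem irr_char_eq_determinantal_char:
  assumes s: "length lam \<le> s" and p: "p permutes {..<m}"
  shows "irr_char lam p = of_int (determinantal_char m s (\<lambda>i. part lam i + staircase s i) p)"
proof -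
  define f where "f p = (of_int (determinantal_char m s (\<lambda>i. part lam i + staircase s i) p) :: complex)" for p
  have ff: "(\<Sum>p\<in>Sym m. f p * f p) = fact m"
  proof -
    have "(\<Sum>p\<in>Sym m. f p * f p) = of_int (\<Sum>p\<in>Sym m. determinantal_char m s (\<lambda>i. part lam i + staircase s i) p *
        determinantal_char m s (\<lambda>i. part lam i + staircase s i) p)"
      by (simp add: f_def)
    also have "\<dots> = of_int (fact m)"
      by (subst determinantal_char_norm[OF part_decreasing _ sum_part[OF s]]) (simp_all add: part_def)
    finally show ?thesis by simp
  qed
  have Xf: "(\<Sum>p\<in>Sym m. conj_sum p * f p) = fact m * h"
    unfolding f_def by (rule conj_sum_determinantal_char_inner[OF s])
  define z where "z p = Re (conj_sum p - h * f p)" for p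
  have z: "complex_of_real (z p) = conj_sum p - h * f p" for p
    unfolding z_def using h_real conj_sum_real by (intro of_real_Re) (auto simp: f_def)
  have "complex_of_real (\<Sum>p\<in>Sym m. (z p)\<^sup>2) = (\<Sum>p\<in>Sym m. (conj_sum p - h * f p)\<^sup>2)"
    by (simp add: z)
  also have "\<dots> = (\<Sum>p\<in>Sym m. conj_sum p * conj_sum p) - 2 * h * (\<Sum>p\<in>Sym m. conj_sum p * f p) + h\<^sup>2 * (\<Sum>p\<in>Sym m. f p * f p)"
    unfolding sum_distrib_left sum.distrib[symmetric] sum_subtractf[symmetric]
    by (rule sum.cong[OF refl]) (simp add: power2_eq_square algebra_simps)
  also have "\<dots> = 0" unfolding conj_sum_norm Xf ff by (simp add: power2_eq_square)
  finally have "(\<Sum>p\<in>Sym m. (z p)\<^sup>2) = 0" by (simp only: of_real_eq_0_iff)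
  then have "z p = 0"
    using p by (subst (asm) sum_nonneg_eq_0_iff) auto
  then have "conj_sum p = h * f p" using z[of p] by simp
  moreover have "h * irr_char lam p = conj_sum p" unfolding conj_sum_def by (rule trace_irr[OF p])
  ultimately show ?thesis using h_nonzero by (simp add: f_def)
qed

end

section \<open>Kronecker coefficients as alternating sums of Kostka numbers\<close>

text \<open>The matrices with row sums \<open>a\<close> and column sums \<open>b\<close>, where the cells of an \<open>r\<close> by \<open>r\<close> square are
  listed as \<open>0, \<dots>, s - 1\<close> and \<open>t\<close> is the cell in row \<open>f t\<close> and column \<open>g t\<close>. Listing the cells lets
  such a matrix serve as a weight of a Kostka number.\<close>

definition square_margins where
  "square_margins m s f g r a b = {A \<in> contents {..<s} m. (\<forall>i<r. (\<Sum>t | t < s \<and> f t = i. A t) = a i) \<and>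
       (\<forall>j<r. (\<Sum>t | t < s \<and> g t = j. A t) = b j)}"
  for f g :: "nat \<Rightarrow> nat"

lemma determinantal_char_mult:
  assumes bij: "bij_betw (\<lambda>t. (f t, g t)) {..<s} ({..<r} \<times> {..<r})" and p: "p permutes {..<m}"
  shows "determinantal_char m r l p * determinantal_char m r l' p = (\<Sum>q\<in>Sym r. \<Sum>q'\<in>Sym r. sign q * sign q' *
    (\<Sum>A\<in>square_margins m s f g r (\<lambda>i. l i - staircase r (q i)) (\<lambda>i. l' i - staircase r (q' i)). permchar m s A p))"
  unfolding determinantal_char_def sum_product square_margins_def permchar_mult_sum[OF bij p, symmetric]
  by (simp add: mult_ac)

text \<open>Expand the first two characters by the determinantal formula. A product of two permutation
  characters is the sum of the permutation characters of all matrices with the given margins, and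
  the inner product of each of these with the third character is a Kostka number.\<close>

theorem kronecker_expansion:
  assumes dec: "sorted_wrt (\<ge>) lam" "sorted_wrt (\<ge>) mu" "sorted_wrt (\<ge>) nu"
    and m: "sum_list lam = m" "sum_list mu = m" "sum_list nu = m"
    and len: "length lam \<le> r" "length mu \<le> r" "length nu \<le> s"
    and bij: "bij_betw (\<lambda>t. (f t, g t)) {..<s} ({..<r} \<times> {..<r})"
  shows "kronecker lam mu nu = of_int (\<Sum>q\<in>Sym r. \<Sum>q'\<in>Sym r. sign q * sign q' *
    (\<Sum>A\<in>square_margins m s f g r (\<lambda>i. part lam i + staircase r i - staircase r (q i)) (\<lambda>i. part mu i + staircase r i - staircase r (q' i)).
      kostka s s A (\<lambda>i. part nu i + staircase s i)))"
proof -
  interpret L: young_shape lam by unfold_locales (rule dec)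
  interpret M: young_shape mu by unfold_locales (rule dec)
  interpret N: young_shape nu by unfold_locales (rule dec)
  define l where "l = (\<lambda>i. part lam i + staircase r i)"
  define l' where "l' = (\<lambda>i. part mu i + staircase r i)"
  define k where "k = (\<lambda>i. part nu i + staircase s i)"
  let ?M = "\<lambda>q q'. square_margins m s f g r (\<lambda>i. l i - staircase r (q i)) (\<lambda>i. l' i - staircase r (q' i))"
  have inner: "(\<Sum>p\<in>Sym m. permchar m s A p * determinantal_char m s k p) = fact m * kostka s s A k"
    if "A \<in> ?M q q'" for A q q'
    using that by (intro permchar_determinantal_char_inner) (simp add: square_margins_def contents_def)
  have "(\<Sum>p\<in>Sym m. irr_char lam p * irr_char mu p * cnj (irr_char nu p))
      = (\<Sum>p\<in>Sym m. of_int (determinantal_char m r l p * determinantal_char m r l' p * determinantal_char m s k p))"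
    by (intro sum.cong refl)
      (simp add: L.irr_char_eq_determinantal_char[OF len(1), unfolded m] M.irr_char_eq_determinantal_char[OF len(2), unfolded m]
        N.irr_char_eq_determinantal_char[OF len(3), unfolded m] l_def l'_def k_def)
  also have "\<dots> = of_int (\<Sum>p\<in>Sym m. determinantal_char m r l p * determinantal_char m r l' p * determinantal_char m s k p)" by simp
  also have "(\<Sum>p\<in>Sym m. determinantal_char m r l p * determinantal_char m r l' p * determinantal_char m s k p)
     = (\<Sum>p\<in>Sym m. \<Sum>q\<in>Sym r. \<Sum>q'\<in>Sym r. sign q * sign q' * (\<Sum>A\<in>?M q q'. permchar m s A p * determinantal_char m s k p))"
    by (rule sum.cong[OF refl]) (simp only: determinantal_char_mult[OF bij] mem_Collect_eq sum_distrib_right mult.assoc)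
  also have "\<dots> = (\<Sum>q\<in>Sym r. \<Sum>q'\<in>Sym r. \<Sum>p\<in>Sym m. sign q * sign q' * (\<Sum>A\<in>?M q q'. permchar m s A p * determinantal_char m s k p))"
    by (subst sum.swap) (rule sum.cong[OF refl], rule sum.swap)
  also have "\<dots> = (\<Sum>q\<in>Sym r. \<Sum>q'\<in>Sym r. sign q * sign q' * (fact m * (\<Sum>A\<in>?M q q'. kostka s s A k)))"
  proof (rule sum.cong[OF refl], rule sum.cong[OF refl])
    fix q q'
    have "(\<Sum>p\<in>Sym m. sign q * sign q' * (\<Sum>A\<in>?M q q'. permchar m s A p * determinantal_char m s k p))
       = sign q * sign q' * (\<Sum>A\<in>?M q q'. \<Sum>p\<in>Sym m. permchar m s A p * determinantal_char m s k p)"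
      by (subst sum.swap) (simp add: sum_distrib_left)
    then show "(\<Sum>p\<in>Sym m. sign q * sign q' * (\<Sum>A\<in>?M q q'. permchar m s A p * determinantal_char m s k p))
       = sign q * sign q' * (fact m * (\<Sum>A\<in>?M q q'. kostka s s A k))"
      by (simp add: inner sum_distrib_left)
  qed
  also have "\<dots> = fact m * (\<Sum>q\<in>Sym r. \<Sum>q'\<in>Sym r. sign q * sign q' * (\<Sum>A\<in>?M q q'. kostka s s A k))"
    by (simp add: sum_distrib_left mult_ac)
  finally show ?thesis
    unfolding kronecker_def char_inner_def m l_def l'_def k_def by simp
qed

section \<open>Eventually constant sequences\<close>

text \<open>Also used for predicates, where it says that the truth value settles.\<close>

definition eventually_constant :: "(nat \<Rightarrow> 'a) \<Rightarrow> bool" where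
  "eventually_constant f \<longleftrightarrow> (\<exists>c. \<forall>\<^sub>F n in sequentially. f n = c)"

lemma eventually_constant_const [simp]: "eventually_constant (\<lambda>_. c)"
  by (auto simp: eventually_constant_def)

lemma eventually_constant_map2: "eventually_constant f \<Longrightarrow> eventually_constant g \<Longrightarrow> eventually_constant (\<lambda>n. F (f n) (g n))"
  unfolding eventually_constant_def by (elim exE, rule exI) (auto elim: eventually_elim2)

lemma eventually_constant_map: "eventually_constant f \<Longrightarrow> eventually_constant (\<lambda>n. F (f n))"
  using eventually_constant_map2[of f "\<lambda>_. ()" "\<lambda>a _. F a"] by simp

lemma eventually_constant_sum: "finite I \<Longrightarrow> (\<And>i. i \<in> I \<Longrightarrow> eventually_constant (f i)) \<Longrightarrow> eventually_constant (\<lambda>n. \<Sum>i\<in>I. f i n :: 'a :: comm_monoid_add)"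
  by (induction I rule: finite_induct) (auto intro: eventually_constant_map2[where F = "(+)"])

lemma eventually_constant_conj: "eventually_constant P \<Longrightarrow> eventually_constant Q \<Longrightarrow> eventually_constant (\<lambda>n. P n \<and> Q n)"
  by (rule eventually_constant_map2)

lemma eventually_constant_ball: "finite I \<Longrightarrow> (\<And>i. i \<in> I \<Longrightarrow> eventually_constant (P i)) \<Longrightarrow> eventually_constant (\<lambda>n. \<forall>i\<in>I. P i n)"
  by (induction I rule: finite_induct) (auto intro: eventually_constant_conj)

lemma eventually_constant_if: "eventually_constant P \<Longrightarrow> eventually_constant f \<Longrightarrow> eventually_constant (\<lambda>n. if P n then f n else c)"
  by (rule eventually_constant_map2[where F = "\<lambda>p x. if p then x else c"])

lemma eventually_constant_le: "eventually_constant (\<lambda>n. a + int n * b \<le> c + int n * d)"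
proof -
  consider "b = d" | "b < d" | "d < b" by linarith
  then show ?thesis
  proof cases
    case 2
    have "a + int n * b \<le> c + int n * d" if "n \<ge> nat (a - c)" for n
    proof -
      have "int n * 1 \<le> int n * (d - b)" using 2 by (intro mult_left_mono) auto
      then show ?thesis using that by (simp add: algebra_simps)
    qed
    then show ?thesis unfolding eventually_constant_def eventually_sequentially by (intro exI[of _ True]) auto
  next
    case 3
    have "\<not> a + int n * b \<le> c + int n * d" if "n \<ge> nat (c - a + 1)" for n
    proof -
      have "int n * 1 \<le> int n * (b - d)" using 3 by (intro mult_left_mono) auto
      then show ?thesis using that by (simp add: algebra_simps)
    qed
    then show ?thesis unfolding eventually_constant_def eventually_sequentially by (intro exI[of _ False]) auto
  qed simp
qed

lemma eventually_constant_less: "eventually_constant (\<lambda>n. a + int n * b < c + int n * d)"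
proof -
  have "a + int n * b < c + int n * d \<longleftrightarrow> a + 1 + int n * b \<le> c + int n * d" for n by linarith
  then show ?thesis by (simp only:) (rule eventually_constant_le)
qed

text \<open>The index sets may move with \<open>n\<close>. It suffices that the indices with nonzero terms are
  parametrized by a fixed finite set \<open>D\<close>, in such a way that membership and summand settle for each
  parameter.\<close>

lemma eventually_constant_shifted_sum:
  fixes F :: "nat \<Rightarrow> 'a \<Rightarrow> 'c :: comm_monoid_add"
  assumes fin: "finite D" "\<And>n. finite (S n)" and inj: "\<And>n. inj_on (\<phi> n) D"
    and D: "\<And>n c. c \<in> S n \<Longrightarrow> F n c \<noteq> 0 \<Longrightarrow> \<exists>d\<in>D. c = \<phi> n d"
    and eventually_constant: "\<And>d. d \<in> D \<Longrightarrow> eventually_constant (\<lambda>n. if \<phi> n d \<in> S n then F n (\<phi> n d) else 0)"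
  shows "eventually_constant (\<lambda>n. \<Sum>c\<in>S n. F n c)"
proof -
  have "(\<Sum>c\<in>S n. F n c) = (\<Sum>d\<in>D. if \<phi> n d \<in> S n then F n (\<phi> n d) else 0)" for n
  proof -
    have "(\<Sum>d\<in>D. if \<phi> n d \<in> S n then F n (\<phi> n d) else 0) = (\<Sum>d\<in>{d \<in> D. \<phi> n d \<in> S n}. F n (\<phi> n d))"
      using fin by (intro sum.inter_filter[symmetric])
    also have "\<dots> = (\<Sum>c\<in>\<phi> n ` {d \<in> D. \<phi> n d \<in> S n}. F n c)"
      using inj[of n] by (subst sum.reindex) (auto intro: inj_on_subset)
    also have "\<dots> = (\<Sum>c\<in>S n. F n c)"
      using fin D by (intro sum.mono_neutral_left) auto
    finally show ?thesis ..
  qed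
  then show ?thesis using eventually_constant by (simp add: eventually_constant_sum fin)
qed

section \<open>Stability of Kostka numbers\<close>

text \<open>Remove the last horizontal strip by the Pieri rule. The strip is \<open>d\<close> plus \<open>n * delta N\<close> boxes in
  row \<open>N\<close>. Its boxes in the rows from \<open>N\<close> on are determined by \<open>kostka_support\<close>, and the remaining
  ones are nonnegative with known sum; so \<open>d\<close> ranges over a finite set that does not depend on \<open>n\<close>.
  The conditions that make a given \<open>d\<close> a strip are linear inequalities in \<open>n\<close>, and what is left is an
  instance of the induction hypothesis with \<open>y - d\<close> in place of \<open>y\<close>.\<close>

lemma kostka_stable:
  fixes y beta delta :: "nat \<Rightarrow> int"
  assumes "N \<le> s"
  defines "l \<equiv> \<lambda>y N n i. y i + int n * (if i < N then delta i else 0)"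
    and "a \<equiv> \<lambda>n t. beta t + int n * delta t"
  shows "eventually_constant (\<lambda>n. if strictly_decreasing s (l y N n) then kostka N s (a n) (l y N n) else 0)"
  using assms(1)
proof (induction N arbitrary: y)
  case 0
  have "l y 0 n = y" for n by (simp add: l_def)
  then show ?case by (simp add: kostka_0 cong: if_cong)
next
  case (Suc N)
  \<comment> \<open>A bound on the entries of \<open>d\<close>: those from \<open>N\<close> on equal \<open>y i - staircase s i\<close>, and all sum to \<open>beta N\<close>.\<close>
  define K where "K = \<bar>beta N\<bar> + (\<Sum>i<s. \<bar>y i - staircase s i\<bar>)"
  define D where "D = {d :: nat \<Rightarrow> int. (\<forall>i\<in>{..<s}. - K \<le> d i \<and> d i \<le> K) \<and> (\<forall>i. i \<notin> {..<s} \<longrightarrow> d i = 0)}"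
  define \<phi> where "\<phi> = (\<lambda>n (d :: nat \<Rightarrow> int) i. d i + int n * (if i = N then delta N else 0))"
  let ?S = "\<lambda>n. horizontal_strips s (l y (Suc N) n) (a n N)"
  let ?F = "\<lambda>n c. kostka N s (a n) (\<lambda>j. l y (Suc N) n j - c j)"
  have shift: "(\<lambda>j. l y (Suc N) n j - \<phi> n d j) = l (\<lambda>i. y i - d i) N n" for n d
    by (auto simp: l_def \<phi>_def fun_eq_iff)
  have sum_phi: "(\<Sum>j<s. \<phi> n d j) = (\<Sum>j<s. d j) + int n * delta N" for n d
    using Suc.prems by (simp add: \<phi>_def sum.distrib flip: sum_distrib_left)
  have "eventually_constant (\<lambda>n. \<Sum>c\<in>?S n. ?F n c)"
  proof (rule eventually_constant_shifted_sum[where D = D and \<phi> = \<phi>])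
    show "finite D" unfolding D_def by (rule finite_box) simp
    show "finite (?S n)" for n by (rule finite_horizontal_strips)
    show "inj_on (\<phi> n) D" for n by (auto simp: inj_on_def \<phi>_def fun_eq_iff)
    show "\<exists>d\<in>D. c = \<phi> n d" if c: "c \<in> ?S n" "?F n c \<noteq> 0" for n c
    proof
      define d where "d = (\<lambda>i. c i - int n * (if i = N then delta N else 0))"
      show c_phi: "c = \<phi> n d" by (auto simp: \<phi>_def d_def)
      have comp: "\<forall>j. 0 \<le> c j" "\<forall>j\<ge>s. c j = 0" "(\<Sum>j<s. c j) = a n N"
        using c(1) by (auto simp: horizontal_strips_def weak_compositions_def)
      have sum_d: "(\<Sum>j<s. d j) = beta N"
        using comp(3) sum_phi[of n d] by (simp add: c_phi[symmetric] a_def)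
      have tail: "d i = y i - staircase s i" if "N \<le> i" "i < s" for i
      proof -
        have "l y (Suc N) n i - c i = staircase s i"
          using kostka_support[OF strictly_decreasing_strip[OF c(1)] _ c(2)] Suc.prems that by auto
        then show ?thesis using that fun_cong[OF shift[of n d], of i] by (simp add: c_phi[symmetric] l_def)
      qed
      have head: "0 \<le> d i" if "i < N" for i using comp(1) that by (simp add: d_def)
      have bound: "\<bar>d i\<bar> \<le> K" if i: "i < s" for i
      proof (cases "i < N")
        case True
        have "(\<Sum>j<s. d j) = (\<Sum>j<N. d j) + (\<Sum>j\<in>{N..<s}. d j)"
          using Suc.prems by (subst sum.union_disjoint[symmetric]) (auto simp: ivl_disj_un)
        moreover have "(\<Sum>j\<in>{N..<s}. d j) = (\<Sum>j\<in>{N..<s}. y j - staircase s j)"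
          by (intro sum.cong) (auto simp: tail)
        moreover have "\<bar>\<Sum>j\<in>{N..<s}. y j - staircase s j\<bar> \<le> (\<Sum>j\<in>{N..<s}. \<bar>y j - staircase s j\<bar>)"
          by (rule sum_abs)
        moreover have "(\<Sum>j\<in>{N..<s}. \<bar>y j - staircase s j\<bar>) \<le> (\<Sum>j<s. \<bar>y j - staircase s j\<bar>)"
          by (rule sum_mono2) auto
        moreover have "d i \<le> (\<Sum>j<N. d j)" using True head by (intro member_le_sum) auto
        ultimately show ?thesis using head[OF True] sum_d unfolding K_def by linarith
      next
        case False
        then have "\<bar>d i\<bar> = \<bar>y i - staircase s i\<bar>" using tail i by simp
        also have "\<dots> \<le> (\<Sum>i<s. \<bar>y i - staircase s i\<bar>)"
          using i by (intro member_le_sum[where f = "\<lambda>i. \<bar>y i - staircase s i\<bar>"]) auto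
        finally show ?thesis by (simp add: K_def)
      qed
      have "- K \<le> d i" "d i \<le> K" if "i < s" for i using bound[OF that] by (auto simp: abs_le_iff)
      moreover have "d i = 0" if "\<not> i < s" for i using comp(2) Suc.prems that by (simp add: d_def)
      ultimately show "d \<in> D" by (simp add: D_def)
    qed
    show "eventually_constant (\<lambda>n. if \<phi> n d \<in> ?S n then ?F n (\<phi> n d) else 0)" if d: "d \<in> D" for d
    proof -
      have "\<phi> n d \<in> ?S n \<longleftrightarrow> (\<forall>j\<in>{..<s}. 0 + int n * 0 \<le> d j + int n * (if j = N then delta N else 0)) \<and>
         (\<Sum>j<s. d j) = beta N \<and>
         (\<forall>i\<in>{..<s - 1}. y (Suc i) + int n * (if Suc i < Suc N then delta (Suc i) else 0)
            < (y i - d i) + int n * (if i < N then delta i else 0))" for n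
      proof -
        have zero: "\<phi> n d j = 0" if "s \<le> j" for j using that d Suc.prems by (auto simp: \<phi>_def D_def)
        have "(\<forall>j. 0 \<le> \<phi> n d j) \<longleftrightarrow> (\<forall>j\<in>{..<s}. 0 \<le> \<phi> n d j)"
        proof (intro iffI allI)
          fix j assume "\<forall>j\<in>{..<s}. 0 \<le> \<phi> n d j"
          then show "0 \<le> \<phi> n d j" using zero[of j] by (cases "j < s") auto
        qed simp
        then have pos: "(\<forall>j. 0 \<le> \<phi> n d j) \<longleftrightarrow> (\<forall>j\<in>{..<s}. 0 + int n * 0 \<le> d j + int n * (if j = N then delta N else 0))"
          by (simp add: \<phi>_def)
        have diff: "l y (Suc N) n i - \<phi> n d i = (y i - d i) + int n * (if i < N then delta i else 0)" for i
          using fun_cong[OF shift[of n d], of i] by (simp add: l_def)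
        have strip: "(\<forall>i. Suc i < s \<longrightarrow> l y (Suc N) n (Suc i) < l y (Suc N) n i - \<phi> n d i) \<longleftrightarrow>
          (\<forall>i\<in>{..<s - 1}. y (Suc i) + int n * (if Suc i < Suc N then delta (Suc i) else 0)
            < (y i - d i) + int n * (if i < N then delta i else 0))"
          unfolding diff by (simp only: l_def Ball_def lessThan_iff less_diff_conv Suc_eq_plus1)
        have size: "(\<Sum>j<s. \<phi> n d j) = a n N \<longleftrightarrow> (\<Sum>j<s. d j) = beta N"
          by (simp add: sum_phi a_def)
        show ?thesis
          unfolding horizontal_strips_def weak_compositions_def mem_Collect_eq pos strip size using zero by simp
      qed
      then have "eventually_constant (\<lambda>n. \<phi> n d \<in> ?S n)"
        by (simp only:) (intro eventually_constant_conj eventually_constant_ball eventually_constant_le eventually_constant_less eventually_constant_const finite_lessThan)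
      moreover have "eventually_constant (\<lambda>n. if strictly_decreasing s (l (\<lambda>i. y i - d i) N n) then kostka N s (a n) (l (\<lambda>i. y i - d i) N n) else 0)"
        using Suc by simp
      ultimately have "eventually_constant (\<lambda>n. if \<phi> n d \<in> ?S n then
          if strictly_decreasing s (l (\<lambda>i. y i - d i) N n) then kostka N s (a n) (l (\<lambda>i. y i - d i) N n) else 0 else 0)"
        by (rule eventually_constant_if)
      moreover have "strictly_decreasing s (l (\<lambda>i. y i - d i) N n)" if "\<phi> n d \<in> ?S n" for n
        using strictly_decreasing_strip[OF that] by (simp add: shift)
      ultimately show ?thesis unfolding shift by (simp cong: if_cong)
    qed
  qed
  moreover have "eventually_constant (\<lambda>n. strictly_decreasing s (l y (Suc N) n))"
  proof -
    have "strictly_decreasing s (l y (Suc N) n) \<longleftrightarrow> (\<forall>i\<in>{..<s - 1}. y (Suc i) + int n * (if Suc i < Suc N then delta (Suc i) else 0)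
       < y i + int n * (if i < Suc N then delta i else 0))" for n
      by (auto simp: strictly_decreasing_def l_def less_diff_conv)
    then show ?thesis by (simp only:) (intro eventually_constant_ball eventually_constant_less finite_lessThan)
  qed
  ultimately have "eventually_constant (\<lambda>n. if strictly_decreasing s (l y (Suc N) n) then \<Sum>c\<in>?S n. ?F n c else 0)"
    by (intro eventually_constant_if)
  then show ?case by (simp add: pieri cong: if_cong)
qed

section \<open>Matrices near a multiple of an additive matrix\<close>

lemma sum_by_fibres:
  fixes w :: "nat \<Rightarrow> int"
  assumes "finite T" "\<And>t. t \<in> T \<Longrightarrow> f t < (r :: nat)"
  shows "(\<Sum>t\<in>T. w (f t) * B t) = (\<Sum>i<r. w i * (\<Sum>t | t \<in> T \<and> f t = i. B t))"
proof -
  have "(\<Sum>t\<in>T. w (f t) * B t) = (\<Sum>i<r. \<Sum>t | t \<in> T \<and> f t = i. w (f t) * B t)"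
    by (rule sum.group[symmetric]) (use assms in auto)
  also have "\<dots> = (\<Sum>i<r. w i * (\<Sum>t | t \<in> T \<and> f t = i. B t))"
    by (simp add: sum_distrib_left)
  finally show ?thesis .
qed

text \<open>This is where additivity of the matrix \<open>\<delta>\<close> enters: its entries are the positive parts of
  \<open>k - f t - g t\<close>, a function of the row plus a function of the column. Summed against that function
  itself, \<open>B\<close> gives a value \<open>K\<close> that depends on its margins only. The part of this sum with positive
  coefficients is a sum over the layers \<open>{t. v \<le> \<delta> t}\<close>, each contributing at most \<open>M\<close>, while the part
  with negative coefficients contributes at most \<open>0\<close>, since \<open>B\<close> is nonnegative there. As the total is
  \<open>K\<close>, every layer sum is also bounded below and the entries with negative coefficient are bounded
  above. Each remaining entry may be adjoined to the layer of the positions with larger \<open>\<delta>\<close> without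
  the sum exceeding \<open>M\<close>, so it is bounded above because that layer sum is bounded below. The sum of all entries being fixed, upper bounds imply lower bounds.\<close>

lemma perturbation_bounded:
  fixes k r s :: nat and f g :: "nat \<Rightarrow> nat" and M :: int and a b :: "nat \<Rightarrow> int"
  defines "\<delta> \<equiv> \<lambda>t. int (k - (f t + g t))"
  assumes fg: "\<And>t. t < s \<Longrightarrow> f t < r \<and> g t < r"
    and dec: "\<And>t u. t \<le> u \<Longrightarrow> u < s \<Longrightarrow> \<delta> u \<le> \<delta> t" and M: "0 \<le> M"
  shows "\<exists>D. \<forall>B. (\<forall>i<r. (\<Sum>t | t < s \<and> f t = i. B t) = a i) \<longrightarrow>
      (\<forall>j<r. (\<Sum>t | t < s \<and> g t = j. B t) = b j) \<longrightarrow>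
      (\<forall>q\<le>s. (\<Sum>t<q. B t) \<le> M) \<longrightarrow>
      (\<forall>q t. q \<le> t \<longrightarrow> t < s \<longrightarrow> \<delta> t = \<delta> q \<longrightarrow> (\<Sum>t<q. B t) + B t \<le> M) \<longrightarrow>
      (\<forall>t<s. \<delta> t = 0 \<longrightarrow> 0 \<le> B t) \<longrightarrow> (\<forall>t<s. - D \<le> B t \<and> B t \<le> (D :: int))"
proof -
  define K where "K = (\<Sum>i<r. (int k - int i) * a i) - (\<Sum>j<r. int j * b j)"
  define E where "E = M + int k * M + \<bar>K\<bar>"
  define D where "D = E + \<bar>\<Sum>i<r. a i\<bar> + int s * E"
  have bound: "- D \<le> B t0 \<and> B t0 \<le> D"
    if row: "\<forall>i<r. (\<Sum>t | t < s \<and> f t = i. B t) = a i"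
      and col: "\<forall>j<r. (\<Sum>t | t < s \<and> g t = j. B t) = b j"
      and prefix: "\<forall>q\<le>s. (\<Sum>t<q. B t) \<le> M"
      and prefix1: "\<forall>q t. q \<le> t \<longrightarrow> t < s \<longrightarrow> \<delta> t = \<delta> q \<longrightarrow> (\<Sum>t<q. B t) + B t \<le> M"
      and nn: "\<forall>t<s. \<delta> t = 0 \<longrightarrow> 0 \<le> B t" and t0: "t0 < s" for B t0
  proof -
    \<comment> \<open>The negative part of \<open>k - f t - g t\<close>.\<close>
    define neg where "neg t = int (f t + g t - k)" for t
    have B_neg: "0 \<le> neg t * B t" if "t < s" for t
      using nn that by (cases "k \<le> f t + g t") (auto simp: neg_def \<delta>_def)
    have weighted: "(\<Sum>t<s. \<delta> t * B t) - (\<Sum>t<s. neg t * B t) = K"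
    proof -
      have "(\<Sum>t<s. \<delta> t * B t) - (\<Sum>t<s. neg t * B t)
        = (\<Sum>t<s. (int k - int (f t)) * B t) - (\<Sum>t<s. int (g t) * B t)"
        unfolding sum_subtractf[symmetric] left_diff_distrib[symmetric]
      proof (rule sum.cong[OF refl])
        fix t
        have "\<delta> t - neg t = int k - int (f t) - int (g t)" by (simp add: \<delta>_def neg_def)
        then show "(\<delta> t - neg t) * B t = (int k - int (f t) - int (g t)) * B t" by simp
      qed
      also have "(\<Sum>t<s. (int k - int (f t)) * B t) = (\<Sum>i<r. (int k - int i) * a i)"
        using sum_by_fibres[of "{..<s}" f r "\<lambda>i. int k - int i" B] fg row by simp
      also have "(\<Sum>t<s. int (g t) * B t) = (\<Sum>j<r. int j * b j)"
        using sum_by_fibres[of "{..<s}" g r int B] fg col by simp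
      finally show ?thesis by (simp add: K_def)
    qed
    \<comment> \<open>The layer sums; every layer is an initial segment because \<open>\<delta>\<close> decreases.\<close>
    define P where "P v = (\<Sum>t | t < s \<and> int v \<le> \<delta> t. B t)" for v :: nat
    define q where "q v = card {t. t < s \<and> int v \<le> \<delta> t}" for v :: nat
    have initial: "{t. t < s \<and> int v \<le> \<delta> t} = {..<q v}" for v
    proof -
      let ?A = "{t. t < s \<and> int v \<le> \<delta> t}"
      have "?A \<subseteq> {..<card ?A}"
      proof
        fix t assume t: "t \<in> ?A"
        have "int v \<le> \<delta> u" if "u \<le> t" for u using dec[OF that] t by auto
        then have "{..t} \<subseteq> ?A" using t by auto
        then have "card {..t} \<le> card ?A" by (intro card_mono) auto
        then show "t \<in> {..<card ?A}" by simp
      qed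
      then show ?thesis unfolding q_def by (intro card_subset_eq) auto
    qed
    have mem_initial: "t < q v \<longleftrightarrow> t < s \<and> int v \<le> \<delta> t" for t v
      using initial[of v] by (simp add: set_eq_iff)
    have q_le: "q v \<le> s" for v
      using card_mono[of "{..<s}" "{t. t < s \<and> int v \<le> \<delta> t}"] by (auto simp: q_def)
    have P_q: "P v = (\<Sum>t<q v. B t)" for v by (simp add: P_def initial)
    have P_le: "P v \<le> M" for v using prefix q_le by (simp add: P_q)
    have layers: "(\<Sum>t<s. \<delta> t * B t) = (\<Sum>v\<in>{1..k}. P v)"
    proof -
      have "(\<Sum>v\<in>{1..k}. P v) = (\<Sum>v\<in>{1..k}. \<Sum>t<s. if int v \<le> \<delta> t then B t else 0)"
        unfolding P_def by (rule sum.cong[OF refl]) (subst sum.inter_filter[symmetric]; simp)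
      also have "\<dots> = (\<Sum>t<s. \<Sum>v\<in>{1..k}. if int v \<le> \<delta> t then B t else 0)" by (rule sum.swap)
      also have "\<dots> = (\<Sum>t<s. \<delta> t * B t)"
      proof (rule sum.cong[OF refl])
        fix t
        have "(\<Sum>v\<in>{1..k}. if int v \<le> \<delta> t then B t else 0) = (\<Sum>v\<in>{v \<in> {1..k}. int v \<le> \<delta> t}. B t)"
          by (rule sum.inter_filter[symmetric]) simp
        also have "{v \<in> {1..k}. int v \<le> \<delta> t} = {1..k - (f t + g t)}" by (auto simp: \<delta>_def)
        finally show "(\<Sum>v\<in>{1..k}. if int v \<le> \<delta> t then B t else 0) = \<delta> t * B t"
          by (simp add: \<delta>_def)
      qed
      finally show ?thesis ..
    qed
    have kM: "(\<Sum>v\<in>V. P v) \<le> int k * M" if "V \<subseteq> {1..k}" for V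
    proof -
      have "(\<Sum>v\<in>V. P v) \<le> int (card V) * M" using sum_bounded_above[of V P M] P_le by simp
      also have "\<dots> \<le> int k * M"
        using M card_mono[OF _ that] by (intro mult_right_mono) auto
      finally show ?thesis .
    qed
    have neg_nn: "0 \<le> (\<Sum>t<s. neg t * B t)" using B_neg by (intro sum_nonneg) auto
    have P_ge: "- \<bar>K\<bar> - int k * M \<le> P v" if "1 \<le> v" "v \<le> k" for v
    proof -
      have "(\<Sum>v\<in>{1..k}. P v) = P v + (\<Sum>v\<in>{1..k} - {v}. P v)" using that by (intro sum.remove) auto
      moreover have "(\<Sum>v\<in>{1..k} - {v}. P v) \<le> int k * M" by (rule kM) auto
      ultimately show ?thesis using weighted layers neg_nn by linarith
    qed
    have E: "0 \<le> E" using M by (simp add: E_def)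
    have upper: "B t \<le> E" if t: "t < s" for t
    proof (cases "k < f t + g t")
      case True
      have "neg t * B t \<le> (\<Sum>t<s. neg t * B t)"
        using t B_neg by (intro member_le_sum) auto
      moreover have "1 * B t \<le> neg t * B t"
        using True nn t by (intro mult_right_mono) (auto simp: neg_def \<delta>_def)
      moreover have "(\<Sum>v\<in>{1..k}. P v) \<le> int k * M" by (rule kM) auto
      ultimately show ?thesis using weighted layers M unfolding E_def by linarith
    next
      case False
      \<comment> \<open>The positions with \<open>\<delta>\<close> larger than at \<open>t\<close> form the layer \<open>Suc v\<close>.\<close>
      define v where "v = k - (f t + g t)"
      have "\<not> t < q (Suc v)" unfolding mem_initial by (simp add: \<delta>_def v_def)
      then have qt: "q (Suc v) \<le> t" by simp
      have "\<not> (q (Suc v) < s \<and> int (Suc v) \<le> \<delta> (q (Suc v)))"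
        unfolding mem_initial[symmetric] by simp
      then have "\<delta> (q (Suc v)) \<le> int v" using qt t by simp
      moreover have "int v \<le> \<delta> (q (Suc v))" using dec[OF qt t] by (simp add: \<delta>_def v_def)
      ultimately have "\<delta> t = \<delta> (q (Suc v))" by (simp add: \<delta>_def v_def)
      then have le: "P (Suc v) + B t \<le> M" using prefix1 qt t by (simp add: P_q)
      show ?thesis
      proof (cases "Suc v \<le> k")
        case True
        then show ?thesis using le P_ge[of "Suc v"] unfolding E_def by simp
      next
        case False
        then have "{t. t < s \<and> int (Suc v) \<le> \<delta> t} = {}" by (auto simp: \<delta>_def)
        then have "P (Suc v) = 0" by (simp only: P_def) simp
        moreover have "0 \<le> int k * M" using M by simp
        ultimately show ?thesis using le unfolding E_def by linarith
      qed
    qed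
    have total: "(\<Sum>t<s. B t) = (\<Sum>i<r. a i)"
      using sum_by_fibres[of "{..<s}" f r "\<lambda>_. 1" B] fg row by simp
    have "(\<Sum>t<s. B t) = B t0 + (\<Sum>t\<in>{..<s} - {t0}. B t)" using t0 by (intro sum.remove) auto
    moreover have "(\<Sum>t\<in>{..<s} - {t0}. B t) \<le> int (card ({..<s} - {t0})) * E"
      using sum_bounded_above[of "{..<s} - {t0}" B E] upper by simp
    moreover have "int (card ({..<s} - {t0})) * E \<le> int s * E"
      using E card_mono[of "{..<s}" "{..<s} - {t0}"] by (intro mult_right_mono) auto
    moreover have "0 \<le> int s * E" using E by simp
    ultimately show ?thesis using total upper[OF t0] E unfolding D_def by linarith
  qed
  show ?thesis by (rule exI[of _ D], intro allI impI, rule bound)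
qed

text \<open>A matrix with nonzero Kostka number is dominated by \<open>nu + n \<delta>\<close>. Reordering the weights shows
  that this bounds the sum of the first \<open>q\<close> entries together with any one later entry, and when
  \<open>\<delta>\<close> has the same value at that entry as at position \<open>q\<close> the multiples of \<open>n\<close> cancel. So
  \<open>perturbation_bounded\<close> applies to the difference \<open>B\<close> between the matrix and \<open>n \<delta>\<close>, and
  \<open>kostka_stable\<close> to each of the finitely many \<open>B\<close>.\<close>

lemma sum_kostka_stable:
  fixes k r s :: nat and f g :: "nat \<Rightarrow> nat" and a b nu :: "nat \<Rightarrow> int" and m0 e :: nat and \<eta>1 \<eta>2 :: "nat \<Rightarrow> int"
  defines "\<delta> \<equiv> \<lambda>t. int (k - (f t + g t))"
  assumes fg: "\<And>t. t < s \<Longrightarrow> f t < r \<and> g t < r"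
    and dec: "\<And>t u. t \<le> u \<Longrightarrow> u < s \<Longrightarrow> \<delta> u \<le> \<delta> t"
    and row: "\<And>i. i < r \<Longrightarrow> (\<Sum>t | t < s \<and> f t = i. \<delta> t) = \<eta>1 i"
    and col: "\<And>j. j < r \<Longrightarrow> (\<Sum>t | t < s \<and> g t = j. \<delta> t) = \<eta>2 j"
    and total: "(\<Sum>t<s. \<delta> t) = int e"
    and nu: "\<And>i. nu (Suc i) \<le> nu i" "\<And>i. 0 \<le> nu i"
  shows "eventually_constant (\<lambda>n. \<Sum>A\<in>square_margins (m0 + n * e) s f g r (\<lambda>i. a i + int n * \<eta>1 i) (\<lambda>j. b j + int n * \<eta>2 j).
     kostka s s A (\<lambda>i. nu i + staircase s i + int n * (if i < s then \<delta> i else 0)))"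
proof -
  define M where "M = (\<Sum>i<s. nu i)"
  have M: "0 \<le> M" unfolding M_def using nu by (intro sum_nonneg) auto
  obtain D where D: "\<forall>B. (\<forall>i<r. (\<Sum>t | t < s \<and> f t = i. B t) = a i) \<longrightarrow>
      (\<forall>j<r. (\<Sum>t | t < s \<and> g t = j. B t) = b j) \<longrightarrow>
      (\<forall>q\<le>s. (\<Sum>t<q. B t) \<le> M) \<longrightarrow>
      (\<forall>q t. q \<le> t \<longrightarrow> t < s \<longrightarrow> \<delta> t = \<delta> q \<longrightarrow> (\<Sum>t<q. B t) + B t \<le> M) \<longrightarrow>
      (\<forall>t<s. \<delta> t = 0 \<longrightarrow> 0 \<le> B t) \<longrightarrow> (\<forall>t<s. - D \<le> B t \<and> B t \<le> D)"
    unfolding \<delta>_def using perturbation_bounded[OF fg dec[unfolded \<delta>_def] M, where a = a and b = b] by (rule exE)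
  define Box where "Box = {B :: nat \<Rightarrow> int. (\<forall>i\<in>{..<s}. - D \<le> B i \<and> B i \<le> D) \<and> (\<forall>i. i \<notin> {..<s} \<longrightarrow> B i = 0)}"
  define \<phi> where "\<phi> = (\<lambda>n (B :: nat \<Rightarrow> int) t. B t + int n * (if t < s then \<delta> t else 0))"
  define l where "l = (\<lambda>n i. nu i + staircase s i + int n * (if i < s then \<delta> i else 0))"
  let ?S = "\<lambda>n. square_margins (m0 + n * e) s f g r (\<lambda>i. a i + int n * \<eta>1 i) (\<lambda>j. b j + int n * \<eta>2 j)"
  have l_dec: "strictly_decreasing s (l n)" for n
    unfolding strictly_decreasing_def l_def
  proof (intro allI impI)
    fix i assume i: "Suc i < s"
    then have "int n * \<delta> (Suc i) \<le> int n * \<delta> i" using dec[of i "Suc i"] by (intro mult_left_mono) auto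
    moreover have "staircase s (Suc i) < staircase s i" using i by (simp add: staircase_def)
    ultimately show "nu (Suc i) + staircase s (Suc i) + int n * (if Suc i < s then \<delta> (Suc i) else 0)
      < nu i + staircase s i + int n * (if i < s then \<delta> i else 0)" using nu(1)[of i] i by simp
  qed
  have phi_sum: "(\<Sum>t | t < s \<and> Q t. \<phi> n B t) = (\<Sum>t | t < s \<and> Q t. B t) + int n * (\<Sum>t | t < s \<and> Q t. \<delta> t)" for n B Q
    by (simp add: \<phi>_def sum.distrib sum_distrib_left)
  have phi_row: "(\<Sum>t | t < s \<and> f t = i. \<phi> n B t) = (\<Sum>t | t < s \<and> f t = i. B t) + int n * \<eta>1 i" if "i < r" for n B i
    using row[OF that] by (simp add: phi_sum)
  have phi_col: "(\<Sum>t | t < s \<and> g t = i. \<phi> n B t) = (\<Sum>t | t < s \<and> g t = i. B t) + int n * \<eta>2 i" if "i < r" for n B i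
    using col[OF that] by (simp add: phi_sum)
  have phi_prefix: "(\<Sum>t<q. \<phi> n B t) = (\<Sum>t<q. B t) + int n * (\<Sum>t<q. \<delta> t)" if "q \<le> s" for n B q
    using that by (simp add: \<phi>_def sum.distrib sum_distrib_left)
  have "eventually_constant (\<lambda>n. \<Sum>A\<in>?S n. kostka s s A (l n))"
  proof (rule eventually_constant_shifted_sum[where D = Box and \<phi> = \<phi>])
    show "finite Box" unfolding Box_def by (rule finite_box) simp
    show "finite (?S n)" for n
      by (rule finite_subset[OF _ finite_contents[of "{..<s}"]]) (auto simp: square_margins_def)
    show "inj_on (\<phi> n) Box" for n by (auto simp: inj_on_def \<phi>_def fun_eq_iff)
    show "\<exists>B\<in>Box. A = \<phi> n B" if A: "A \<in> ?S n" "kostka s s A (l n) \<noteq> 0" for n A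
    proof
      define B where "B = (\<lambda>t. A t - int n * (if t < s then \<delta> t else 0))"
      show A_phi: "A = \<phi> n B" by (auto simp: \<phi>_def B_def)
      have A_mem: "\<forall>t. 0 \<le> A t" "\<forall>t\<ge>s. A t = 0" "\<forall>i<r. (\<Sum>t | t < s \<and> f t = i. A t) = a i + int n * \<eta>1 i"
        "\<forall>j<r. (\<Sum>t | t < s \<and> g t = j. A t) = b j + int n * \<eta>2 j"
        using A(1) by (auto simp: square_margins_def contents_def)
      have nu_le: "(\<Sum>i<q. nu i) \<le> M" if "q \<le> s" for q
        unfolding M_def using that nu(2) by (intro sum_mono2) auto
      have l_prefix: "(\<Sum>i<q. l n i - staircase s i) = (\<Sum>i<q. nu i) + int n * (\<Sum>i<q. \<delta> i)" if "q \<le> s" for q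
        using that by (simp add: l_def sum.distrib sum_distrib_left)
      have prefix: "(\<Sum>t<q. B t) \<le> M" if q: "q \<le> s" for q
      proof -
        have "(\<Sum>t<q. A t) \<le> (\<Sum>i<q. l n i - staircase s i)"
          using kostka_dominance[OF l_dec order_refl A(2) q] .
        then show ?thesis using nu_le[OF q] phi_prefix[OF q, of n B] l_prefix[OF q] by (simp add: A_phi[symmetric])
      qed
      have prefix1: "(\<Sum>t<q. B t) + B t \<le> M" if q: "q \<le> t" "t < s" "\<delta> t = \<delta> q" for q t
      proof -
        have "transpose q t permutes {..<s}" using q by (intro permutes_swap_id) auto
        then have "kostka s s (A \<circ> transpose q t) (l n) \<noteq> 0"
          using A(2) by (simp only: kostka_permute_weights) simp
        from kostka_dominance[OF l_dec order_refl this, of "Suc q"] q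
        have "(\<Sum>i<Suc q. (A \<circ> transpose q t) i) \<le> (\<Sum>i<Suc q. l n i - staircase s i)"
          by linarith
        also have "(\<Sum>i<Suc q. (A \<circ> transpose q t) i) = (\<Sum>i<q. A i) + A t"
        proof -
          have "(\<Sum>i<q. (A \<circ> transpose q t) i) = (\<Sum>i<q. A i)"
            using q by (intro sum.cong) (auto simp: transpose_def)
          then show ?thesis by simp
        qed
        also have "(\<Sum>i<q. A i) = (\<Sum>i<q. B i) + int n * (\<Sum>i<q. \<delta> i)"
          using phi_prefix[of q n B] q by (simp add: A_phi[symmetric])
        also have "A t = B t + int n * \<delta> q" using q by (simp add: B_def)
        also have "(\<Sum>i<Suc q. l n i - staircase s i) = (\<Sum>i<Suc q. nu i) + int n * (\<Sum>i<q. \<delta> i) + int n * \<delta> q"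
          using l_prefix[of "Suc q"] q by (simp add: algebra_simps)
        finally show ?thesis using nu_le[of "Suc q"] q by simp
      qed
      have rowB: "\<forall>i<r. (\<Sum>t | t < s \<and> f t = i. B t) = a i"
        using A_mem(3) phi_row[of _ n B] by (simp add: A_phi[symmetric])
      have colB: "\<forall>j<r. (\<Sum>t | t < s \<and> g t = j. B t) = b j"
        using A_mem(4) phi_col[of _ n B] by (simp add: A_phi[symmetric])
      have zeroB: "\<forall>t<s. \<delta> t = 0 \<longrightarrow> 0 \<le> B t" using A_mem(1) by (simp add: B_def)
      have "\<forall>q\<le>s. (\<Sum>t<q. B t) \<le> M" using prefix by blast
      moreover have "\<forall>q t. q \<le> t \<longrightarrow> t < s \<longrightarrow> \<delta> t = \<delta> q \<longrightarrow> (\<Sum>t<q. B t) + B t \<le> M"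
        using prefix1 by blast
      ultimately have "\<forall>t<s. - D \<le> B t \<and> B t \<le> D"
        by (intro D[THEN spec, THEN mp, THEN mp, THEN mp, THEN mp, THEN mp] rowB colB zeroB)
      then show "B \<in> Box" using A_mem(2) by (simp add: Box_def B_def)
    qed
    show "eventually_constant (\<lambda>n. if \<phi> n B \<in> ?S n then kostka s s (\<phi> n B) (l n) else 0)" if B: "B \<in> Box" for B
    proof (rule eventually_constant_if)
      have "\<phi> n B \<in> ?S n \<longleftrightarrow> (\<forall>t\<in>{..<s}. 0 + int n * 0 \<le> B t + int n * \<delta> t) \<and>
        ((\<Sum>t<s. B t) = int m0 \<and> (\<forall>i<r. (\<Sum>t | t < s \<and> f t = i. B t) = a i) \<and>
        (\<forall>j<r. (\<Sum>t | t < s \<and> g t = j. B t) = b j))" for n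
      proof -
        have zero: "\<phi> n B t = 0" if "\<not> t < s" for t using that B by (simp add: \<phi>_def Box_def)
        have "(\<forall>t. 0 \<le> \<phi> n B t) \<longleftrightarrow> (\<forall>t\<in>{..<s}. 0 \<le> \<phi> n B t)"
        proof (intro iffI allI)
          fix t assume "\<forall>t\<in>{..<s}. 0 \<le> \<phi> n B t"
          then show "0 \<le> \<phi> n B t" using zero[of t] by (cases "t < s") auto
        qed simp
        then have pos: "(\<forall>t. 0 \<le> \<phi> n B t) \<longleftrightarrow> (\<forall>t\<in>{..<s}. 0 + int n * 0 \<le> B t + int n * \<delta> t)"
          by (simp add: \<phi>_def)
        have size: "(\<Sum>t<s. \<phi> n B t) = int (m0 + n * e) \<longleftrightarrow> (\<Sum>t<s. B t) = int m0"
          using phi_prefix[OF order_refl, of n B] total by simp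
        have rows: "(\<forall>i<r. (\<Sum>t | t < s \<and> f t = i. \<phi> n B t) = a i + int n * \<eta>1 i) \<longleftrightarrow>
            (\<forall>i<r. (\<Sum>t | t < s \<and> f t = i. B t) = a i)"
          by (simp add: phi_row)
        have cols: "(\<forall>j<r. (\<Sum>t | t < s \<and> g t = j. \<phi> n B t) = b j + int n * \<eta>2 j) \<longleftrightarrow>
            (\<forall>j<r. (\<Sum>t | t < s \<and> g t = j. B t) = b j)"
          by (simp add: phi_col)
        show ?thesis
          unfolding square_margins_def contents_def mem_Collect_eq pos size rows cols using zero by simp
      qed
      then show "eventually_constant (\<lambda>n. \<phi> n B \<in> ?S n)"
        by (simp only:) (intro eventually_constant_conj eventually_constant_ball eventually_constant_le eventually_constant_const finite_lessThan)
      have "eventually_constant (\<lambda>n. if strictly_decreasing s (l n) then kostka s s (\<lambda>t. B t + int n * \<delta> t) (l n) else 0)"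
        unfolding l_def by (rule kostka_stable) simp
      moreover have "kostka s s (\<phi> n B) (l n) = kostka s s (\<lambda>t. B t + int n * \<delta> t) (l n)" for n
        by (rule kostka_cong) (auto simp: \<phi>_def)
      ultimately show "eventually_constant (\<lambda>n. kostka s s (\<phi> n B) (l n))" by (simp add: l_dec)
    qed
  qed
  then show ?thesis by (simp add: l_def)
qed

section \<open>The additive matrix with margins eta and entries delta\<close>

lemma part_Nil [simp]: "part [] i = 0"
  by (simp add: part_def)

lemma part_Cons: "part (a # as) i = (case i of 0 \<Rightarrow> int a | Suc j \<Rightarrow> part as j)"
  by (simp add: part_def split: nat.split)

lemma part_padd: "part (padd as bs) i = part as i + part bs i"
  by (induction as bs arbitrary: i rule: padd.induct) (simp_all add: part_Cons split: nat.split)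

lemma part_pscale: "part (pscale n l) i = int n * part l i"
  by (simp add: part_def pscale_def)

lemma length_pscale: "length (pscale n l) = length l"
  by (simp add: pscale_def)

lemma length_padd: "length (padd as bs) = max (length as) (length bs)"
  by (induction as bs rule: padd.induct) auto

lemma sorted_iff_part: "sorted_wrt (\<ge>) l \<longleftrightarrow> (\<forall>i. part l (Suc i) \<le> part l i)"
proof
  assume "sorted_wrt (\<ge>) l"
  then interpret young_shape l by unfold_locales
  show "\<forall>i. part l (Suc i) \<le> part l i" using part_decreasing by blast
next
  assume *: "\<forall>i. part l (Suc i) \<le> part l i"
  have "l ! Suc i \<le> l ! i" if "Suc i < length l" for i
    using *[rule_format, of i] that by (simp add: part_def)
  then show "sorted_wrt (\<ge>) l"
    by (subst sorted_wrt_iff_nth_Suc_transp) (auto intro: transpI)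
qed

lemma sum_descending: "(\<Sum>j<a. a - j) = (Suc a choose 2)"
proof (induction a)
  case (Suc a)
  have "(\<Sum>j<Suc a. Suc a - j) = Suc a + (\<Sum>j<a. a - j)"
    by (subst sum.lessThan_Suc_shift) simp
  then show ?case using Suc by (simp add: numeral_2_eq_2)
qed simp

lemma part_eta: "part (eta k) i = int (Suc k - i choose 2)"
proof (cases "i < k")
  case True
  then have "rev [2..<k + 2] ! i = Suc k - i" by (simp add: rev_nth del: upt_Suc)
  then show ?thesis using True by (simp add: part_def eta_def del: upt_Suc)
next
  case False
  then have "Suc k - i \<le> 1" by simp
  then have "Suc k - i choose 2 = 0" by (intro binomial_eq_0) simp
  then show ?thesis using False by (simp add: part_def eta_def del: upt_Suc)
qed

lemma eta_row_sum:
  assumes "k \<le> r"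
  shows "(\<Sum>j<r. int (k - (i + j))) = part (eta k) i"
proof (cases "i \<le> k")
  case True
  have "(\<Sum>j<r. int (k - (i + j))) = (\<Sum>j<k - i. int (k - (i + j)))"
    by (rule sum.mono_neutral_right) (use assms in auto)
  also have "\<dots> = int (\<Sum>j<k - i. (k - i) - j)" by simp
  also have "\<dots> = int (Suc (k - i) choose 2)" by (simp only: sum_descending)
  finally show ?thesis using True by (simp add: part_eta Suc_diff_le)
next
  case False
  then have "Suc k - i = 0" by simp
  then show ?thesis using False by (simp add: part_eta)
qed

lemma bij_betw_fibre:
  assumes "bij_betw (\<lambda>t. (f t, g t)) A (X \<times> Y)" "i \<in> X"
  shows "bij_betw g {t. t \<in> A \<and> f t = i} Y"
proof (rule bij_betw_imageI)
  have inj: "inj_on (\<lambda>t. (f t, g t)) A" and img: "(\<lambda>t. (f t, g t)) ` A = X \<times> Y"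
    using assms(1) by (auto simp: bij_betw_def)
  show "inj_on g {t. t \<in> A \<and> f t = i}" using inj by (auto simp: inj_on_def)
  show "g ` {t. t \<in> A \<and> f t = i} = Y"
  proof (intro equalityI subsetI)
    fix j assume "j \<in> Y"
    then have "(i, j) \<in> (\<lambda>t. (f t, g t)) ` A" using img assms(2) by simp
    then show "j \<in> g ` {t. t \<in> A \<and> f t = i}" by auto
  next
    fix j assume "j \<in> g ` {t. t \<in> A \<and> f t = i}"
    then obtain t where "t \<in> A" "j = g t" by auto
    then have "(f t, j) \<in> (\<lambda>t. (f t, g t)) ` A" by auto
    then show "j \<in> Y" using img by auto
  qed
qed

text \<open>The cells with \<open>i + j < k\<close> in the order of their antidiagonals, along which \<open>k - (i + j)\<close> runs
  through the parts of \<open>delta k\<close>.\<close>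

definition triangle :: "nat \<Rightarrow> (nat \<times> nat) list" where
  "triangle k = concat (map (\<lambda>d. map (\<lambda>i. (i, d - i)) [0..<Suc d]) [0..<k])"

lemma triangle_set_distinct: "set (triangle k) = {(i, j). i + j < k} \<and> distinct (triangle k)"
proof (induction k)
  case (Suc k)
  have "triangle (Suc k) = triangle k @ map (\<lambda>i. (i, k - i)) [0..<Suc k]" by (simp add: triangle_def)
  moreover have "set (map (\<lambda>i. (i, k - i)) [0..<Suc k]) = {(i, j). i + j = k}" by (auto simp: image_iff)
  moreover have "distinct (map (\<lambda>i. (i, k - i)) [0..<Suc k])" by (simp add: distinct_map inj_on_def del: upt_Suc)
  ultimately show ?case using Suc by (auto simp del: upt_Suc)
qed (simp add: triangle_def)

lemma map_triangle: "map (\<lambda>(i, j). k - (i + j)) (triangle k) = delta k"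
proof -
  have rev: "rev [1..<k + 1] = map (\<lambda>d. k - d) [0..<k]"
    by (rule nth_equalityI) (auto simp: rev_nth simp del: upt_Suc)
  have "map (\<lambda>(i, j). k - (i + j)) (triangle k)
     = concat (map (\<lambda>d. map (\<lambda>i. k - (i + (d - i))) [0..<Suc d]) [0..<k])"
    by (simp add: triangle_def map_concat comp_def del: upt_Suc)
  also have "map (\<lambda>d. map (\<lambda>i. k - (i + (d - i))) [0..<Suc d]) [0..<k]
     = map (\<lambda>d. replicate (k + 1 - (k - d)) (k - d)) [0..<k]"
  proof (rule map_cong[OF refl])
    fix d assume "d \<in> set [0..<k]"
    then show "map (\<lambda>i. k - (i + (d - i))) [0..<Suc d] = replicate (k + 1 - (k - d)) (k - d)"
      by (intro nth_equalityI) (auto simp del: upt_Suc replicate_Suc)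
  qed
  also have "concat \<dots> = delta k"
    by (simp only: delta_def rev map_map comp_def)
  finally show ?thesis .
qed

lemma sorted_delta: "sorted_wrt (\<ge>) (delta k)"
proof -
  have inc: "sorted (concat (map (\<lambda>i. replicate (c i) i) [a..<b]))" for c :: "nat \<Rightarrow> nat" and a b
    by (induction b) (auto simp: sorted_append)
  have "rev (delta k) = concat (map (\<lambda>i. replicate (k + 1 - i) i) [1..<k + 1])"
    by (simp add: delta_def rev_concat rev_map comp_def del: upt_Suc)
  then have "sorted (rev (delta k))" using inc by (simp del: upt_Suc)
  then show ?thesis by (simp add: sorted_wrt_rev)
qed

text \<open>The cells outside the triangle are appended in any order: there \<open>k - (i + j)\<close> is \<open>0\<close>, as is
  \<open>delta k\<close> beyond its last part.\<close>

lemma enumerate_square: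
  assumes "k \<le> r"
  obtains f g :: "nat \<Rightarrow> nat" where
    "bij_betw (\<lambda>t. (f t, g t)) {..<r * r} ({..<r} \<times> {..<r})"
    "\<forall>t<r * r. part (delta k) t = int (k - (f t + g t))"
    "length (delta k) \<le> r * r"
proof -
  let ?Q = "{..<r} \<times> {..<r}"
  obtain L2 where L2: "set L2 = ?Q - set (triangle k)" "distinct L2"
    using finite_distinct_list[of "?Q - set (triangle k)"] by auto
  define L where "L = triangle k @ L2"
  have "set (triangle k) \<subseteq> ?Q" using triangle_set_distinct[of k] assms by auto
  then have L: "set L = ?Q" "distinct L"
    using L2 triangle_set_distinct[of k] by (auto simp: L_def)
  have len: "length L = r * r" using distinct_card[OF L(2)] L(1) by (simp add: card_cartesian_product)
  have len_delta: "length (delta k) = length (triangle k)" by (simp flip: map_triangle)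
  show ?thesis
  proof
    have "bij_betw ((!) L) {..<r * r} ?Q" using L len by (intro bij_betw_nth) auto
    then show "bij_betw (\<lambda>t. (fst (L ! t), snd (L ! t))) {..<r * r} ?Q" by simp
    have "part (delta k) t = int (k - (fst (L ! t) + snd (L ! t)))" if t: "t < r * r" for t
    proof (cases "t < length (triangle k)")
      case True
      then have "delta k ! t = (case triangle k ! t of (i, j) \<Rightarrow> k - (i + j))"
        by (simp flip: map_triangle)
      then show ?thesis using True by (simp add: part_def len_delta L_def nth_append split_beta)
    next
      case False
      then have "L ! t \<in> set L2" using t len by (simp add: L_def nth_append)
      moreover have "set L2 = ?Q - {(i, j). i + j < k}" using L2(1) triangle_set_distinct[of k] by simp
      ultimately have "L ! t \<notin> {(i, j). i + j < k}" by simp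
      then have "k \<le> fst (L ! t) + snd (L ! t)" by (simp add: split_beta)
      then show ?thesis using False by (simp add: part_def len_delta)
    qed
    then show "\<forall>t<r * r. part (delta k) t = int (k - (fst (L ! t) + snd (L ! t)))" by blast
    show "length (delta k) \<le> r * r" using len by (simp add: len_delta L_def)
  qed
qed

theorem corollary1p3:
  fixes k m :: nat and lam mu nu :: "nat list"
  assumes "1 \<le> k"
    and "partition_of m lam" and "partition_of m mu" and "partition_of m nu"
  shows "\<exists>L\<ge>1. \<forall>n\<ge>L.
    kronecker (padd lam (pscale n (eta k))) (padd mu (pscale n (eta k))) (padd nu (pscale n (delta k)))
    = kronecker (padd lam (pscale L (eta k))) (padd mu (pscale L (eta k))) (padd nu (pscale L (delta k)))"
proof -
  have lam: "sorted_wrt (\<ge>) lam" "sum_list lam = m" and mu: "sorted_wrt (\<ge>) mu" "sum_list mu = m"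
    and nu: "sorted_wrt (\<ge>) nu" "sum_list nu = m"
    using assms by (auto simp: partition_of_def)
  \<comment> \<open>A bound for the lengths of the first two partitions, uniform in \<open>n\<close>; its square bounds the third.\<close>
  define r where "r = k + length lam + length mu + length nu"
  define s where "s = r * r"
  have "k \<le> r" by (simp add: r_def)
  then obtain f g where "bij_betw (\<lambda>t. (f t, g t)) {..<r * r} ({..<r} \<times> {..<r})"
    "\<forall>t<r * r. part (delta k) t = int (k - (f t + g t))" "length (delta k) \<le> r * r"
    by (rule enumerate_square)
  note bij = this(1)[folded s_def] and fg = this(2)[folded s_def, rule_format] and len_delta = this(3)[folded s_def]
  have "length nu \<le> r" by (simp add: r_def)
  moreover have "r \<le> r * r" by (rule le_square)
  ultimately have len_nu: "length nu \<le> s" unfolding s_def by (rule order_trans)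
  have bij_swap: "bij_betw (\<lambda>t. (g t, f t)) {..<s} ({..<r} \<times> {..<r})"
  proof -
    have "bij_betw prod.swap ({..<r} \<times> {..<r}) ({..<r} \<times> {..<r})"
      by (simp add: bij_betw_def product_swap)
    from bij_betw_trans[OF bij this] show ?thesis by (simp add: comp_def)
  qed
  have fg_lt: "f t < r \<and> g t < r" if "t < s" for t using bij_betwE[OF bij] that by auto
  have row: "(\<Sum>t | t < s \<and> f t = i. int (k - (f t + g t))) = part (eta k) i" if "i < r" for i
  proof -
    have "bij_betw g {t. t < s \<and> f t = i} {..<r}"
      using bij_betw_fibre[OF bij] that by simp
    then have "(\<Sum>j<r. int (k - (i + j))) = (\<Sum>t | t < s \<and> f t = i. int (k - (i + g t)))"
      by (rule sum.reindex_bij_betw[symmetric])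
    then show ?thesis using eta_row_sum[OF \<open>k \<le> r\<close>] by simp
  qed
  have col: "(\<Sum>t | t < s \<and> g t = j. int (k - (f t + g t))) = part (eta k) j" if "j < r" for j
  proof -
    have "bij_betw f {t. t < s \<and> g t = j} {..<r}"
      using bij_betw_fibre[OF bij_swap] that by simp
    then have "(\<Sum>i<r. int (k - (j + i))) = (\<Sum>t | t < s \<and> g t = j. int (k - (j + f t)))"
      by (rule sum.reindex_bij_betw[symmetric])
    also have "\<dots> = (\<Sum>t | t < s \<and> g t = j. int (k - (f t + g t)))"
      by (rule sum.cong) (auto simp: add.commute)
    finally show ?thesis using eta_row_sum[OF \<open>k \<le> r\<close>, of j] by simp
  qed
  define e where "e = sum_list (delta k)"
  have total: "(\<Sum>t<s. int (k - (f t + g t))) = int e"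
    using sum_part[OF len_delta] fg by (simp add: e_def)
  have len_eta: "length (eta k) \<le> r" by (simp add: eta_def r_def del: upt_Suc)
  have "(\<Sum>t<s. int (k - (f t + g t))) = (\<Sum>i<r. part (eta k) i)"
    using sum_by_fibres[of "{..<s}" f r "\<lambda>_. 1" "\<lambda>t. int (k - (f t + g t))"] fg_lt row by simp
  then have sum_eta: "sum_list (eta k) = e" using total sum_part[OF len_eta] by simp
  let ?lam = "\<lambda>n. padd lam (pscale n (eta k))" and ?mu = "\<lambda>n. padd mu (pscale n (eta k))"
    and ?nu = "\<lambda>n. padd nu (pscale n (delta k))"
  have part_sum: "part (padd al (pscale n be)) i = part al i + int n * part be i" for al be n i
    by (simp add: part_padd part_pscale)
  have eta_dec: "part (eta k) (Suc i) \<le> part (eta k) i" for i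
    unfolding part_eta by (simp add: binomial_right_mono)
  have sorted_sum: "sorted_wrt (\<ge>) (padd al (pscale n be))"
    if "sorted_wrt (\<ge>) al" "sorted_wrt (\<ge>) be" for al be n
    using that unfolding sorted_iff_part part_sum by (intro allI add_mono mult_left_mono) auto
  have size: "sum_list (padd al (pscale n be)) = sum_list al + n * sum_list be" for al be n
  proof -
    define N where "N = max (length al) (length be)"
    have "int (sum_list (padd al (pscale n be))) = (\<Sum>i<N. part (padd al (pscale n be)) i)"
      by (rule sum_part[symmetric]) (simp add: N_def length_padd length_pscale)
    also have "\<dots> = (\<Sum>i<N. part al i) + int n * (\<Sum>i<N. part be i)"
      by (simp add: part_sum sum.distrib sum_distrib_left)
    also have "\<dots> = int (sum_list al + n * sum_list be)"
      using sum_part[of al N] sum_part[of be N] by (simp add: N_def)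
    finally show ?thesis by (simp only: of_nat_eq_iff)
  qed
  have sorted_eta: "sorted_wrt (\<ge>) (eta k)" unfolding sorted_iff_part using eta_dec by blast
  let ?a = "\<lambda>q n i. part lam i + staircase r i - staircase r (q i) + int n * part (eta k) i"
  let ?b = "\<lambda>q n i. part mu i + staircase r i - staircase r (q i) + int n * part (eta k) i"
  let ?l = "\<lambda>n i. part nu i + staircase s i + int n * (if i < s then int (k - (f i + g i)) else 0)"
  define G where "G = (\<lambda>n. \<Sum>q\<in>Sym r. \<Sum>q'\<in>Sym r. sign q * sign q' *
      (\<Sum>A\<in>square_margins (m + n * e) s f g r (?a q n) (?b q' n). kostka s s A (?l n)))"
  have kron: "kronecker (?lam n) (?mu n) (?nu n) = of_int (G n)" for n
  proof -
    have "part (delta k) i = (if i < s then int (k - (f i + g i)) else 0)" for i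
      using fg len_delta by (auto simp: part_def)
    then have l: "(\<lambda>i. part (?nu n) i + staircase s i) = ?l n" by (simp add: part_sum fun_eq_iff)
    have a: "(\<lambda>i. part (?lam n) i + staircase r i - staircase r (q i)) = ?a q n"
      "(\<lambda>i. part (?mu n) i + staircase r i - staircase r (q i)) = ?b q n" for q
      by (simp_all add: part_sum fun_eq_iff)
    have "kronecker (?lam n) (?mu n) (?nu n) = of_int (\<Sum>q\<in>Sym r. \<Sum>q'\<in>Sym r. sign q * sign q' *
      (\<Sum>A\<in>square_margins (m + n * e) s f g r (\<lambda>i. part (?lam n) i + staircase r i - staircase r (q i))
         (\<lambda>i. part (?mu n) i + staircase r i - staircase r (q' i)). kostka s s A (\<lambda>i. part (?nu n) i + staircase s i)))"
      using len_eta len_delta len_nu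
      by (intro kronecker_expansion sorted_sum lam mu nu sorted_eta sorted_delta bij)
        (auto simp: size sum_eta lam mu nu e_def[symmetric] length_padd length_pscale r_def)
    then show ?thesis unfolding l a G_def .
  qed
  have "eventually_constant (\<lambda>n. \<Sum>A\<in>square_margins (m + n * e) s f g r (?a q n) (?b q' n). kostka s s A (?l n))" for q q'
  proof (rule sum_kostka_stable[where k = k])
    show "int (k - (f u + g u)) \<le> int (k - (f t + g t))" if "t \<le> u" "u < s" for t u
    proof -
      have "part (delta k) (Suc i) \<le> part (delta k) i" for i
        using sorted_delta[of k] unfolding sorted_iff_part by blast
      then have "part (delta k) u \<le> part (delta k) t"
        by (rule lift_Suc_antimono_le) (rule that(1))
      then show ?thesis using fg[of t] fg[of u] that by simp
    qed
    show "part nu (Suc i) \<le> part nu i" for i using nu(1) unfolding sorted_iff_part by blast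
    show "0 \<le> part nu i" for i by (simp add: part_def)
    show "f t < r \<and> g t < r" if "t < s" for t by (rule fg_lt[OF that])
    show "(\<Sum>t<s. int (k - (f t + g t))) = int e" by (rule total)
  qed (rule row col; assumption)+
  then have "eventually_constant G"
    unfolding G_def by (intro eventually_constant_sum finite_Sym eventually_constant_map[where F = "(*) _"])
  then obtain c N where N: "\<And>n. N \<le> n \<Longrightarrow> G n = c"
    unfolding eventually_constant_def eventually_sequentially by blast
  show ?thesis
  proof (intro exI[of _ "max N 1"] conjI allI impI)
    fix n assume "max N 1 \<le> n"
    then show "kronecker (?lam n) (?mu n) (?nu n) = kronecker (?lam (max N 1)) (?mu (max N 1)) (?nu (max N 1))"
      unfolding kron using N[of n] N[of "max N 1"] by simp
  qed simp
qed

end
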